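(* Let $H$ be a locally compact group, let $K$ be a locally compact abelian (LCA) group, let $\tau:H\to \mathrm{Aut}(K)$ be a continuous homomorphism, and let $u\in L^2(K)$ with $\widehat{u}\in L^1(\widehat{K})$. For $f\in L^2(G_\tau)$ define $\mathcal{V}_uf(h,s,\omega):=\delta(h)^{1/2}\langle f_h,\varrho(s,\omega)u\rangle_{L^2(K)}$. Then every $f\in L^2(G_\tau)$ with $\widehat{f_h}\in L^1(\widehat{K})$ for a.e. $h\in H$ satisfies the reconstruction formula $$f(h,k)=\delta(h)^{-1/2}\,\|u\|^{-2}_{L^2(K)}\int_{K\times\widehat{K}}\mathcal{V}_uf(h,s,\omega)\,[\varrho(s,\omega)u](k)\,ds\,d\omega.$$
   Context: $dh$ is a left Haar measure on $H$, $dk$ (or $ds$) a Haar measure on $K$ (written additively); $\widehat{K}$ is the dual group and $d\omega$ is the Plancherel measure on $\widehat K$ (normalized so that the Fourier transform $\widehat v(\omega)=\int_K v(k)\overline{\omega(k)}\,dk$ extends to a unitary map $L^2(K)\to L^2(\widehat K)$); for $v\in L^2(K)$, $\widehat v$ denotes this extension. Continuity of $\tau$ means that $(h,k)\mapsto\tau_h(k)$ is continuous from $H\times K$ to $K$. The continuous homomorphism $\delta:H\to(0,\infty)$ is determined by $dk=\delta(h)\,d(\tau_h(k))$, i.e. $\int_K v(\tau_h(k))\,dk=\delta(h)\int_K v(k)\,dk$ for $v\in L^1(K)$. $G_\tau=H\ltimes_\tau K$ is the semi-direct product (set $H\times K$, product topology, law $(h,k)(h',k')=(hh',k+\tau_h(k'))$)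 with left Haar measure $\delta(h)\,dh\,dk$, and $L^2(G_\tau)$ is taken with respect to it. For $f\in L^2(G_\tau)$, $f_h(k):=f(h,k)$, which lies in $L^2(K)$ for a.e. $h\in H$. The time-frequency shift is $[\varrho(s,\omega)u](y)=\omega(y)u(y-s)$ for $s,y\in K$, $\omega\in\widehat K$.
   Formalization: The integral over K×K̂ need not converge absolutely; it is read as a repeated integral, converging to the same value in both orders and equal to the product Lebesgue integral whenever that exists; u is assumed nonzero, and the identity holds for a.e. h and a.e. k. *)

theory Defs
  imports "HOL-Analysis.Analysis"
begin

section \<open>Haar measures\<close>

text \<open>
  Haar measures live on groups that need not be second countable or sigma-compact, so regularity
  is part of the definition.  The group law is an explicit argument, because the definition is
  used for additively written groups and for the semi-direct product law on pairs.
\<close>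

definition radon_measure :: "'a::topological_space measure \<Rightarrow> bool" where
  "radon_measure \<mu> \<longleftrightarrow>
     sets \<mu> = sets borel \<and>
     (\<forall>C. compact C \<longrightarrow> emeasure \<mu> C < \<infinity>) \<and>
     (\<forall>A\<in>sets borel. emeasure \<mu> A = (INF U\<in>{U. open U \<and> A \<subseteq> U}. emeasure \<mu> U)) \<and>
     (\<forall>U. open U \<longrightarrow> emeasure \<mu> U = (SUP C\<in>{C. compact C \<and> C \<subseteq> U}. emeasure \<mu> C))"

definition left_haar_measure ::
    "('a::topological_space \<Rightarrow> 'a \<Rightarrow> 'a) \<Rightarrow> 'a measure \<Rightarrow> bool" where
  "left_haar_measure m \<mu> \<longleftrightarrow>
     radon_measure \<mu> \<and> emeasure \<mu> UNIV \<noteq> 0 \<and>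
     (\<forall>x. \<forall>A\<in>sets borel. emeasure \<mu> (m x ` A) = emeasure \<mu> A)"

text \<open>
  The measure \<open>w(x) d\<mu>(x) d\<nu>(y)\<close> on the product space.  For measures that are not sigma-finite
  this is the Radon measure representing the functional below (unique by the Riesz
  representation theorem); its domain is the Borel algebra of the product topology, which may be
  larger than the product of the Borel algebras.
\<close>

definition radon_product ::
    "('a::topological_space \<Rightarrow> real) \<Rightarrow> 'a measure \<Rightarrow> 'b::topological_space measure
      \<Rightarrow> ('a \<times> 'b) measure \<Rightarrow> bool" where
  "radon_product w \<mu> \<nu> \<pi> \<longleftrightarrow>
     radon_measure \<pi> \<and>
     (\<forall>F :: 'a \<times> 'b \<Rightarrow> real.
        continuous_on UNIV F \<longrightarrow> (\<exists>C. compact C \<and> (\<forall>z. z \<notin> C \<longrightarrow> F z = 0)) \<longrightarrow>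
        (LINT z|\<pi>. F z) = (LINT x|\<mu>. w x * (LINT y|\<nu>. F (x, y))))"


section \<open>The spaces of square-integrable functions\<close>

definition L2 :: "'a measure \<Rightarrow> ('a \<Rightarrow> complex) set" where
  "L2 M = {v. v \<in> borel_measurable M \<and> integrable M (\<lambda>x. (cmod (v x))\<^sup>2)}"

definition L2_inner :: "'a measure \<Rightarrow> ('a \<Rightarrow> complex) \<Rightarrow> ('a \<Rightarrow> complex) \<Rightarrow> complex" where
  "L2_inner M v w = (LINT x|M. v x * cnj (w x))"

definition L2_norm :: "'a measure \<Rightarrow> ('a \<Rightarrow> complex) \<Rightarrow> real" where
  "L2_norm M v = sqrt (LINT x|M. (cmod (v x))\<^sup>2)"

text \<open>Unitary maps between the Hilbert spaces of classes modulo equality almost everywhere,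
  described on representatives.\<close>

definition L2_unitary ::
    "'a measure \<Rightarrow> 'b measure \<Rightarrow> (('a \<Rightarrow> complex) \<Rightarrow> 'b \<Rightarrow> complex) \<Rightarrow> bool" where
  "L2_unitary M N U \<longleftrightarrow>
     (\<forall>v\<in>L2 M. U v \<in> L2 N) \<and>
     (\<forall>v\<in>L2 M. \<forall>w\<in>L2 M. \<forall>c. AE y in N. U (\<lambda>x. c * v x + w x) y = c * U v y + U w y) \<and>
     (\<forall>v\<in>L2 M. \<forall>w\<in>L2 M. L2_inner N (U v) (U w) = L2_inner M v w) \<and>
     (\<forall>w\<in>L2 N. \<exists>v\<in>L2 M. AE y in N. U v y = w y)"


section \<open>The dual group\<close>

text \<open>The dual group is written additively: \<open>(\<omega> + \<psi>)(k) = \<omega>(k) \<psi>(k)\<close>.\<close>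

typedef (overloaded) ('a::topological_ab_group_add) dual =
  "{\<phi>. continuous_on (UNIV :: 'a set) \<phi> \<and> (\<forall>x y. \<phi> (x + y) = \<phi> x * \<phi> y) \<and> (\<forall>x. cmod (\<phi> x) = 1)}"
  morphisms char_at Abs_dual
  by (rule exI[of _ "\<lambda>_. 1"]) simp

lemma char_at_props:
  "continuous_on UNIV (char_at \<omega>)"
  "char_at \<omega> (x + y) = char_at \<omega> x * char_at \<omega> y"
  "cmod (char_at \<omega> x) = 1"
  using char_at[of \<omega>] by auto

instantiation dual :: (topological_ab_group_add) ab_group_add
begin

definition zero_dual :: "'a dual" where "0 = Abs_dual (\<lambda>_. 1)"
definition plus_dual :: "'a dual \<Rightarrow> 'a dual \<Rightarrow> 'a dual" where
  "\<omega> + \<psi> = Abs_dual (\<lambda>k. char_at \<omega> k * char_at \<psi> k)"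
definition uminus_dual :: "'a dual \<Rightarrow> 'a dual" where
  "- \<omega> = Abs_dual (\<lambda>k. cnj (char_at \<omega> k))"
definition minus_dual :: "'a dual \<Rightarrow> 'a dual \<Rightarrow> 'a dual" where
  "\<omega> - \<psi> = \<omega> + - (\<psi> :: 'a dual)"

lemma char_at_zero: "char_at (0 :: 'a dual) k = 1"
  unfolding zero_dual_def by (subst Abs_dual_inverse) auto

lemma char_at_plus: "char_at (\<omega> + \<psi> :: 'a dual) k = char_at \<omega> k * char_at \<psi> k"
  unfolding plus_dual_def
  by (subst Abs_dual_inverse) (auto simp: char_at_props norm_mult intro!: continuous_intros)

lemma char_at_uminus: "char_at (- \<omega> :: 'a dual) k = cnj (char_at \<omega> k)"
  unfolding uminus_dual_def
  by (subst Abs_dual_inverse) (auto simp: char_at_props intro!: continuous_intros)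

instance
proof
  fix a b c :: "'a dual"
  show "a + b + c = a + (b + c)" "a + b = b + a" "0 + a = a"
    by (auto simp: char_at_inject[symmetric] char_at_plus char_at_zero)
  have "cnj (char_at a k) * char_at a k = 1" for k
    using complex_norm_square[of "char_at a k"] by (simp add: char_at_props mult.commute)
  then show "- a + a = 0"
    by (auto simp: char_at_inject[symmetric] char_at_plus char_at_zero char_at_uminus)
  show "a - b = a + - b" by (rule minus_dual_def)
qed

end

definition dual_nbhd :: "'a::topological_ab_group_add dual \<Rightarrow> 'a set \<Rightarrow> real \<Rightarrow> 'a dual set" where
  "dual_nbhd \<omega> C e = {\<psi>. \<forall>k\<in>C. cmod (char_at \<psi> k - char_at \<omega> k) < e}"

text \<open>The topology of uniform convergence on compact sets, i.e. the compact-open topology.\<close>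

instantiation dual :: (topological_ab_group_add) topological_space
begin

definition open_dual :: "'a dual set \<Rightarrow> bool" where
  "open S \<longleftrightarrow> (\<forall>\<omega>\<in>S. \<exists>C e. compact C \<and> 0 < e \<and> dual_nbhd \<omega> C e \<subseteq> S)"

instance
proof
  show "open (UNIV :: 'a dual set)"
    unfolding open_dual_def by (auto intro!: exI[of _ "{}"] exI[of _ 1])
next
  fix S T :: "'a dual set" assume "open S" "open T"
  show "open (S \<inter> T)"
    unfolding open_dual_def
  proof
    fix \<omega> assume "\<omega> \<in> S \<inter> T"
    with \<open>open S\<close> \<open>open T\<close> obtain C e D d
      where "compact C" "0 < e" "dual_nbhd \<omega> C e \<subseteq> S"
        and "compact D" "0 < d" "dual_nbhd \<omega> D d \<subseteq> T"
      unfolding open_dual_def by (meson IntD1 IntD2)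
    then have "compact (C \<union> D) \<and> 0 < min e d \<and> dual_nbhd \<omega> (C \<union> D) (min e d) \<subseteq> S \<inter> T"
      by (force simp: dual_nbhd_def)
    then show "\<exists>C e. compact C \<and> 0 < e \<and> dual_nbhd \<omega> C e \<subseteq> S \<inter> T" by blast
  qed
next
  fix \<K> :: "'a dual set set" assume "\<forall>S\<in>\<K>. open S"
  then show "open (\<Union>\<K>)"
    unfolding open_dual_def by (meson Union_iff Union_upper order_trans)
qed

end

lemma open_dual_nbhd:
  assumes "compact C" shows "open (dual_nbhd \<omega> C e)"
  unfolding open_dual_def
proof
  fix \<psi> assume \<psi>: "\<psi> \<in> dual_nbhd \<omega> C e"
  show "\<exists>D d. compact D \<and> 0 < d \<and> dual_nbhd \<psi> D d \<subseteq> dual_nbhd \<omega> C e"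
  proof (cases "C = {}")
    case True
    then show ?thesis by (intro exI[of _ "{}"] exI[of _ 1]) (auto simp: dual_nbhd_def)
  next
    case False
    have "continuous_on C (\<lambda>k. cmod (char_at \<psi> k - char_at \<omega> k))"
      by (intro continuous_intros continuous_on_subset[OF char_at_props(1)]) auto
    from continuous_attains_sup[OF assms False this]
    obtain k0 where k0: "k0 \<in> C"
      "\<And>k. k \<in> C \<Longrightarrow> cmod (char_at \<psi> k - char_at \<omega> k) \<le> cmod (char_at \<psi> k0 - char_at \<omega> k0)"
      by auto
    define d where "d = e - cmod (char_at \<psi> k0 - char_at \<omega> k0)"
    have "0 < d" using \<psi> k0(1) by (auto simp: d_def dual_nbhd_def)
    moreover have "dual_nbhd \<psi> C d \<subseteq> dual_nbhd \<omega> C e"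
    proof
      fix \<phi> assume \<phi>: "\<phi> \<in> dual_nbhd \<psi> C d"
      show "\<phi> \<in> dual_nbhd \<omega> C e"
        unfolding dual_nbhd_def
      proof safe
        fix k assume k: "k \<in> C"
        have "cmod (char_at \<phi> k - char_at \<psi> k) < d" using \<phi> k by (auto simp: dual_nbhd_def)
        moreover have "cmod (char_at \<phi> k - char_at \<omega> k)
            \<le> cmod (char_at \<phi> k - char_at \<psi> k) + cmod (char_at \<psi> k - char_at \<omega> k)"
          by (metis add_diff_cancel diff_add_cancel group_cancel.sub1 norm_triangle_ineq)
        ultimately show "cmod (char_at \<phi> k - char_at \<omega> k) < e"
          using k0(2)[OF k] by (simp add: d_def)
      qed
    qed
    ultimately show ?thesis using assms by blast
  qed
qed

lemma eventually_nhds_dual: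
  "eventually P (nhds (\<omega> :: 'a::topological_ab_group_add dual)) \<longleftrightarrow>
     (\<exists>C e. compact C \<and> 0 < e \<and> (\<forall>\<psi>\<in>dual_nbhd \<omega> C e. P \<psi>))"
proof
  assume "eventually P (nhds \<omega>)"
  then obtain S where "open S" "\<omega> \<in> S" "\<forall>\<psi>\<in>S. P \<psi>" by (auto simp: eventually_nhds)
  then show "\<exists>C e. compact C \<and> 0 < e \<and> (\<forall>\<psi>\<in>dual_nbhd \<omega> C e. P \<psi>)"
    unfolding open_dual_def by (meson subsetD)
next
  assume "\<exists>C e. compact C \<and> 0 < e \<and> (\<forall>\<psi>\<in>dual_nbhd \<omega> C e. P \<psi>)"
  then obtain C e where *: "compact C" "0 < e" "\<forall>\<psi>\<in>dual_nbhd \<omega> C e. P \<psi>" by blast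
  then show "eventually P (nhds \<omega>)"
    unfolding eventually_nhds
    by (intro exI[of _ "dual_nbhd \<omega> C e"]) (auto simp: open_dual_nbhd, auto simp: dual_nbhd_def)
qed

lemma filterlim_nhds_dual:
  "filterlim f (nhds (\<omega> :: 'a::topological_ab_group_add dual)) F \<longleftrightarrow>
     (\<forall>C e. compact C \<longrightarrow> 0 < e \<longrightarrow> eventually (\<lambda>x. f x \<in> dual_nbhd \<omega> C e) F)"
  unfolding filterlim_iff eventually_nhds_dual
proof (intro iffI allI impI)
  fix C :: "'a set" and e :: real
  assume *: "\<forall>P. (\<exists>C e. compact C \<and> 0 < e \<and> (\<forall>\<psi>\<in>dual_nbhd \<omega> C e. P \<psi>)) \<longrightarrow> eventually (\<lambda>x. P (f x)) F"
    and "compact C" "0 < e"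
  then show "eventually (\<lambda>x. f x \<in> dual_nbhd \<omega> C e) F"
    using *[rule_format, of "\<lambda>\<psi>. \<psi> \<in> dual_nbhd \<omega> C e"] by blast
next
  fix P :: "'a dual \<Rightarrow> bool"
  assume *: "\<forall>C e. compact C \<longrightarrow> 0 < e \<longrightarrow> eventually (\<lambda>x. f x \<in> dual_nbhd \<omega> C e) F"
    and "\<exists>C e. compact C \<and> 0 < e \<and> (\<forall>\<psi>\<in>dual_nbhd \<omega> C e. P \<psi>)"
  then obtain C e where "compact C" "0 < e" and P: "\<forall>\<psi>\<in>dual_nbhd \<omega> C e. P \<psi>" by blast
  with * have "eventually (\<lambda>x. f x \<in> dual_nbhd \<omega> C e) F" by blast
  then show "eventually (\<lambda>x. P (f x)) F" by (rule eventually_mono) (use P in blast)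
qed

instance dual :: (topological_ab_group_add) topological_ab_group_add
proof
  fix a b :: "'a dual"
  show "filterlim (\<lambda>x. fst x + snd x) (nhds (a + b)) (nhds a \<times>\<^sub>F nhds b)"
    unfolding filterlim_nhds_dual
  proof (intro allI impI)
    fix C :: "'a set" and e :: real assume C: "compact C" and e: "0 < e"
    have "eventually (\<lambda>x. x \<in> dual_nbhd a C (e/2)) (nhds a)"
         "eventually (\<lambda>x. x \<in> dual_nbhd b C (e/2)) (nhds b)"
      using C e by (auto simp: eventually_nhds_dual intro!: exI[of _ C] exI[of _ "e/2"])
    then have "eventually (\<lambda>x. fst x \<in> dual_nbhd a C (e/2) \<and> snd x \<in> dual_nbhd b C (e/2))
        (nhds a \<times>\<^sub>F nhds b)"
      by (auto simp: eventually_prod_filter)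
    then show "eventually (\<lambda>x. fst x + snd x \<in> dual_nbhd (a + b) C e) (nhds a \<times>\<^sub>F nhds b)"
    proof (rule eventually_mono)
      fix x assume x: "fst x \<in> dual_nbhd a C (e/2) \<and> snd x \<in> dual_nbhd b C (e/2)"
      show "fst x + snd x \<in> dual_nbhd (a + b) C e"
        unfolding dual_nbhd_def
      proof safe
        fix k assume k: "k \<in> C"
        let ?p = "char_at (fst x) k" and ?q = "char_at (snd x) k"
        let ?a = "char_at a k" and ?b = "char_at b k"
        have "?p * ?q - ?a * ?b = (?p - ?a) * ?q + ?a * (?q - ?b)" by (simp add: algebra_simps)
        then have "cmod (?p * ?q - ?a * ?b) \<le> cmod (?p - ?a) + cmod (?q - ?b)"
          using norm_triangle_ineq[of "(?p - ?a) * ?q" "?a * (?q - ?b)"]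
          by (simp add: norm_mult char_at_props)
        also have "\<dots> < e" using x k by (force simp: dual_nbhd_def)
        finally show "cmod (char_at (fst x + snd x) k - char_at (a + b) k) < e"
          by (simp add: char_at_plus)
      qed
    qed
  qed
  show "filterlim uminus (nhds (- a)) (nhds a)"
    unfolding filterlim_nhds_dual
  proof (intro allI impI)
    fix C :: "'a set" and e :: real assume C: "compact C" and e: "0 < e"
    have "- x \<in> dual_nbhd (- a) C e" if "x \<in> dual_nbhd a C e" for x
    proof -
      have "cmod (cnj (char_at x k) - cnj (char_at a k)) = cmod (char_at x k - char_at a k)" for k
        by (metis complex_cnj_diff complex_mod_cnj)
      then show ?thesis using that by (simp add: dual_nbhd_def char_at_uminus)
    qed
    then show "eventually (\<lambda>x. - x \<in> dual_nbhd (- a) C e) (nhds a)"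
      unfolding eventually_nhds_dual using C e by blast
  qed
qed

instance dual :: (topological_ab_group_add) t2_space
proof
  fix a b :: "'a dual" assume "a \<noteq> b"
  then obtain k where k: "char_at a k \<noteq> char_at b k" by (auto simp: char_at_inject[symmetric])
  define e where "e = cmod (char_at a k - char_at b k) / 2"
  have "dual_nbhd a {k} e \<inter> dual_nbhd b {k} e = {}"
  proof -
    have False if "cmod (z - char_at a k) < e" "cmod (z - char_at b k) < e" for z
      using that norm_triangle_ineq4[of "z - char_at b k" "z - char_at a k"] by (simp add: e_def)
    then show ?thesis by (auto simp: dual_nbhd_def)
  qed
  moreover have "0 < e" using k by (simp add: e_def)
  ultimately show "\<exists>U V. open U \<and> open V \<and> a \<in> U \<and> b \<in> V \<and> U \<inter> V = {}"
    by (intro exI[of _ "dual_nbhd a {k} e"] exI[of _ "dual_nbhd b {k} e"] conjI open_dual_nbhd)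
       (auto simp: dual_nbhd_def)
qed


section \<open>Fourier transform and Plancherel measure\<close>

definition fourier :: "'k::topological_ab_group_add measure \<Rightarrow> ('k \<Rightarrow> complex) \<Rightarrow> 'k dual \<Rightarrow> complex" where
  "fourier \<mu>K v \<omega> = (LINT k|\<mu>K. v k * cnj (char_at \<omega> k))"

definition plancherel_map ::
    "'k::topological_ab_group_add measure \<Rightarrow> 'k dual measure
      \<Rightarrow> (('k \<Rightarrow> complex) \<Rightarrow> 'k dual \<Rightarrow> complex) \<Rightarrow> bool" where
  "plancherel_map \<mu>K \<mu>D U \<longleftrightarrow>
     L2_unitary \<mu>K \<mu>D U \<and>
     (\<forall>v\<in>L2 \<mu>K. integrable \<mu>K v \<longrightarrow> (AE \<omega> in \<mu>D. U v \<omega> = fourier \<mu>K v \<omega>))"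

definition plancherel_measure ::
    "'k::topological_ab_group_add measure \<Rightarrow> 'k dual measure \<Rightarrow> bool" where
  "plancherel_measure \<mu>K \<mu>D \<longleftrightarrow>
     left_haar_measure (+) \<mu>D \<and> (\<exists>U. plancherel_map \<mu>K \<mu>D U)"

text \<open>Integrable square-integrable functions are dense, so the extension below is unique up to
  equality almost everywhere.\<close>

definition plancherel ::
    "'k::topological_ab_group_add measure \<Rightarrow> 'k dual measure \<Rightarrow> ('k \<Rightarrow> complex) \<Rightarrow> 'k dual \<Rightarrow> complex" where
  "plancherel \<mu>K \<mu>D = (SOME U. plancherel_map \<mu>K \<mu>D U)"


section \<open>Semi-direct products\<close>

definition Aut :: "('k::topological_ab_group_add \<Rightarrow> 'k) set" where
  "Aut = {\<alpha>. (\<forall>k k'. \<alpha> (k + k') = \<alpha> k + \<alpha> k') \<and> (\<exists>\<beta>. homeomorphism UNIV UNIV \<alpha> \<beta>)}"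

text \<open>The group \<open>H\<close> is in general not commutative; its law is written \<open>+\<close> because that is the
  notation of the library class of topological groups.\<close>

definition continuous_action ::
    "('h::topological_group_add \<Rightarrow> 'k::topological_ab_group_add \<Rightarrow> 'k) \<Rightarrow> bool" where
  "continuous_action \<tau> \<longleftrightarrow>
     (\<forall>h. \<tau> h \<in> Aut) \<and> (\<forall>h h'. \<tau> (h + h') = \<tau> h \<circ> \<tau> h') \<and>
     continuous_on UNIV (\<lambda>(h, k). \<tau> h k)"

definition modular_character ::
    "('h::topological_group_add \<Rightarrow> 'k::topological_ab_group_add \<Rightarrow> 'k) \<Rightarrow> 'k measure
      \<Rightarrow> ('h \<Rightarrow> real) \<Rightarrow> bool" where
  "modular_character \<tau> \<mu>K \<delta> \<longleftrightarrow>
     (\<forall>h. 0 < \<delta> h) \<and> (\<forall>h h'. \<delta> (h + h') = \<delta> h * \<delta> h') \<and> continuous_on UNIV \<delta> \<and>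
     (\<forall>h. \<forall>v :: 'k \<Rightarrow> complex. integrable \<mu>K v \<longrightarrow>
        (LINT k|\<mu>K. v (\<tau> h k)) = complex_of_real (\<delta> h) * (LINT k|\<mu>K. v k))"

definition semidirect_mult ::
    "('h::topological_group_add \<Rightarrow> 'k::topological_ab_group_add \<Rightarrow> 'k) \<Rightarrow> 'h \<times> 'k \<Rightarrow> 'h \<times> 'k \<Rightarrow> 'h \<times> 'k" where
  "semidirect_mult \<tau> = (\<lambda>(h, k) (h', k'). (h + h', k + \<tau> h k'))"

definition semidirect_haar ::
    "('h::topological_group_add \<Rightarrow> 'k::topological_ab_group_add \<Rightarrow> 'k) \<Rightarrow> ('h \<Rightarrow> real)
      \<Rightarrow> 'h measure \<Rightarrow> 'k measure \<Rightarrow> ('h \<times> 'k) measure \<Rightarrow> bool" where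
  "semidirect_haar \<tau> \<delta> \<mu>H \<mu>K \<mu>G \<longleftrightarrow>
     left_haar_measure (semidirect_mult \<tau>) \<mu>G \<and> radon_product \<delta> \<mu>H \<mu>K \<mu>G"


section \<open>The partial Gabor transform\<close>

definition tf_shift ::
    "'k::topological_ab_group_add \<Rightarrow> 'k dual \<Rightarrow> ('k \<Rightarrow> complex) \<Rightarrow> 'k \<Rightarrow> complex" where
  "tf_shift s \<omega> u y = char_at \<omega> y * u (y - s)"

definition partial_gabor ::
    "'k::topological_ab_group_add measure \<Rightarrow> ('h \<Rightarrow> real) \<Rightarrow> ('k \<Rightarrow> complex) \<Rightarrow> ('h \<times> 'k \<Rightarrow> complex)
      \<Rightarrow> 'h \<Rightarrow> 'k \<Rightarrow> 'k dual \<Rightarrow> complex" where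
  "partial_gabor \<mu>K \<delta> u f h s \<omega> =
     complex_of_real (\<delta> h powr (1/2)) * L2_inner \<mu>K (\<lambda>k. f (h, k)) (tf_shift s \<omega> u)"


section \<open>Integrals over a product\<close>

definition has_iterated_integral ::
    "'a measure \<Rightarrow> 'b measure \<Rightarrow> ('a \<Rightarrow> 'b \<Rightarrow> complex) \<Rightarrow> complex \<Rightarrow> bool" where
  "has_iterated_integral \<mu> \<nu> F I \<longleftrightarrow>
     (AE x in \<mu>. integrable \<nu> (F x)) \<and>
     integrable \<mu> (\<lambda>x. LINT y|\<nu>. F x y) \<and>
     (LINT x|\<mu>. LINT y|\<nu>. F x y) = I"

text \<open>
  The reconstruction integral over \<open>K \<times> K^\<close> need not converge absolutely.  For \<open>K = \<real>\<close> take \<open>u^\<close> the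
  indicator of \<open>[0,1]\<close> and \<open>f\<^sub>h^\<close> the sum over \<open>n \<ge> 2\<close> of the indicators of
  \<open>[2n, 2n + 1/(n (ln n)^2)]\<close>: then \<open>f\<^sub>h^\<close> is integrable and square-integrable, but the integrand is not
  integrable on the product.  So the integral is read as a repeated integral, required to
  converge to the same value in both orders, and to agree with the Lebesgue integral with respect
  to the product measure whenever the latter exists.
\<close>

definition has_product_integral ::
    "'a::topological_space measure \<Rightarrow> 'b::topological_space measure \<Rightarrow> ('a \<Rightarrow> 'b \<Rightarrow> complex)
      \<Rightarrow> complex \<Rightarrow> bool" where
  "has_product_integral \<mu> \<nu> F I \<longleftrightarrow>
     has_iterated_integral \<mu> \<nu> F I \<and>
     has_iterated_integral \<nu> \<mu> (\<lambda>y x. F x y) I \<and>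
     (\<forall>\<pi>. radon_product (\<lambda>_. 1) \<mu> \<nu> \<pi> \<longrightarrow> integrable \<pi> (\<lambda>z. F (fst z) (snd z)) \<longrightarrow>
        (LINT z|\<pi>. F (fst z) (snd z)) = I)"

end

theory Submission
  imports Defs
begin

text \<open>
  Write \<open>v\<close> for the section \<open>f\<^sub>h\<close>, where \<open>h\<close> lies outside a null set, and let \<open>p\<close>, \<open>q\<close> be the Fourier transforms of \<open>v\<close> and \<open>u\<close>; both lie in \<open>L\<^sup>1\<close> and
  \<open>L\<^sup>2\<close> of the dual group.  By Fourier inversion \<open>v\<close> and \<open>u\<close> agree almost everywhere with the inverse
  transforms of \<open>p\<close> and \<open>q\<close>, and Parseval's formula turns \<open>\<langle>v, \<rho>(s,\<omega>)u\<rangle>\<close> into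
  \<open>G(s,\<omega>) = \<integral> p(\<xi>) q(\<xi>-\<omega>)\<^sup>* (\<xi>-\<omega>)(s) d\<xi>\<close>, where the star denotes complex conjugation.

  Integrate \<open>G(s,\<omega>) \<omega>(k) u(k-s)\<close> over \<open>\<omega>\<close> first.  The substitution \<open>\<eta> = \<xi>-\<omega>\<close> decouples the resulting
  double integral over the dual group, absolutely convergent because \<open>p\<close> and \<open>q\<close> are integrable, into
  \<open>v(k) u(k-s)\<^sup>* u(k-s)\<close>, and the integral of this over \<open>s\<close> is \<open>v(k) \<parallel>u\<parallel>\<^sup>2\<close>.
  Integrate over \<open>s\<close> first.  The function \<open>G(\<cdot>,\<omega>)\<close> is the inverse transform of
  \<open>g\<^sub>\<omega>(\<xi>) = p(\<xi>+\<omega>) q(\<xi>)\<^sup>*\<close>, which is square-integrable for almost every \<open>\<omega>\<close> since the double integral of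
  \<open>|p(\<xi>+\<omega>)|\<^sup>2 |q(\<xi>)|\<^sup>2\<close> is \<open>\<parallel>p\<parallel>\<^sup>2 \<parallel>q\<parallel>\<^sup>2\<close>.  For such \<open>\<omega>\<close> Parseval's formula evaluates the integral over \<open>s\<close> as
  \<open>\<integral> p(\<xi>+\<omega>) (\<xi>+\<omega>)(k) |q(\<xi>)|\<^sup>2 d\<xi>\<close>, and the integral of this over \<open>\<omega>\<close> is \<open>v(k) \<parallel>q\<parallel>\<^sup>2 = v(k) \<parallel>u\<parallel>\<^sup>2\<close>.

  The substance of the formal proof is measure theory on groups that need not be second countable.
  A function such as \<open>(\<xi>,\<omega>) \<mapsto> q(\<xi>-\<omega>)\<close> is Borel for the product topology, but in general not measurable
  for the product of the Borel algebras, so Fubini's theorem for products of sigma-finite measures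
  does not apply to it.  The replacement \<open>radon_fubini\<close> comes from the fact that integration against a
  Radon measure commutes with directed suprema of lower semicontinuous functions
  (\<open>directed_lower_semicont\<close>): an open set in a product is the directed union of the finite unions
  of open rectangles in it, for which the classical theorem holds, so the two iterated measures agree
  on the open, hence on the Borel subsets of sigma-finite open rectangles.  With compactly supported continuous functions in place of
  rectangles, the same principle gives Fubini's theorem for Radon products (\<open>radon_product_fubini\<close>).
  That theorem shows that almost every section of \<open>f\<close> is square-integrable, and that the
  reconstruction integral over the product agrees with the repeated ones whenever it exists.

  Fourier inversion (\<open>inversion\<close>) is deduced from the Plancherel map alone, by pairing with indicator
  functions.  Two facts on Haar measures enter besides: they are invariant under inversion of an
  abelian group (\<open>haar_distr_uminus\<close>), and a group that carries one is locally compact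
  (\<open>haar_locally_compact\<close>), which makes Radon products with the dual group accessible.
\<close>

section \<open>Integration of lower semicontinuous functions\<close>

text \<open>
  The half of the Radon property on which the continuity of the integral along directed families of
  lower semicontinuous functions rests.
\<close>

definition open_inner_regular :: "'a::topological_space measure \<Rightarrow> bool" where
  "open_inner_regular M \<longleftrightarrow> sets M = sets borel \<and>
     (\<forall>U. open U \<longrightarrow> emeasure M U = (SUP C\<in>{C. compact C \<and> C \<subseteq> U}. emeasure M C))"

definition lower_semicont :: "('a::topological_space \<Rightarrow> ennreal) \<Rightarrow> bool" where
  "lower_semicont g \<longleftrightarrow> (\<forall>a. open {x. a < g x})"

lemma lower_semicont_measurable:
  assumes "lower_semicont g" "sets M = sets borel"
  shows "g \<in> borel_measurable M"
proof -
  have "g \<in> borel_measurable borel"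
    using assms(1) by (intro borel_measurableI_greater) (auto simp: lower_semicont_def)
  then show ?thesis using assms(2) by (simp cong: measurable_cong_sets)
qed

lemma lower_semicont_indicator: "open U \<Longrightarrow> lower_semicont (indicator U :: _ \<Rightarrow> ennreal)"
  unfolding lower_semicont_def
proof
  fix a :: ennreal assume "open U"
  have "{x. a < indicator U x} = (if a < 1 then U else {})"
    by (auto simp: indicator_def split: if_splits)
  then show "open {x. a < (indicator U x :: ennreal)}" using \<open>open U\<close> by simp
qed

lemma lower_semicont_continuous:
  fixes F :: "'a::topological_space \<Rightarrow> real"
  assumes "continuous_on UNIV F"
  shows "lower_semicont (\<lambda>x. ennreal (F x))"
  unfolding lower_semicont_def
proof
  fix a :: ennreal
  have "continuous_on UNIV (\<lambda>x. ennreal (F x))" using assms by (rule continuous_on_ennreal)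
  then have "open ((\<lambda>x. ennreal (F x)) -` {a<..})" by (intro open_vimage) auto
  then show "open {x. a < ennreal (F x)}" by (simp add: vimage_def)
qed

text \<open>
  At a point \<open>x\<close> the sum is \<open>h\<close> times the number of indices \<open>i\<close> with \<open>x \<in> C i\<close>, so at most \<open>(j + 1) h\<close>
  for the largest such index \<open>j\<close>.
\<close>

lemma staircase_le_nn_integral:
  fixes C :: "nat \<Rightarrow> 'a set" and \<phi> :: "'a \<Rightarrow> ennreal"
  assumes C: "\<And>i. C i \<in> sets M" and h: "0 < h"
    and le: "\<And>i x. i < m \<Longrightarrow> x \<in> C i \<Longrightarrow> ennreal (real (Suc i) * h) \<le> \<phi> x"
  shows "(\<Sum>i<m. ennreal h * emeasure M (C i)) \<le> (\<integral>\<^sup>+x. \<phi> x \<partial>M)"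
proof -
  have pt: "(\<Sum>i<m. ennreal h * indicator (C i) x) \<le> \<phi> x" for x
  proof -
    define J where "J = {i. i < m \<and> x \<in> C i}"
    have fin: "finite J" by (simp add: J_def)
    have "(\<Sum>i<m. ennreal h * indicator (C i) x) = (\<Sum>i\<in>J. ennreal h)"
      by (rule sum.mono_neutral_cong_right) (auto simp: J_def indicator_def)
    also have "\<dots> = ennreal (real (card J) * h)"
      using h by (simp add: ennreal_mult ennreal_of_nat_eq_real_of_nat)
    also have "\<dots> \<le> \<phi> x"
    proof (cases "J = {}")
      case False
      have "J \<subseteq> {..Max J}" using fin by auto
      then have "card J \<le> Suc (Max J)" by (metis card_atMost card_mono finite_atMost)
      then have "ennreal (real (card J) * h) \<le> ennreal (real (Suc (Max J)) * h)"
        using h by (intro ennreal_leI mult_right_mono) auto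
      also have "\<dots> \<le> \<phi> x" using Max_in[OF fin False] le by (auto simp: J_def)
      finally show ?thesis .
    qed simp
    finally show ?thesis .
  qed
  have "(\<Sum>i<m. ennreal h * emeasure M (C i)) = (\<integral>\<^sup>+x. (\<Sum>i<m. ennreal h * indicator (C i) x) \<partial>M)"
    using C by (subst nn_integral_sum) (auto simp: nn_integral_cmult)
  also have "\<dots> \<le> (\<integral>\<^sup>+x. \<phi> x \<partial>M)" by (intro nn_integral_mono pt)
  finally show ?thesis .
qed

text \<open>
  The sums \<open>\<Sum>i. h 1{g > (i + 1) h}\<close> converge to \<open>g\<close> from below, and the sets in them are open, so
  that inner regularity replaces them by compact ones.  Statements on integrals of lower
  semicontinuous functions thereby reduce to finitely many compact sets.
\<close>

lemma lower_semicont_staircase: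
  fixes M :: "'a::t2_space measure"
  assumes M: "open_inner_regular M" and g: "lower_semicont g" and c: "c < (\<integral>\<^sup>+x. g x \<partial>M)"
  obtains h :: real and m and C :: "nat \<Rightarrow> 'a set"
  where "0 < h" "\<And>i. compact (C i)" "\<And>i x. x \<in> C i \<Longrightarrow> ennreal (real (Suc i) * h) < g x"
    "c < (\<Sum>i<m. ennreal h * emeasure M (C i))"
proof -
  have sM: "sets M = sets borel" using M by (simp add: open_inner_regular_def)
  define h where "h N = 1 / real (Suc N)" for N
  define U where "U N i = {x. ennreal (real (Suc i) * h N) < g x}" for N i
  have oU: "open (U N i)" for N i using g by (simp add: U_def lower_semicont_def)
  have [measurable]: "U N i \<in> sets M" for N i using oU sM by auto
  define s :: "nat \<Rightarrow> 'a \<Rightarrow> ennreal"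
    where "s N x = (\<Sum>i<(Suc N)^2. ennreal (h N) * indicator (U N i) x)" for N x
  have h0: "0 < h N" for N by (simp add: h_def)
  have lim: "g x \<le> liminf (\<lambda>N. s N x)" for x
  proof (rule dense_le)
    fix a assume a: "a < g x"
    then obtain t where t: "a = ennreal t" "0 \<le> t" by (cases a) auto
    obtain b where b: "a < b" "b < g x" using a dense by blast
    then obtain r where r: "b = ennreal r" "0 \<le> r" by (cases b) auto
    have tr: "t < r" using b t r by (simp add: ennreal_less_iff)
    \<comment> \<open>With \<open>k\<close> levels below \<open>r\<close> and mesh \<open>1 / (N + 1) < r - t\<close>, the sum lies above \<open>t\<close>.\<close>
    obtain N0 where N0: "1 / (r - t) < real N0" "r < real N0"
      using reals_Archimedean2[of "max (1 / (r - t)) r"] by auto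
    have "ennreal t \<le> s N x" if N: "N \<ge> N0" for N
    proof -
      define k where "k = nat \<lfloor>r * real (Suc N)\<rfloor>"
      have kr: "real k \<le> r * real (Suc N)" "r * real (Suc N) < real k + 1"
        using r(2) by (auto simp: k_def) 
      have "real k \<le> real (Suc N) * real (Suc N)"
        using kr(1) N0(2) N by (smt (verit) mult_right_mono of_nat_Suc of_nat_0_le_iff of_nat_mono)
      then have k2: "k \<le> (Suc N)^2" unfolding power2_eq_square by (metis of_nat_le_iff of_nat_mult)
      have "t * real (Suc N) \<le> real k"
      proof -
        have "1 < (r - t) * real (Suc N)"
        proof -
          have "1 < (r - t) * real N0" using N0(1) tr by (simp add: field_simps)
          also have "\<dots> \<le> (r - t) * real (Suc N)" using N tr by (intro mult_left_mono) auto
          finally show ?thesis .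
        qed
        then show ?thesis using kr(2) by (simp add: algebra_simps)
      qed
      then have "t \<le> real k * h N" by (simp add: h_def field_simps)
      then have "ennreal t \<le> ennreal (real k * h N)" by (rule ennreal_leI)
      also have "\<dots> = (\<Sum>i<k. ennreal (h N) * indicator (U N i) x)"
      proof -
        have "x \<in> U N i" if "i < k" for i
        proof -
          have "real (Suc i) * h N \<le> real k * h N" using that h0[of N] by (intro mult_right_mono) auto
          also have "\<dots> \<le> r" using kr(1) by (simp add: h_def field_simps)
          finally have "ennreal (real (Suc i) * h N) \<le> b" using r by (simp add: ennreal_leI)
          then show ?thesis using b by (auto simp: U_def)
        qed
        then have "(\<Sum>i<k. ennreal (h N) * indicator (U N i) x) = (\<Sum>i<k. ennreal (h N))"
          by (intro sum.cong) auto
        then show ?thesis using h0[of N] by (simp add: ennreal_mult ennreal_of_nat_eq_real_of_nat)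
      qed
      also have "\<dots> \<le> s N x" unfolding s_def using k2 by (intro sum_mono2) auto
      finally show ?thesis .
    qed
    then have "\<forall>\<^sub>F N in sequentially. ennreal t \<le> s N x" by (auto simp: eventually_sequentially)
    then show "a \<le> liminf (\<lambda>N. s N x)" using t by (simp add: Liminf_bounded)
  qed
  have "c < (\<integral>\<^sup>+x. liminf (\<lambda>N. s N x) \<partial>M)"
    using c nn_integral_mono[OF lim] by (rule less_le_trans)
  also have "\<dots> \<le> liminf (\<lambda>N. \<integral>\<^sup>+x. s N x \<partial>M)"
    by (rule nn_integral_liminf) (simp add: s_def)
  finally have less: "c < liminf (\<lambda>N. \<integral>\<^sup>+x. s N x \<partial>M)" .
  have "\<exists>N. c < (\<integral>\<^sup>+x. s N x \<partial>M)"
  proof (rule ccontr)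
    assume "\<not> ?thesis"
    then have "liminf (\<lambda>N. \<integral>\<^sup>+x. s N x \<partial>M) \<le> c" by (intro Liminf_le) (auto simp: not_less)
    then show False using less by auto
  qed
  then obtain N where N: "c < (\<integral>\<^sup>+x. s N x \<partial>M)" by blast
  define m where "m = (Suc N)^2"
  have N': "c < (\<Sum>i<m. ennreal (h N) * emeasure M (U N i))"
  proof -
    have "(\<integral>\<^sup>+x. s N x \<partial>M) = (\<Sum>i<m. ennreal (h N) * emeasure M (U N i))"
      unfolding s_def m_def by (subst nn_integral_sum) (auto simp: nn_integral_cmult)
    then show ?thesis using N by simp
  qed
  have "\<exists>C. (\<forall>n. compact (C n) \<and> C n \<subseteq> U N i) \<and> (\<lambda>n::nat. emeasure M (C n)) \<longlonglongrightarrow> emeasure M (U N i)" for i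
  proof -
    let ?A = "emeasure M ` {C. compact C \<and> C \<subseteq> U N i}"
    have "?A \<noteq> {}" by auto
    from ennreal_Sup_countable_SUP[OF this] obtain f :: "nat \<Rightarrow> ennreal"
      where f: "incseq f" "range f \<subseteq> ?A" "Sup ?A = (SUP i. f i)" by blast
    then have "\<forall>n. \<exists>C. compact C \<and> C \<subseteq> U N i \<and> f n = emeasure M C" by auto
    then obtain C where C: "\<And>n. compact (C n) \<and> C n \<subseteq> U N i \<and> f n = emeasure M (C n)" by metis
    have "emeasure M (U N i) = (SUP i. f i)"
      using M oU f(3) by (simp add: open_inner_regular_def)
    then have "f \<longlonglongrightarrow> emeasure M (U N i)" using LIMSEQ_SUP[OF f(1)] by simp
    moreover have "f = (\<lambda>n. emeasure M (C n))" using C by auto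
    ultimately show ?thesis using C by auto
  qed
  then obtain C where C: "\<And>i n. compact (C i n)" "\<And>i n. C i n \<subseteq> U N i"
    "\<And>i. (\<lambda>n::nat. emeasure M (C i n)) \<longlonglongrightarrow> emeasure M (U N i)" by metis
  have "(\<lambda>n. \<Sum>i<m. ennreal (h N) * emeasure M (C i n)) \<longlonglongrightarrow> (\<Sum>i<m. ennreal (h N) * emeasure M (U N i))"
    by (intro tendsto_sum ennreal_tendsto_cmult C) auto
  from order_tendstoD(1)[OF this N'] obtain n
    where n: "c < (\<Sum>i<m. ennreal (h N) * emeasure M (C i n))"
    by (auto dest: eventually_happens)
  have "ennreal (real (Suc i) * h N) < g x" if "x \<in> C i n" for i x
    using C(2)[of i n] that by (auto simp: U_def)
  then show thesis
    using h0 C(1) n by (intro that[of "h N" "\<lambda>i. C i n" m]) auto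
qed

text \<open>
  Compactness makes finitely many members of the family suffice on each of the finitely many steps
  of a staircase below \<open>g\<close>, and a common upper bound of all of them has an integral above \<open>c\<close>.  For
  uncountable families this takes the place of monotone convergence.
\<close>

lemma directed_lower_semicont:
  fixes M :: "'a::t2_space measure" and \<F> :: "('a \<Rightarrow> ennreal) set"
  assumes M: "open_inner_regular M" and g: "lower_semicont g" and c: "c < (\<integral>\<^sup>+x. g x \<partial>M)"
    and ne: "\<F> \<noteq> {}" and dir: "\<And>\<phi> \<psi>. \<phi> \<in> \<F> \<Longrightarrow> \<psi> \<in> \<F> \<Longrightarrow> \<exists>\<eta>\<in>\<F>. \<phi> \<le> \<eta> \<and> \<psi> \<le> \<eta>"
    and lsc: "\<And>\<phi>. \<phi> \<in> \<F> \<Longrightarrow> lower_semicont \<phi>"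
    and sup: "\<And>x a. a < g x \<Longrightarrow> \<exists>\<phi>\<in>\<F>. a < \<phi> x"
  obtains \<phi> where "\<phi> \<in> \<F>" "c < (\<integral>\<^sup>+x. \<phi> x \<partial>M)"
proof -
  have sM: "sets M = sets borel" using M by (simp add: open_inner_regular_def)
  obtain h m C where h: "0 < h" and C: "\<And>i. compact (C i)"
    "\<And>i x. x \<in> C i \<Longrightarrow> ennreal (real (Suc i) * h) < g x"
    and cs: "c < (\<Sum>i<m. ennreal h * emeasure M (C i))"
    using lower_semicont_staircase[OF M g c] by metis
  have fin: "\<exists>\<eta>\<in>\<F>. \<forall>\<phi>\<in>D. \<phi> \<le> \<eta>" if "finite D" "D \<subseteq> \<F>" for D
    using that
  proof (induction D)
    case (insert \<phi> D)
    then obtain \<eta> where "\<eta> \<in> \<F>" "\<forall>\<phi>\<in>D. \<phi> \<le> \<eta>" by auto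
    moreover obtain \<eta>' where "\<eta>' \<in> \<F>" "\<eta> \<le> \<eta>'" "\<phi> \<le> \<eta>'" using dir insert.prems calculation by blast
    ultimately show ?case by (intro bexI[of _ \<eta>']) (auto intro: order_trans)
  qed (use ne in auto)
  have step: "\<exists>\<phi>\<in>\<F>. \<forall>x\<in>C i. ennreal (real (Suc i) * h) < \<phi> x" for i
  proof -
    let ?a = "ennreal (real (Suc i) * h)"
    have cov: "C i \<subseteq> (\<Union>\<phi>\<in>\<F>. {x. ?a < \<phi> x})" using C(2) sup by blast
    have op: "\<And>\<phi>. \<phi> \<in> \<F> \<Longrightarrow> open {x. ?a < \<phi> x}" using lsc by (auto simp: lower_semicont_def)
    obtain D where D: "D \<subseteq> \<F>" "finite D" "C i \<subseteq> (\<Union>\<phi>\<in>D. {x. ?a < \<phi> x})"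
      using compactE_image[OF C(1) op cov] by blast
    from fin[OF D(2,1)] obtain \<eta> where "\<eta> \<in> \<F>" "\<forall>\<phi>\<in>D. \<phi> \<le> \<eta>" by auto
    then have le: "\<phi> x \<le> \<eta> x" if "\<phi> \<in> D" for \<phi> x using that by (simp add: le_fun_def)
    have "?a < \<eta> x" if x: "x \<in> C i" for x
    proof -
      obtain \<phi> where "\<phi> \<in> D" "?a < \<phi> x" using D(3) x by blast
      then show ?thesis using le less_le_trans by blast
    qed
    with \<open>\<eta> \<in> \<F>\<close> show ?thesis by blast
  qed
  then obtain \<phi> where \<phi>: "\<And>i. \<phi> i \<in> \<F>" "\<And>i x. x \<in> C i \<Longrightarrow> ennreal (real (Suc i) * h) < \<phi> i x" by metis
  obtain \<eta> where \<eta>: "\<eta> \<in> \<F>" "\<forall>\<psi>\<in>\<phi> ` {..<m}. \<psi> \<le> \<eta>"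
    using fin[of "\<phi> ` {..<m}"] \<phi>(1) by auto
  have "c < (\<integral>\<^sup>+x. \<eta> x \<partial>M)"
  proof (rule less_le_trans[OF cs], rule staircase_le_nn_integral[OF _ h])
    show "C i \<in> sets M" for i using C(1) sM by (auto intro: borel_closed compact_imp_closed)
    show "ennreal (real (Suc i) * h) \<le> \<eta> x" if "i < m" "x \<in> C i" for i x
      using \<eta>(2) \<phi>(2)[OF that(2)] that(1) by (auto simp: le_fun_def intro: less_imp_le less_le_trans)
  qed
  with \<eta>(1) show thesis by (rule that)
qed

text \<open>
  By the tube lemma a staircase below \<open>\<Phi> (x, _)\<close> stays below \<open>\<Phi> (x', _)\<close> for \<open>x'\<close> near \<open>x\<close>.
\<close>

lemma lower_semicont_nn_integral:
  fixes N :: "'b::t2_space measure" and \<Phi> :: "'a::topological_space \<times> 'b \<Rightarrow> ennreal"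
  assumes N: "open_inner_regular N" and \<Phi>: "lower_semicont \<Phi>"
  shows "lower_semicont (\<lambda>x. \<integral>\<^sup>+y. \<Phi> (x, y) \<partial>N)"
  unfolding lower_semicont_def
proof
  fix c
  show "open {x. c < (\<integral>\<^sup>+y. \<Phi> (x, y) \<partial>N)}"
  proof (rule Topological_Spaces.openI)
    fix x assume "x \<in> {x. c < (\<integral>\<^sup>+y. \<Phi> (x, y) \<partial>N)}"
    then have c: "c < (\<integral>\<^sup>+y. \<Phi> (x, y) \<partial>N)" by simp
    have sN: "sets N = sets borel" using N by (simp add: open_inner_regular_def)
    have lx: "lower_semicont (\<lambda>y. \<Phi> (x, y))"
      unfolding lower_semicont_def
    proof
      fix a
      have "open (Pair x -` {z. a < \<Phi> z})"
        using \<Phi> by (intro open_vimage) (auto simp: lower_semicont_def intro!: continuous_intros)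
      then show "open {y. a < \<Phi> (x, y)}" by (simp add: vimage_def)
    qed
    obtain h m C where h: "0 < h" and C: "\<And>i. compact (C i)"
      "\<And>i y. y \<in> C i \<Longrightarrow> ennreal (real (Suc i) * h) < \<Phi> (x, y)"
      and cs: "c < (\<Sum>i<m. ennreal h * emeasure N (C i))"
      using lower_semicont_staircase[of N "\<lambda>y. \<Phi> (x, y)" c, OF N lx c] by metis
    have "\<exists>X. x \<in> X \<and> open X \<and> X \<times> C i \<subseteq> {z. ennreal (real (Suc i) * h) < \<Phi> z}" for i
      by (rule Elementary_Topology.tube_lemma[OF C(1)]) (use C(2) \<Phi> in \<open>auto simp: lower_semicont_def\<close>)
    then obtain X where X: "\<And>i. x \<in> X i" "\<And>i. open (X i)"
      "\<And>i. X i \<times> C i \<subseteq> {z. ennreal (real (Suc i) * h) < \<Phi> z}" by metis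
    have "c < (\<integral>\<^sup>+y. \<Phi> (x', y) \<partial>N)" if "x' \<in> (\<Inter>i<m. X i)" for x'
    proof (rule less_le_trans[OF cs], rule staircase_le_nn_integral[OF _ h])
      show "C i \<in> sets N" for i using C(1) sN by (auto intro: borel_closed compact_imp_closed)
      show "ennreal (real (Suc i) * h) \<le> \<Phi> (x', y)" if "i < m" "y \<in> C i" for i y
        using X(3)[of i] that \<open>x' \<in> _\<close> by (auto intro!: less_imp_le)
    qed
    moreover have "open (\<Inter>i<m. X i)" using X(2) by (intro open_INT) auto
    ultimately show "\<exists>T. open T \<and> x \<in> T \<and> T \<subseteq> {x. c < (\<integral>\<^sup>+y. \<Phi> (x, y) \<partial>N)}"
      using X(1) by (intro exI[of _ "\<Inter>i<m. X i"]) auto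
  qed
qed

section \<open>Disintegration of Borel measures on product spaces\<close>

lemma measurable_Pair_left_borel:
  assumes "\<Phi> \<in> borel_measurable (borel :: ('a::topological_space \<times> 'b::topological_space) measure)"
    "sets N = sets (borel :: 'b measure)"
  shows "(\<lambda>y. \<Phi> (x, y)) \<in> borel_measurable N"
proof -
  have "Pair x \<in> (borel :: 'b measure) \<rightarrow>\<^sub>M borel"
    by (intro borel_measurable_continuous_onI continuous_intros)
  from measurable_compose[OF this assms(1)] show ?thesis
    using assms(2) by (simp cong: measurable_cong_sets)
qed

lemma section_borel:
  assumes "S \<in> sets (borel :: ('a::topological_space \<times> 'b::topological_space) measure)"
    "sets N = sets (borel :: 'b measure)"
  shows "Pair x -` S \<in> sets N"
proof -
  have "Pair x \<in> (borel :: 'b measure) \<rightarrow>\<^sub>M borel"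
    by (intro borel_measurable_continuous_onI continuous_intros)
  from measurable_sets[OF this assms(1)] show ?thesis using assms(2) by simp
qed

lemma open_section:
  fixes V :: "('a::topological_space \<times> 'b::topological_space) set"
  assumes "open V" shows "open (Pair x -` V)"
  using assms by (intro open_vimage continuous_intros)

lemma borel_swap: "prod.swap \<in> (borel :: ('a::topological_space \<times> 'b::topological_space) measure)
    \<rightarrow>\<^sub>M borel"
  by (intro borel_measurable_continuous_onI) (auto simp: prod.swap_def intro!: continuous_intros)

lemma borel_induct_open [consumes 1, case_names basic compl union]:
  assumes S: "S \<in> sets (borel :: 'a::topological_space measure)"
    and op: "\<And>V. open V \<Longrightarrow> Q V"
    and compl: "\<And>A. A \<in> sets borel \<Longrightarrow> Q A \<Longrightarrow> Q (- A)"
    and union: "\<And>A :: nat \<Rightarrow> 'a set. disjoint_family A \<Longrightarrow> (\<And>i. A i \<in> sets borel) \<Longrightarrow>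
      (\<And>i. Q (A i)) \<Longrightarrow> Q (\<Union>i. A i)"
  shows "Q S"
proof -
  have b: "sets (borel :: 'a measure) = sigma_sets UNIV {V. open V}"
    by (simp add: borel_def)
  have "Int_stable {V :: 'a set. open V}" by (auto simp: Int_stable_def)
  moreover have "S \<in> sigma_sets UNIV {V. open V}" using S b by simp
  ultimately show ?thesis
  proof (induction rule: sigma_sets_induct_disjoint[where \<Omega> = UNIV, OF _ subset_UNIV[of "{V. open
      V}", folded Pow_UNIV], consumes 2, case_names basic empty compl union])
    case (compl A) then show ?case using assms(3)[of A] b by (simp add: Compl_eq_Diff_UNIV)
  next
    case (union A) then show ?case using assms(4)[of A] b by auto
  qed (use op in auto)
qed

text \<open>
  Only open sets are constrained.  The restriction to subsets of \<open>R\<close> accommodates measures that are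
  defined as the iterated measure of \<open>S \<inter> R\<close>.
\<close>

definition disintegrates_on ::
    "('a \<times> 'b) set \<Rightarrow> ('a::topological_space \<times> 'b::topological_space) measure \<Rightarrow> 'a measure \<Rightarrow> 'b
        measure \<Rightarrow> bool" where
  "disintegrates_on R P M N \<longleftrightarrow>
     sets P = sets borel \<and> sets M = sets borel \<and> sets N = sets borel \<and>
     (\<forall>V. open V \<longrightarrow> V \<subseteq> R \<longrightarrow>
        (\<lambda>x. emeasure N (Pair x -` V)) \<in> borel_measurable M \<and>
        emeasure P V = (\<integral>\<^sup>+x. emeasure N (Pair x -` V) \<partial>M))"

text \<open>
  The sets with the stated property form a Dynkin system.  Complements need sections of finite
  measure; the sections of \<open>V\<close> have finite measure outside a null set, and \<open>g\<close> is zero on that set.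
\<close>

lemma disintegrates_on_borel:
  assumes D: "disintegrates_on R P M N" and V: "open V" "V \<subseteq> R" "emeasure P V < \<infinity>"
    and S: "S \<in> sets borel"
  obtains g where "g \<in> borel_measurable M" "AE x in M. g x = emeasure N (Pair x -` (S \<inter> V))"
    "emeasure P (S \<inter> V) = (\<integral>\<^sup>+x. g x \<partial>M)"
proof -
  have sP: "sets P = sets borel" and sM: "sets M = sets borel" and sN: "sets N = sets borel"
    and meas: "\<And>V. open V \<Longrightarrow> V \<subseteq> R \<Longrightarrow> (\<lambda>x. emeasure N (Pair x -` V)) \<in> borel_measurable M"
    and PV: "\<And>V. open V \<Longrightarrow> V \<subseteq> R \<Longrightarrow> emeasure P V = (\<integral>\<^sup>+x. emeasure N (Pair x -` V) \<partial>M)"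
    using D by (auto simp: disintegrates_on_def)
  define F where "F = {x \<in> space M. emeasure N (Pair x -` V) < \<infinity>}"
  have mF[measurable]: "F \<in> sets M"
    using meas[OF V(1,2)] unfolding F_def by measurable
  have "AE x in M. emeasure N (Pair x -` V) \<noteq> \<infinity>"
    using PV[OF V(1,2)] V(3) meas[OF V(1,2)] by (intro nn_integral_PInf_AE) auto
  then have aeF: "AE x in M. x \<in> F" by (auto simp: F_def less_top)
  define G where "G S x = (if x \<in> F then emeasure N (Pair x -` (S \<inter> V)) else 0)" for S x
  have bV: "V \<in> sets borel" using V(1) by auto
  have fin: "emeasure N (Pair x -` (S \<inter> V)) \<noteq> \<infinity>" if "x \<in> F" for x S
  proof -
    have "emeasure N (Pair x -` (S \<inter> V)) \<le> emeasure N (Pair x -` V)"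
      using section_borel[OF bV sN] by (intro emeasure_mono) auto
    then show ?thesis using that by (auto simp: F_def less_top[symmetric] top_unique)
  qed
  have "G S \<in> borel_measurable M \<and> emeasure P (S \<inter> V) = (\<integral>\<^sup>+x. G S x \<partial>M)"
    using S
  proof (induction rule: borel_induct_open)
    case (basic S)
    then have o: "open (S \<inter> V)" "S \<inter> V \<subseteq> R" using V by auto
    have "(\<integral>\<^sup>+x. G S x \<partial>M) = (\<integral>\<^sup>+x. emeasure N (Pair x -` (S \<inter> V)) \<partial>M)"
      using aeF by (intro nn_integral_cong_AE) (auto simp: G_def)
    moreover have "G S \<in> borel_measurable M"
      using meas[OF o] unfolding G_def by measurable
    ultimately show ?case using PV[OF o] by simp
  next
    case (compl A)
    have GU: "G UNIV \<in> borel_measurable M" "emeasure P V = (\<integral>\<^sup>+x. G UNIV x \<partial>M)"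
    proof -
      show "G UNIV \<in> borel_measurable M" using meas[OF V(1,2)] unfolding G_def Int_UNIV_left by
          measurable
      have "(\<integral>\<^sup>+x. G UNIV x \<partial>M) = (\<integral>\<^sup>+x. emeasure N (Pair x -` V) \<partial>M)"
        using aeF by (intro nn_integral_cong_AE) (auto simp: G_def)
      then show "emeasure P V = (\<integral>\<^sup>+x. G UNIV x \<partial>M)" using PV[OF V(1,2)] by simp
    qed
    have eq: "G (- A) x = G UNIV x - G A x" for x
    proof (cases "x \<in> F")
      case True
      have "Pair x -` (- A \<inter> V) = Pair x -` V - Pair x -` (A \<inter> V)" by auto
      moreover have "emeasure N (Pair x -` V - Pair x -` (A \<inter> V)) =
          emeasure N (Pair x -` V) - emeasure N (Pair x -` (A \<inter> V))"
        by (rule emeasure_Diff) (use fin[OF True] section_borel[OF _ sN] bV compl(1) in auto)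
      ultimately show ?thesis using True by (simp add: G_def)
    qed (simp add: G_def)
    have le: "emeasure P (A \<inter> V) \<le> emeasure P V" using bV sP by (intro emeasure_mono) auto
    have "emeasure P (- A \<inter> V) = emeasure P (V - (A \<inter> V))" by (rule arg_cong[of _ _ "emeasure P"]) auto
    also have "\<dots> = emeasure P V - emeasure P (A \<inter> V)"
      by (rule emeasure_Diff) (use le V(3) bV compl(1) sP in \<open>auto simp: top_unique\<close>)
    also have "\<dots> = (\<integral>\<^sup>+x. G UNIV x \<partial>M) - (\<integral>\<^sup>+x. G A x \<partial>M)" using compl GU by simp
    also have "\<dots> = (\<integral>\<^sup>+x. G UNIV x - G A x \<partial>M)"
    proof (rule nn_integral_diff[symmetric])
      show "(\<integral>\<^sup>+x. G A x \<partial>M) \<noteq> \<infinity>" using compl le V(3) by (auto simp: top_unique)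
      show "AE x in M. G A x \<le> G UNIV x"
      proof (rule AE_I2)
        fix x
        have "emeasure N (Pair x -` (A \<inter> V)) \<le> emeasure N (Pair x -` V)"
          using section_borel[OF bV sN] by (intro emeasure_mono) auto
        then show "G A x \<le> G UNIV x" by (simp add: G_def)
      qed
    qed (use compl GU in auto)
    finally have "emeasure P (- A \<inter> V) = (\<integral>\<^sup>+x. G (- A) x \<partial>M)" using eq by simp
    moreover have "G (- A) \<in> borel_measurable M"
    proof -
      have "G (- A) = (\<lambda>x. G UNIV x - G A x)" using eq by auto
      moreover have [measurable]: "G UNIV \<in> borel_measurable M" "G A \<in> borel_measurable M" using GU
          compl by auto
      have "(\<lambda>x. G UNIV x - G A x) \<in> borel_measurable M" by measurable
      ultimately show ?thesis by simp
    qed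
    ultimately show ?case by blast
  next
    case (union A)
    have eq: "G (\<Union>i. A i) x = (\<Sum>i. G (A i) x)" for x
    proof (cases "x \<in> F")
      case True
      have "(\<Sum>i. emeasure N (Pair x -` (A i \<inter> V))) = emeasure N (\<Union>i. Pair x -` (A i \<inter> V))"
      proof (rule suminf_emeasure)
        show "range (\<lambda>i. Pair x -` (A i \<inter> V)) \<subseteq> sets N"
          using section_borel[OF _ sN] union(2) bV by auto
        show "disjoint_family (\<lambda>i. Pair x -` (A i \<inter> V))"
          using union(1) by (auto simp: disjoint_family_on_def)
      qed
      moreover have "(\<Union>i. Pair x -` (A i \<inter> V)) = Pair x -` ((\<Union>i. A i) \<inter> V)" by auto
      ultimately show ?thesis using True by (simp add: G_def)
    qed (simp add: G_def)
    have "emeasure P ((\<Union>i. A i) \<inter> V) = (\<Sum>i. emeasure P (A i \<inter> V))"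
    proof -
      have "(\<Sum>i. emeasure P (A i \<inter> V)) = emeasure P (\<Union>i. A i \<inter> V)"
        by (rule suminf_emeasure) (use union bV sP in \<open>auto simp: disjoint_family_on_def\<close>)
      moreover have "(\<Union>i. A i \<inter> V) = (\<Union>i. A i) \<inter> V" by auto
      ultimately show ?thesis by simp
    qed
    also have "\<dots> = (\<integral>\<^sup>+x. (\<Sum>i. G (A i) x) \<partial>M)"
      using union(3) by (subst nn_integral_suminf) auto
    finally have "emeasure P ((\<Union>i. A i) \<inter> V) = (\<integral>\<^sup>+x. G (\<Union>i. A i) x \<partial>M)" using eq by simp
    moreover have "G (\<Union>i. A i) \<in> borel_measurable M"
    proof -
      have "G (\<Union>i. A i) = (\<lambda>x. \<Sum>i. G (A i) x)" using eq by auto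
      moreover have [measurable]: "G (A i) \<in> borel_measurable M" for i using union(3) by auto
      have "(\<lambda>x. \<Sum>i. G (A i) x) \<in> borel_measurable M" by measurable
      ultimately show ?thesis by simp
    qed
    ultimately show ?case by blast
  qed
  moreover have "AE x in M. G S x = emeasure N (Pair x -` (S \<inter> V))"
    using aeF by eventually_elim (simp add: G_def)
  ultimately show thesis using that[of "G S"] by blast
qed

text \<open>
  The usual passage from sets to functions; null sets are collected along the way, because
  \<open>disintegrates_on_borel\<close> determines section measures only almost everywhere.
\<close>

lemma disintegrates_on_nn_integral:
  fixes \<Phi> :: "'a::topological_space \<times> 'b::topological_space \<Rightarrow> ennreal"
  assumes D: "disintegrates_on R P M N" and W: "incseq W" "\<And>n. open (W n)" "\<And>n. W n \<subseteq> R"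
    "\<And>n. emeasure P (W n) < \<infinity>" and \<Phi>: "\<Phi> \<in> borel_measurable borel"
    and van: "\<And>z. z \<notin> (\<Union>n. W n) \<Longrightarrow> \<Phi> z = 0"
  obtains g where "g \<in> borel_measurable M" "AE x in M. g x = (\<integral>\<^sup>+y. \<Phi> (x, y) \<partial>N)"
    "(\<integral>\<^sup>+z. \<Phi> z \<partial>P) = (\<integral>\<^sup>+x. g x \<partial>M)"
proof -
  have sP: "sets P = sets borel" and sM: "sets M = sets borel" and sN: "sets N = sets borel"
    using D by (auto simp: disintegrates_on_def)
  have mP: "borel_measurable P = borel_measurable borel" using sP by (rule measurable_cong_sets) simp
  define Q where "Q \<Phi> \<longleftrightarrow> (\<exists>g. g \<in> borel_measurable M \<and> (AE x in M. g x = (\<integral>\<^sup>+y. \<Phi> (x, y) \<partial>N)) \<and>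
    (\<integral>\<^sup>+z. \<Phi> z \<partial>P) = (\<integral>\<^sup>+x. g x \<partial>M))" for \<Phi> :: "'a \<times> 'b \<Rightarrow> ennreal"
  have Q_sup: "Q (\<lambda>z. SUP i. U i z)"
    if U: "\<And>i::nat. U i \<in> borel_measurable borel" "incseq U" "\<And>i. Q (U i)" for U
  proof -
    have "\<exists>g. \<forall>i. g i \<in> borel_measurable M \<and> (AE x in M. g i x = (\<integral>\<^sup>+y. U i (x, y) \<partial>N)) \<and>
      (\<integral>\<^sup>+z. U i z \<partial>P) = (\<integral>\<^sup>+x. g i x \<partial>M)" using U(3) unfolding Q_def by (rule choice[OF allI])
    then obtain g where g: "\<And>i. g i \<in> borel_measurable M"
      "\<And>i. AE x in M. g i x = (\<integral>\<^sup>+y. U i (x, y) \<partial>N)" "\<And>i. (\<integral>\<^sup>+z. U i z \<partial>P) = (\<integral>\<^sup>+x. g i x \<partial>M)" by blast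
    have all: "AE x in M. \<forall>i. g i x = (\<integral>\<^sup>+y. U i (x, y) \<partial>N)" using g(2) by (simp add: AE_all_countable)
    have inc: "incseq (\<lambda>i y. U i (x, y))" for x
      using U(2) by (auto simp: incseq_def le_fun_def)
    have "(\<integral>\<^sup>+z. (SUP i. U i z) \<partial>P) = (SUP i. \<integral>\<^sup>+z. U i z \<partial>P)"
      using U mP by (intro nn_integral_monotone_convergence_SUP) auto
    also have "\<dots> = (SUP i. \<integral>\<^sup>+x. g i x \<partial>M)" using g(3) by simp
    also have "\<dots> = (\<integral>\<^sup>+x. (SUP i. g i x) \<partial>M)"
    proof (rule nn_integral_monotone_convergence_SUP_AE[symmetric])
      fix i
      show "AE x in M. g i x \<le> g (Suc i) x"
        using all
      proof eventually_elim
        case (elim x)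
        then show ?case using inc[of x] by (auto intro!: nn_integral_mono simp: incseq_Suc_iff
            le_fun_def)
      qed
    qed (use g in auto)
    finally have e: "(\<integral>\<^sup>+z. (SUP i. U i z) \<partial>P) = (\<integral>\<^sup>+x. (SUP i. g i x) \<partial>M)" .
    have "AE x in M. (SUP i. g i x) = (\<integral>\<^sup>+y. (SUP i. U i (x, y)) \<partial>N)"
      using all
    proof eventually_elim
      case (elim x)
      then show ?case
        using inc[of x] measurable_Pair_left_borel[OF U(1) sN]
        by (subst nn_integral_monotone_convergence_SUP) auto
    qed
    then show ?thesis unfolding Q_def using e g(1) by (intro exI[of _ "\<lambda>x. SUP i. g i x"]) auto
  qed
  have [measurable]: "W n \<in> sets borel" for n using W(2) by auto
  have QV: "Q (\<lambda>z. \<Phi> z * indicator (W n) z)" if "\<Phi> \<in> borel_measurable borel" for \<Phi> n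
    using that
  proof (induction rule: borel_measurable_induct)
    case (cong f g)
    then have "f = g" by auto
    then show ?case using cong by simp
  next
    case (set A)
    then have A: "A \<in> sets borel" by simp
    obtain g where g: "g \<in> borel_measurable M" "AE x in M. g x = emeasure N (Pair x -` (A \<inter> W n))"
      "emeasure P (A \<inter> W n) = (\<integral>\<^sup>+x. g x \<partial>M)"
      by (rule disintegrates_on_borel[OF D W(2,3,4) A])
    have AW: "A \<inter> W n \<in> sets borel" using A W(2) by auto
    have "(\<integral>\<^sup>+z. indicator A z * indicator (W n) z \<partial>P) = emeasure P (A \<inter> W n)"
      using AW sP by (simp add: indicator_inter_arith[symmetric])
    moreover have "(\<integral>\<^sup>+y. indicator A (x, y) * indicator (W n) (x, y) \<partial>N) = emeasure N (Pair x -` (A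
        \<inter> W n))" for x
    proof -
      have "(\<integral>\<^sup>+y. indicator A (x, y) * indicator (W n) (x, y) \<partial>N) = (\<integral>\<^sup>+y. indicator (Pair x -` (A
          \<inter> W n)) y \<partial>N)"
        by (intro nn_integral_cong) (auto split: split_indicator)
      also have "\<dots> = emeasure N (Pair x -` (A \<inter> W n))" using section_borel[OF AW sN] by simp
      finally show ?thesis .
    qed
    ultimately show ?case using g unfolding Q_def by auto
  next
    case (mult u c)
    then obtain g where g: "g \<in> borel_measurable M" "AE x in M. g x = (\<integral>\<^sup>+y. u (x, y) * indicator (W
        n) (x, y) \<partial>N)"
      "(\<integral>\<^sup>+z. u z * indicator (W n) z \<partial>P) = (\<integral>\<^sup>+x. g x \<partial>M)" unfolding Q_def by blast
    have u: "(\<lambda>z. u z * indicator (W n) z) \<in> borel_measurable borel" using mult(2) by measurable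
    have "(\<integral>\<^sup>+z. c * u z * indicator (W n) z \<partial>P) = c * (\<integral>\<^sup>+z. u z * indicator (W n) z \<partial>P)"
      using u mP by (subst nn_integral_cmult[symmetric]) (auto simp: mult.assoc)
    moreover have "(\<integral>\<^sup>+y. c * u (x, y) * indicator (W n) (x, y) \<partial>N) = c * (\<integral>\<^sup>+y. u (x, y) *
        indicator (W n) (x, y) \<partial>N)" for x
      using measurable_Pair_left_borel[OF u sN] by (subst nn_integral_cmult[symmetric]) (auto simp:
          mult.assoc)
    ultimately show ?case unfolding Q_def using g by (intro exI[of _ "\<lambda>x. c * g x"]) (auto simp:
        nn_integral_cmult)
  next
    case (add u v)
    obtain g where g: "g \<in> borel_measurable M" "AE x in M. g x = (\<integral>\<^sup>+y. u (x, y) * indicator (W n)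
        (x, y) \<partial>N)"
      "(\<integral>\<^sup>+z. u z * indicator (W n) z \<partial>P) = (\<integral>\<^sup>+x. g x \<partial>M)" using add unfolding Q_def by blast
    obtain h where h: "h \<in> borel_measurable M" "AE x in M. h x = (\<integral>\<^sup>+y. v (x, y) * indicator (W n)
        (x, y) \<partial>N)"
      "(\<integral>\<^sup>+z. v z * indicator (W n) z \<partial>P) = (\<integral>\<^sup>+x. h x \<partial>M)" using add unfolding Q_def by blast
    have u: "(\<lambda>z. u z * indicator (W n) z) \<in> borel_measurable borel" using add by measurable
    have v: "(\<lambda>z. v z * indicator (W n) z) \<in> borel_measurable borel" using add by measurable
    have "(\<integral>\<^sup>+z. (v z + u z) * indicator (W n) z \<partial>P) = (\<integral>\<^sup>+z. v z * indicator (W n) z \<partial>P) + (\<integral>\<^sup>+z. u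
        z * indicator (W n) z \<partial>P)"
      using u v mP by (subst nn_integral_add[symmetric]) (auto simp: distrib_right)
    moreover have "(\<integral>\<^sup>+y. (v (x, y) + u (x, y)) * indicator (W n) (x, y) \<partial>N) =
       (\<integral>\<^sup>+y. v (x, y) * indicator (W n) (x, y) \<partial>N) + (\<integral>\<^sup>+y. u (x, y) * indicator (W n) (x, y) \<partial>N)"
           for x
      using measurable_Pair_left_borel[OF u sN] measurable_Pair_left_borel[OF v sN]
      by (subst nn_integral_add[symmetric]) (auto simp: distrib_right)
    moreover have "AE x in M. h x + g x = (\<integral>\<^sup>+y. v (x, y) * indicator (W n) (x, y) \<partial>N) + (\<integral>\<^sup>+y. u
        (x, y) * indicator (W n) (x, y) \<partial>N)"
      using g(2) h(2) by eventually_elim simp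
    ultimately show ?case unfolding Q_def using g h by (intro exI[of _ "\<lambda>x. h x + g x"]) (auto simp:
        nn_integral_add)
  next
    case (seq U)
    have "Q (\<lambda>z. SUP i. U i z * indicator (W n) z)"
    proof (rule Q_sup)
      show "(\<lambda>z. U i z * indicator (W n) z) \<in> borel_measurable borel" for i using seq(1)[of i] by
          measurable
      show "incseq (\<lambda>i z. U i z * indicator (W n) z)" using seq(3)
        by (auto simp: incseq_def le_fun_def intro: mult_right_mono)
    qed (use seq in auto)
    moreover have "(\<lambda>z. SUP i. U i z * indicator (W n) z) = (\<lambda>z. (SUP i. U i) z * indicator (W n) z)"
      by (auto simp: fun_eq_iff image_comp split: split_indicator)
    ultimately show ?case by (simp del: SUP_apply Sup_apply)
  qed
  have "Q (\<lambda>z. SUP n. \<Phi> z * indicator (W n) z)"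
  proof (rule Q_sup)
    show "(\<lambda>z. \<Phi> z * indicator (W i) z) \<in> borel_measurable borel" for i using \<Phi> by measurable
    show "incseq (\<lambda>i z. \<Phi> z * indicator (W i) z)" using W(1)
      by (auto simp: incseq_def le_fun_def split: split_indicator)
  qed (rule QV[OF \<Phi>])
  moreover have "(\<lambda>z. SUP n. \<Phi> z * indicator (W n) z) = \<Phi>"
  proof
    fix z
    show "(SUP n. \<Phi> z * indicator (W n) z) = \<Phi> z"
    proof (cases "z \<in> (\<Union>n. W n)")
      case True
      then obtain n where "z \<in> W n" by blast
      then show ?thesis
        by (intro antisym SUP_least SUP_upper2[of n]) (auto split: split_indicator)
    qed (use van in auto)
  qed
  ultimately have "Q \<Phi>" by simp
  then show thesis using that unfolding Q_def by blast
qed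

text \<open>
  The partial integral is required to agree almost everywhere with an integrable function, not to
  be measurable itself.  This makes the notion linear in \<open>\<Phi>\<close>: a sum of partial integrals need not be
  the partial integral of the sum at points where one of the integrands is not integrable.
\<close>

definition iterated_integrable ::
    "'a measure \<Rightarrow> 'b measure \<Rightarrow> ('a \<times> 'b \<Rightarrow> complex) \<Rightarrow> complex \<Rightarrow> bool" where
  "iterated_integrable M N \<Phi> I \<longleftrightarrow> (AE x in M. integrable N (\<lambda>y. \<Phi> (x, y))) \<and>
     (\<exists>g. integrable M g \<and> (AE x in M. g x = (LINT y|N. \<Phi> (x, y))) \<and> (LINT x|M. g x) = I)"

lemma iterated_integrable_add:
  assumes "iterated_integrable M N \<Phi> I" "iterated_integrable M N \<Psi> J"
  shows "iterated_integrable M N (\<lambda>z. \<Phi> z + \<Psi> z) (I + J)"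
proof -
  obtain g h where g: "integrable M g" "AE x in M. g x = (LINT y|N. \<Phi> (x, y))" "(LINT x|M. g x) = I"
    and h: "integrable M h" "AE x in M. h x = (LINT y|N. \<Psi> (x, y))" "(LINT x|M. h x) = J"
    using assms unfolding iterated_integrable_def by blast
  have a: "AE x in M. integrable N (\<lambda>y. \<Phi> (x, y))" "AE x in M. integrable N (\<lambda>y. \<Psi> (x, y))"
    using assms unfolding iterated_integrable_def by blast+
  have "AE x in M. g x + h x = (LINT y|N. \<Phi> (x, y) + \<Psi> (x, y))"
    using g(2) h(2) a by eventually_elim simp
  moreover have "AE x in M. integrable N (\<lambda>y. \<Phi> (x, y) + \<Psi> (x, y))"
    using a by eventually_elim simp
  ultimately show ?thesis
    unfolding iterated_integrable_def using g h by (intro conjI exI[of _ "\<lambda>x. g x + h x"]) auto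
qed

lemma iterated_integrable_cmult:
  assumes "iterated_integrable M N \<Phi> I"
  shows "iterated_integrable M N (\<lambda>z. c * \<Phi> z) (c * I)"
proof -
  obtain g where g: "integrable M g" "AE x in M. g x = (LINT y|N. \<Phi> (x, y))" "(LINT x|M. g x) = I"
    using assms unfolding iterated_integrable_def by blast
  have a: "AE x in M. integrable N (\<lambda>y. \<Phi> (x, y))"
    using assms unfolding iterated_integrable_def by blast
  have "AE x in M. c * g x = (LINT y|N. c * \<Phi> (x, y))"
    using g(2) by eventually_elim simp
  moreover have "AE x in M. integrable N (\<lambda>y. c * \<Phi> (x, y))"
    using a by eventually_elim simp
  ultimately show ?thesis
    unfolding iterated_integrable_def using g by (intro conjI exI[of _ "\<lambda>x. c * g x"]) auto
qed

lemma iterated_integrable_nonneg: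
  fixes \<psi> :: "'a \<times> 'b \<Rightarrow> real"
  assumes pos: "\<And>z. 0 \<le> \<psi> z" and sec: "\<And>x. (\<lambda>y. \<psi> (x, y)) \<in> borel_measurable N"
    and int: "integrable P \<psi>" and g: "g \<in> borel_measurable M"
      "AE x in M. g x = (\<integral>\<^sup>+y. ennreal (\<psi> (x, y)) \<partial>N)" "(\<integral>\<^sup>+z. ennreal (\<psi> z) \<partial>P) = (\<integral>\<^sup>+x. g x \<partial>M)"
  shows "iterated_integrable M N (\<lambda>z. complex_of_real (\<psi> z)) (complex_of_real (LINT z|P. \<psi> z))"
proof -
  have fin: "(\<integral>\<^sup>+x. g x \<partial>M) = ennreal (LINT z|P. \<psi> z)"
    using g(3) nn_integral_eq_integral[OF int] pos by simp
  have gfin: "AE x in M. g x \<noteq> \<infinity>" using fin g(1) by (intro nn_integral_PInf_AE) auto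
  have I: "AE x in M. integrable N (\<lambda>y. \<psi> (x, y))"
    using g(2) gfin
  proof eventually_elim
    case (elim x)
    then show ?case using pos sec[of x] by (intro integrableI_nonneg) (auto simp: less_top)
  qed
  define h where "h x = enn2real (g x)" for x
  have nn: "(\<integral>\<^sup>+x. ennreal (h x) \<partial>M) = (\<integral>\<^sup>+x. g x \<partial>M)"
    using gfin by (intro nn_integral_cong_AE, eventually_elim) (auto simp: h_def less_top)
  have hm[measurable]: "h \<in> borel_measurable M" using g(1) unfolding h_def by measurable
  have hI: "integrable M h" using nn fin by (intro integrableI_nonneg) (auto simp: h_def)
  have "(LINT x|M. h x) = (LINT z|P. \<psi> z)"
    using nn fin by (subst integral_eq_nn_integral) (auto simp: h_def pos)
  moreover have "AE x in M. h x = (LINT y|N. \<psi> (x, y))"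
    using g(2)
  proof eventually_elim
    case (elim x)
    then show ?case using sec[of x] pos by (subst integral_eq_nn_integral) (auto simp: h_def)
  qed
  ultimately show ?thesis
    unfolding iterated_integrable_def using hI I by (intro conjI exI[of _ "\<lambda>x. complex_of_real (h
        x)"]) auto
qed

lemma complex_parts:
  "z = complex_of_real (max 0 (Re z)) + (-1) * complex_of_real (max 0 (- Re z))
     + \<i> * complex_of_real (max 0 (Im z)) + (- \<i>) * complex_of_real (max 0 (- Im z))"
  by (simp add: complex_eq_iff max_def)

text \<open>
  Positive and negative parts of the real and imaginary parts reduce this to
  \<open>disintegrates_on_nn_integral\<close>.
\<close>

lemma disintegrates_on_integral:
  fixes \<Phi> :: "'a::topological_space \<times> 'b::topological_space \<Rightarrow> complex"
  assumes D: "disintegrates_on R P M N" and W: "incseq W" "\<And>n. open (W n)" "\<And>n. W n \<subseteq> R"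
    "\<And>n. emeasure P (W n) < \<infinity>" and \<Phi>: "integrable P \<Phi>"
    and van: "\<And>z. z \<notin> (\<Union>n. W n) \<Longrightarrow> \<Phi> z = 0"
  shows "iterated_integrable M N \<Phi> (LINT z|P. \<Phi> z)"
proof -
  have sP: "sets P = sets borel" and sN: "sets N = sets borel"
    using D by (auto simp: disintegrates_on_def)
  have part: "iterated_integrable M N (\<lambda>z. complex_of_real (max 0 (f (\<Phi> z))))
      (complex_of_real (LINT z|P. max 0 (f (\<Phi> z))))" if f: "bounded_linear f" for f :: "complex \<Rightarrow> real"
  proof -
    have int: "integrable P (\<lambda>z. max 0 (f (\<Phi> z)))"
      using integrable_bounded_linear[OF f \<Phi>] by auto
    have m: "(\<lambda>z. max 0 (f (\<Phi> z))) \<in> borel_measurable borel"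
      using borel_measurable_integrable[OF int] sP by (simp cong: measurable_cong_sets)
    have f0: "f 0 = 0" using f by (simp add: linear_simps)
    obtain g where g: "g \<in> borel_measurable M" "AE x in M. g x = (\<integral>\<^sup>+y. ennreal (max 0 (f (\<Phi> (x,
        y)))) \<partial>N)"
      "(\<integral>\<^sup>+z. ennreal (max 0 (f (\<Phi> z))) \<partial>P) = (\<integral>\<^sup>+x. g x \<partial>M)"
      by (rule disintegrates_on_nn_integral[OF D W, of "\<lambda>z. ennreal (max 0 (f (\<Phi> z)))"])
        (use m van f0 in auto)
    show ?thesis
      by (rule iterated_integrable_nonneg[OF _ _ int g]) (use measurable_Pair_left_borel[OF m sN] in
          auto)
  qed
  have neg: "bounded_linear (\<lambda>z. - Re z)" "bounded_linear (\<lambda>z. - Im z)"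
    by (rule bounded_linear_minus bounded_linear_Re bounded_linear_Im)+
  let ?I = "\<lambda>f. complex_of_real (LINT z|P. max 0 (f (\<Phi> z)))"
  have "iterated_integrable M N (\<lambda>z. complex_of_real (max 0 (Re (\<Phi> z))) + (-1) * complex_of_real
      (max 0 (- Re (\<Phi> z)))
     + \<i> * complex_of_real (max 0 (Im (\<Phi> z))) + (- \<i>) * complex_of_real (max 0 (- Im (\<Phi> z))))
     (?I Re + (-1) * ?I (\<lambda>z. - Re z) + \<i> * ?I Im + (- \<i>) * ?I (\<lambda>z. - Im z))"
    by (intro iterated_integrable_add iterated_integrable_cmult part[OF bounded_linear_Re] part[OF
        bounded_linear_Im]
          part[OF neg(1)] part[OF neg(2)])
  moreover have "?I Re + (-1) * ?I (\<lambda>z. - Re z) + \<i> * ?I Im + (- \<i>) * ?I (\<lambda>z. - Im z) = (LINT z|P. \<Phi> z)"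
  proof -
    have i: "integrable P (\<lambda>z. complex_of_real (max 0 (f (\<Phi> z))))" if "bounded_linear f" for f
      using integrable_bounded_linear[OF that \<Phi>] by auto
    note ii = i[OF bounded_linear_Re] i[OF bounded_linear_Im] i[OF neg(1)] i[OF neg(2)]
    have "(LINT z|P. \<Phi> z) = (LINT z|P. complex_of_real (max 0 (Re (\<Phi> z))) + (-1) * complex_of_real
        (max 0 (- Re (\<Phi> z)))
     + \<i> * complex_of_real (max 0 (Im (\<Phi> z))) + (- \<i>) * complex_of_real (max 0 (- Im (\<Phi> z))))"
      by (subst complex_parts) simp
    then show ?thesis
      using ii by simp
  qed
  ultimately show ?thesis by (simp only: complex_parts[symmetric])
qed

lemma iterated_integrable_has_iterated_integral:
  assumes I: "iterated_integrable M N \<Phi> I" and m: "(\<lambda>x. LINT y|N. \<Phi> (x, y)) \<in> borel_measurable M"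
  shows "has_iterated_integral M N (\<lambda>x y. \<Phi> (x, y)) I"
proof -
  obtain g where g: "integrable M g" "AE x in M. g x = (LINT y|N. \<Phi> (x, y))" "(LINT x|M. g x) = I"
    using I unfolding iterated_integrable_def by blast
  have "integrable M (\<lambda>x. LINT y|N. \<Phi> (x, y)) \<longleftrightarrow> integrable M g"
    using m g by (intro integrable_cong_AE) auto
  moreover have "(LINT x|M. LINT y|N. \<Phi> (x, y)) = (LINT x|M. g x)"
    using m g by (intro integral_cong_AE) auto
  ultimately show ?thesis using I g unfolding has_iterated_integral_def iterated_integrable_def by simp
qed

section \<open>Measurability of partial integrals\<close>

text \<open>
  Integrable functions of a Radon measure vanish off such a set.  Openness keeps the restrictions to
  it within the reach of lower semicontinuity.
\<close>

definition sigma_open :: "'a::topological_space measure \<Rightarrow> 'a set \<Rightarrow> bool" where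
  "sigma_open M A \<longleftrightarrow> (\<exists>V::nat \<Rightarrow> 'a set. (\<forall>n. open (V n) \<and> emeasure M (V n) < \<infinity>) \<and> incseq V \<and> A = (\<Union>n.
      V n))"

lemma measurable_emeasure_section:
  fixes N :: "'b::t2_space measure" and S :: "('a::topological_space \<times> 'b) set"
  assumes N: "open_inner_regular N" and V: "open V" "emeasure N V < \<infinity>" and S: "S \<in> sets borel"
  shows "(\<lambda>x. emeasure N (Pair x -` S \<inter> V)) \<in> borel_measurable borel"
  using S
proof (induction rule: borel_induct_open)
  case (basic S)
  have sN: "sets N = sets borel" using N by (simp add: open_inner_regular_def)
  have "lower_semicont (\<lambda>x. \<integral>\<^sup>+y. indicator (S \<inter> UNIV \<times> V) (x, y) \<partial>N)"
    using basic V by (intro lower_semicont_nn_integral[OF N] lower_semicont_indicator open_Int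
        open_Times) auto
  moreover have "(\<integral>\<^sup>+y. indicator (S \<inter> UNIV \<times> V) (x, y) \<partial>N) = emeasure N (Pair x -` S \<inter> V)" for x
  proof -
    have "(\<integral>\<^sup>+y. indicator (S \<inter> UNIV \<times> V) (x, y) \<partial>N) = (\<integral>\<^sup>+y. indicator (Pair x -` S \<inter> V) y \<partial>N)"
      by (intro nn_integral_cong) (auto split: split_indicator)
    then show ?thesis using basic V sN section_borel[of S N x] by (simp add: sets.Int)
  qed
  ultimately show ?case by (auto intro: lower_semicont_measurable)
next
  case (compl A)
  have sN: "sets N = sets borel" using N by (simp add: open_inner_regular_def)
  have "emeasure N (Pair x -` (- A) \<inter> V) = emeasure N V - emeasure N (Pair x -` A \<inter> V)" for x
  proof -
    have "Pair x -` (- A) \<inter> V = V - (Pair x -` A \<inter> V)" by auto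
    moreover have "emeasure N (Pair x -` A \<inter> V) \<le> emeasure N V"
      using V sN by (intro emeasure_mono) auto
    ultimately show ?thesis
      using V emeasure_Diff[of N "Pair x -` A \<inter> V" V] section_borel[OF compl(1) sN, of x] sN
      by (metis Int_lower2 borel_open infinity_ennreal_def less_top order.strict_trans1 sets.Int)
  qed
  then show ?case using compl by simp
next
  case (union A)
  have sN: "sets N = sets borel" using N by (simp add: open_inner_regular_def)
  have "emeasure N (Pair x -` (\<Union>i. A i) \<inter> V) = (\<Sum>i. emeasure N (Pair x -` A i \<inter> V))" for x
  proof -
    have "(\<Sum>i. emeasure N (Pair x -` A i \<inter> V)) = emeasure N (\<Union>i. Pair x -` A i \<inter> V)"
    proof (rule suminf_emeasure)
      show "range (\<lambda>i. Pair x -` A i \<inter> V) \<subseteq> sets N"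
        using section_borel[OF _ sN] union(2) V(1) sN by (auto intro!: sets.Int)
      show "disjoint_family (\<lambda>i. Pair x -` A i \<inter> V)"
        using union(1) by (auto simp: disjoint_family_on_def)
    qed
    moreover have "(\<Union>i. Pair x -` A i \<inter> V) = Pair x -` (\<Union>i. A i) \<inter> V" by auto
    ultimately show ?thesis by simp
  qed
  then show ?case using union(3) by simp
qed

lemma measurable_nn_integral_section:
  fixes N :: "'b::t2_space measure" and \<Phi> :: "'a::topological_space \<times> 'b \<Rightarrow> ennreal"
  assumes N: "open_inner_regular N" and B: "sigma_open N B" and \<Phi>: "\<Phi> \<in> borel_measurable borel"
    and van: "\<And>x y. y \<notin> B \<Longrightarrow> \<Phi> (x, y) = 0"
  shows "(\<lambda>x. \<integral>\<^sup>+y. \<Phi> (x, y) \<partial>N) \<in> borel_measurable borel"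
proof -
  have sN: "sets N = sets borel" using N by (simp add: open_inner_regular_def)
  obtain V where V: "\<And>n. open (V n)" "\<And>n. emeasure N (V n) < \<infinity>" "incseq V" "B = (\<Union>n::nat. V n)"
    using B unfolding sigma_open_def by blast
  have [measurable]: "V n \<in> sets N" for n using V(1) sN by auto
  have fin: "(\<lambda>x. \<integral>\<^sup>+y. \<Phi> (x, y) * indicator (V n) y \<partial>N) \<in> borel_measurable borel"
    if "\<Phi> \<in> borel_measurable borel" for \<Phi> :: "'a \<times> 'b \<Rightarrow> ennreal" and n
    using that
  proof (induction rule: borel_measurable_induct)
    case (cong f g)
    then have "f = g" by auto
    then show ?case using cong by simp
  next
    case (set A)
    have "(\<integral>\<^sup>+y. indicator A (x, y) * indicator (V n) y \<partial>N) = emeasure N (Pair x -` A \<inter> V n)" for x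
    proof -
      have "(\<integral>\<^sup>+y. indicator A (x, y) * indicator (V n) y \<partial>N) = (\<integral>\<^sup>+y. indicator (Pair x -` A \<inter> V n)
          y \<partial>N)"
        by (intro nn_integral_cong) (auto split: split_indicator)
      then show ?thesis using section_borel[OF set sN, of x] by (simp add: sets.Int)
    qed
    then show ?case using measurable_emeasure_section[OF N V(1,2) set] by simp
  next
    case (mult u c)
    have [measurable]: "(\<lambda>y. u (x, y)) \<in> borel_measurable N" for x
      using mult(2) sN by (rule measurable_Pair_left_borel)
    have "(\<integral>\<^sup>+y. c * u (x, y) * indicator (V n) y \<partial>N) = c * (\<integral>\<^sup>+y. u (x, y) * indicator (V n) y \<partial>N)"
        for x
      by (subst nn_integral_cmult[symmetric]) (auto simp: mult.assoc)
    then show ?case using mult by simp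
  next
    case (add u v)
    have [measurable]: "(\<lambda>y. u (x, y)) \<in> borel_measurable N" "(\<lambda>y. v (x, y)) \<in> borel_measurable N" for x
      using add sN by (auto intro: measurable_Pair_left_borel)
    have "(\<integral>\<^sup>+y. (v (x, y) + u (x, y)) * indicator (V n) y \<partial>N) =
      (\<integral>\<^sup>+y. v (x, y) * indicator (V n) y \<partial>N) + (\<integral>\<^sup>+y. u (x, y) * indicator (V n) y \<partial>N)" for x
      by (subst nn_integral_add[symmetric]) (auto simp: distrib_right)
    then show ?case using add by simp
  next
    case (seq U)
    have [measurable]: "(\<lambda>y. U i (x, y)) \<in> borel_measurable N" for x i
      using seq sN by (auto intro: measurable_Pair_left_borel)
    have "(\<integral>\<^sup>+y. (SUP i. U i) (x, y) * indicator (V n) y \<partial>N) = (SUP i. \<integral>\<^sup>+y. U i (x, y) * indicator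
        (V n) y \<partial>N)" for x
    proof -
      have "(\<integral>\<^sup>+y. (SUP i. U i) (x, y) * indicator (V n) y \<partial>N) = (\<integral>\<^sup>+y. (SUP i. U i (x, y) *
          indicator (V n) y) \<partial>N)"
        by (intro nn_integral_cong) (auto simp: image_comp split: split_indicator)
      also have "\<dots> = (SUP i. \<integral>\<^sup>+y. U i (x, y) * indicator (V n) y \<partial>N)"
        using seq(3) by (intro nn_integral_monotone_convergence_SUP)
          (auto simp: incseq_def le_fun_def intro: mult_right_mono)
      finally show ?thesis .
    qed
    then show ?case using seq by simp
  qed
  have [measurable]: "(\<lambda>y. \<Phi> (x, y)) \<in> borel_measurable N" for x
    using \<Phi> sN by (auto intro: measurable_Pair_left_borel)
  have "(\<integral>\<^sup>+y. \<Phi> (x, y) \<partial>N) = (SUP n. \<integral>\<^sup>+y. \<Phi> (x, y) * indicator (V n) y \<partial>N)" for x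
  proof -
    have "\<Phi> (x, y) = (SUP n. \<Phi> (x, y) * indicator (V n) y)" for y
    proof (cases "y \<in> B")
      case True
      then obtain n where "y \<in> V n" using V(4) by blast
      then show ?thesis
        by (intro antisym SUP_least SUP_upper2[of n]) (auto split: split_indicator)
    qed (use van in auto)
    then have "(\<integral>\<^sup>+y. \<Phi> (x, y) \<partial>N) = (\<integral>\<^sup>+y. (SUP n. \<Phi> (x, y) * indicator (V n) y) \<partial>N)" by (rule
        nn_integral_cong)
    also have "\<dots> = (SUP n. \<integral>\<^sup>+y. \<Phi> (x, y) * indicator (V n) y \<partial>N)"
      using V(3) by (intro nn_integral_monotone_convergence_SUP)
        (auto simp: incseq_def le_fun_def split: split_indicator)
    finally show ?thesis .
  qed
  then show ?thesis using fin[OF \<Phi>] by simp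
qed

text \<open>
  When the sections are supported in one sigma-finite open set, partial integrals are Borel
  functions without exceptional sets.  The integral is expressed by integrals of nonnegative
  functions, with the value 0 where the section is not integrable.
\<close>

lemma measurable_integral_section:
  fixes N :: "'b::t2_space measure" and \<Phi> :: "'a::topological_space \<times> 'b \<Rightarrow> complex"
  assumes N: "open_inner_regular N" and B: "sigma_open N B" and \<Phi>: "\<Phi> \<in> borel_measurable borel"
    and van: "\<And>x y. y \<notin> B \<Longrightarrow> \<Phi> (x, y) = 0"
  shows "(\<lambda>x. LINT y|N. \<Phi> (x, y)) \<in> borel_measurable borel"
proof -
  have sN: "sets N = sets borel" using N by (simp add: open_inner_regular_def)
  have m: "(\<lambda>y. \<Phi> (x, y)) \<in> borel_measurable N" for x
    using \<Phi> sN by (auto intro: measurable_Pair_left_borel)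
  have [measurable]: "(\<lambda>x. \<integral>\<^sup>+y. ennreal (f (\<Phi> (x, y))) \<partial>N) \<in> borel_measurable borel"
    if "f \<in> borel_measurable borel" "f 0 = 0" for f :: "complex \<Rightarrow> real"
    using that \<Phi> van by (intro measurable_nn_integral_section[OF N B, of "\<lambda>z. ennreal (f (\<Phi> z))"]) auto
  let ?n = "\<lambda>f x. \<integral>\<^sup>+y. ennreal (f (\<Phi> (x, y))) \<partial>N"
  have eq: "(LINT y|N. \<Phi> (x, y)) = (if ?n norm x < \<infinity> then
      Complex (enn2real (?n Re x) - enn2real (?n (\<lambda>z. - Re z) x)) (enn2real (?n Im x) - enn2real (?n
          (\<lambda>z. - Im z) x)) else 0)" for x
  proof (cases "?n norm x < \<infinity>")
    case True
    then have i: "integrable N (\<lambda>y. \<Phi> (x, y))" using m by (simp add: integrable_iff_bounded)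
    have "Re (LINT y|N. \<Phi> (x, y)) = enn2real (?n Re x) - enn2real (?n (\<lambda>z. - Re z) x)"
      using i by (subst real_lebesgue_integral_def[symmetric]) auto
    moreover have "Im (LINT y|N. \<Phi> (x, y)) = enn2real (?n Im x) - enn2real (?n (\<lambda>z. - Im z) x)"
      using i by (subst real_lebesgue_integral_def[symmetric]) auto
    ultimately show ?thesis using True by (simp add: complex_eq_iff)
  next
    case False
    then have "\<not> integrable N (\<lambda>y. \<Phi> (x, y))" by (simp add: integrable_iff_bounded)
    then show ?thesis using False by (simp add: not_integrable_integral_eq)
  qed
  have C: "Complex a b = complex_of_real a + \<i> * complex_of_real b" for a b by (simp add:
      complex_eq_iff)
  show ?thesis unfolding eq C by measurable
qed

section \<open>Interchange of the order of integration\<close>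

lemma nn_integral_section_indicator:
  assumes S: "S \<in> sets borel" and sN: "sets N = sets borel"
  shows "(\<integral>\<^sup>+y. indicator S (x, y) \<partial>N) = emeasure N (Pair x -` S)"
proof -
  have "(\<integral>\<^sup>+y. indicator S (x, y) \<partial>N) = (\<integral>\<^sup>+y. indicator (Pair x -` S) y \<partial>N)"
    by (intro nn_integral_cong) (auto split: split_indicator)
  then show ?thesis using section_borel[OF S sN, of x] by simp
qed

lemma lower_semicont_emeasure_section:
  fixes N :: "'b::t2_space measure" and V :: "('a::topological_space \<times> 'b) set"
  assumes N: "open_inner_regular N" and V: "open V"
  shows "lower_semicont (\<lambda>x. emeasure N (Pair x -` V))"
proof -
  have sN: "sets N = sets borel" using N by (simp add: open_inner_regular_def)
  have bV: "V \<in> sets borel" using V by auto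
  show ?thesis
    using lower_semicont_nn_integral[OF N lower_semicont_indicator[OF V]] unfolding
        nn_integral_section_indicator[OF bV sN] .
qed

lemma open_inner_regular_less:
  assumes "open_inner_regular M" "open U" "a < emeasure M U"
  obtains C where "compact C" "C \<subseteq> U" "a < emeasure M C"
  using assms unfolding open_inner_regular_def by (auto simp: less_SUP_iff)

text \<open>
  Finite unions of open rectangles belong to the product of the Borel algebras, and the densities
  make both measures finite without changing the integrals over subsets of \<open>X \<times> Y\<close>.
\<close>

lemma rectangle_union_swap:
  fixes M :: "'a::t2_space measure" and N :: "'b::t2_space measure"
  assumes M: "open_inner_regular M" and N: "open_inner_regular N"
    and X: "open X" "emeasure M X < \<infinity>" and Y: "open Y" "emeasure N Y < \<infinity>"
    and R: "finite R" "\<And>A B. (A, B) \<in> R \<Longrightarrow> open A \<and> open B"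
    and Q: "Q = (\<Union>(A, B)\<in>R. A \<times> B)" "Q \<subseteq> X \<times> Y"
  shows "(\<integral>\<^sup>+x. emeasure N (Pair x -` Q) \<partial>M) = (\<integral>\<^sup>+y. emeasure M ((\<lambda>x. (x, y)) -` Q) \<partial>N)"
proof -
  have sM: "sets M = sets borel" and sN: "sets N = sets borel"
    using M N by (auto simp: open_inner_regular_def)
  have oQ: "open Q" unfolding Q(1) using R(2) by (auto intro!: open_UN open_Times)
  have oQ': "open (prod.swap -` Q)"
    by (intro open_vimage[OF oQ]) (auto simp: prod.swap_def intro!: continuous_intros)
  have [measurable]: "X \<in> sets M" "Y \<in> sets N" using X Y sM sN by auto
  let ?M = "density M (indicator X)" and ?N = "density N (indicator Y)"
  have sp: "space M = UNIV" "space N = UNIV"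
    using sM sN by (auto dest: sets_eq_imp_space_eq)
  have "emeasure ?M (space ?M) = emeasure M X"
    using sp(1) sets.top[of M] by (simp add: emeasure_density)
  moreover have "emeasure ?N (space ?N) = emeasure N Y"
    using sp(2) sets.top[of N] by (simp add: emeasure_density)
  ultimately interpret M: finite_measure ?M + N: finite_measure ?N
    using X Y by (auto intro!: finite_measureI)
  interpret pair_sigma_finite ?M ?N ..
  have "A \<times> B \<in> sets (?M \<Otimes>\<^sub>M ?N)" if "(A, B) \<in> R" for A B
    using R(2)[OF that] sM sN by (intro pair_measureI) auto
  then have QM: "Q \<in> sets (?M \<Otimes>\<^sub>M ?N)" unfolding Q(1) using R(1) by (intro sets.finite_UN) auto
  have F: "(\<integral>\<^sup>+y. \<integral>\<^sup>+x. indicator Q (x, y) \<partial>?M \<partial>?N) = (\<integral>\<^sup>+x. \<integral>\<^sup>+y. indicator Q (x, y) \<partial>?N \<partial>?M)"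
    using QM by (intro Fubini') simp
  have bQ: "Q \<in> sets borel" "prod.swap -` Q \<in> sets borel" using oQ oQ' by auto
  have secM: "(\<lambda>x. (x, y)) -` Q = Pair y -` (prod.swap -` Q)" for y by auto
  have sec[measurable]: "Pair x -` Q \<in> sets N" "(\<lambda>x. (x, y)) -` Q \<in> sets M" for x y
    unfolding secM using bQ section_borel sM sN by blast+
  have i1: "(\<integral>\<^sup>+y. indicator Q (x, y) \<partial>?N) = emeasure N (Pair x -` Q)" for x
  proof -
    have "(\<integral>\<^sup>+y. indicator Q (x, y) \<partial>?N) = (\<integral>\<^sup>+y. indicator (Pair x -` Q) y \<partial>?N)"
      by (intro nn_integral_cong) (auto split: split_indicator)
    also have "\<dots> = (\<integral>\<^sup>+y. indicator Y y * indicator (Pair x -` Q) y \<partial>N)"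
      by (subst nn_integral_density) auto
    also have "\<dots> = (\<integral>\<^sup>+y. indicator (Pair x -` Q) y \<partial>N)"
      using Q(2) by (intro nn_integral_cong) (auto split: split_indicator)
    finally show ?thesis by simp
  qed
  have i2: "(\<integral>\<^sup>+x. indicator Q (x, y) \<partial>?M) = emeasure M ((\<lambda>x. (x, y)) -` Q)" for y
  proof -
    have "(\<integral>\<^sup>+x. indicator Q (x, y) \<partial>?M) = (\<integral>\<^sup>+x. indicator ((\<lambda>x. (x, y)) -` Q) x \<partial>?M)"
      by (intro nn_integral_cong) (auto split: split_indicator)
    also have "\<dots> = (\<integral>\<^sup>+x. indicator X x * indicator ((\<lambda>x. (x, y)) -` Q) x \<partial>M)"
      by (subst nn_integral_density) auto
    also have "\<dots> = (\<integral>\<^sup>+x. indicator ((\<lambda>x. (x, y)) -` Q) x \<partial>M)"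
      using Q(2) by (intro nn_integral_cong) (auto split: split_indicator)
    finally show ?thesis by simp
  qed
  have m1: "(\<lambda>x. emeasure N (Pair x -` Q)) \<in> borel_measurable M"
    by (rule lower_semicont_measurable[OF lower_semicont_emeasure_section[OF N oQ] sM])
  have m2: "(\<lambda>y. emeasure M ((\<lambda>x. (x, y)) -` Q)) \<in> borel_measurable N"
    unfolding secM by (rule lower_semicont_measurable[OF lower_semicont_emeasure_section[OF M oQ'] sN])
  have o1: "(\<integral>\<^sup>+x. emeasure N (Pair x -` Q) \<partial>?M) = (\<integral>\<^sup>+x. emeasure N (Pair x -` Q) \<partial>M)"
  proof (subst nn_integral_density, simp, rule m1, intro nn_integral_cong)
    fix x
    have "Pair x -` Q = {}" if "x \<notin> X" using Q(2) that by auto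
    then show "indicator X x * emeasure N (Pair x -` Q) = emeasure N (Pair x -` Q)"
      by (cases "x \<in> X") auto
  qed
  have o2: "(\<integral>\<^sup>+y. emeasure M ((\<lambda>x. (x, y)) -` Q) \<partial>?N) = (\<integral>\<^sup>+y. emeasure M ((\<lambda>x. (x, y)) -` Q) \<partial>N)"
  proof (subst nn_integral_density, simp, rule m2, intro nn_integral_cong)
    fix y
    have "(\<lambda>x. (x, y)) -` Q = {}" if "y \<notin> Y" using Q(2) that by auto
    then show "indicator Y y * emeasure M ((\<lambda>x. (x, y)) -` Q) = emeasure M ((\<lambda>x. (x, y)) -` Q)"
      by (cases "y \<in> Y") auto
  qed
  show ?thesis using F unfolding i1 i2 o1 o2 by simp
qed

text \<open>
  The function \<open>x \<mapsto> N V\<^sub>x\<close> is the directed supremum of the functions \<open>x \<mapsto> N Q\<^sub>x\<close>, where \<open>Q\<close> runs through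
  the finite unions of open rectangles in \<open>V\<close>: by Wallace's theorem, a compact subset \<open>C\<close> of a section
  \<open>V\<^sub>x\<close> yields a rectangle in \<open>V\<close> that contains \<open>{x} \<times> C\<close>.
\<close>

lemma open_set_swap_le:
  fixes M :: "'a::t2_space measure" and N :: "'b::t2_space measure"
  assumes M: "open_inner_regular M" and N: "open_inner_regular N"
    and X: "open X" "emeasure M X < \<infinity>" and Y: "open Y" "emeasure N Y < \<infinity>"
    and V: "open V" "V \<subseteq> X \<times> Y"
  shows "(\<integral>\<^sup>+x. emeasure N (Pair x -` V) \<partial>M) \<le> (\<integral>\<^sup>+y. emeasure M ((\<lambda>x. (x, y)) -` V) \<partial>N)"
proof (rule dense_le)
  fix c assume c: "c < (\<integral>\<^sup>+x. emeasure N (Pair x -` V) \<partial>M)"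
  have sM: "sets M = sets borel" and sN: "sets N = sets borel"
    using M N by (auto simp: open_inner_regular_def)
  define \<Q> where "\<Q> = {Q. \<exists>R. finite R \<and> (\<forall>(A, B)\<in>R. open A \<and> open B) \<and> Q = (\<Union>(A, B)\<in>R. A \<times> B) \<and> Q \<subseteq> V}"
  have oQ: "open Q" "Q \<subseteq> V" if "Q \<in> \<Q>" for Q
    using that unfolding \<Q>_def by (auto intro!: open_UN open_Times)
  define \<F> where "\<F> = (\<lambda>Q x. emeasure N (Pair x -` Q)) ` \<Q>"
  have sec: "Pair x -` Q \<in> sets N" if "open Q" for x Q
    using that section_borel[OF _ sN, of Q] by auto
  have un: "P \<union> Q \<in> \<Q>" if PQ: "P \<in> \<Q>" "Q \<in> \<Q>" for P Q
  proof -
    obtain R S where "finite R" "\<forall>(A, B)\<in>R. open A \<and> open B" "P = (\<Union>(A, B)\<in>R. A \<times> B)" "P \<subseteq> V"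
      "finite S" "\<forall>(A, B)\<in>S. open A \<and> open B" "Q = (\<Union>(A, B)\<in>S. A \<times> B)" "Q \<subseteq> V"
      using PQ unfolding \<Q>_def by blast
    then show ?thesis unfolding \<Q>_def by (intro CollectI exI[of _ "R \<union> S"]) auto
  qed
  have "{} \<in> \<Q>" unfolding \<Q>_def by (auto intro!: exI[of _ "{}"])
  obtain \<phi> where \<phi>: "\<phi> \<in> \<F>" "c < (\<integral>\<^sup>+x. \<phi> x \<partial>M)"
  proof (rule directed_lower_semicont[OF M lower_semicont_emeasure_section[OF N V(1)] c])
    show "\<F> \<noteq> {}" using \<open>{} \<in> \<Q>\<close> by (auto simp: \<F>_def)
    show "lower_semicont \<phi>" if "\<phi> \<in> \<F>" for \<phi>
      using that oQ(1) by (auto simp: \<F>_def intro: lower_semicont_emeasure_section[OF N])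
    show "\<exists>\<eta>\<in>\<F>. \<phi> \<le> \<eta> \<and> \<psi> \<le> \<eta>" if "\<phi> \<in> \<F>" "\<psi> \<in> \<F>" for \<phi> \<psi>
    proof -
      obtain P Q where P: "P \<in> \<Q>" "\<phi> = (\<lambda>x. emeasure N (Pair x -` P))"
        and Q: "Q \<in> \<Q>" "\<psi> = (\<lambda>x. emeasure N (Pair x -` Q))"
        using \<open>\<phi> \<in> \<F>\<close> \<open>\<psi> \<in> \<F>\<close> unfolding \<F>_def by blast
      have "\<phi> \<le> (\<lambda>x. emeasure N (Pair x -` (P \<union> Q)))" "\<psi> \<le> (\<lambda>x. emeasure N (Pair x -` (P \<union> Q)))"
        unfolding P Q le_fun_def using sec[OF oQ(1)[OF un[OF P(1) Q(1)]]]
        by (auto intro!: emeasure_mono simp del: vimage_Un)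
      moreover have "(\<lambda>x. emeasure N (Pair x -` (P \<union> Q))) \<in> \<F>" using un[OF P(1) Q(1)] unfolding
          \<F>_def by (rule imageI)
      ultimately show ?thesis by blast
    qed
    show "\<exists>\<phi>\<in>\<F>. a < \<phi> x" if a: "a < emeasure N (Pair x -` V)" for x a
    proof -
      obtain C where C: "compact C" "C \<subseteq> Pair x -` V" "a < emeasure N C"
        using open_inner_regular_less[OF N open_section[OF V(1)] a] by blast
      have "{x} \<times> C \<subseteq> V" using C(2) by auto
      then obtain A B where AB: "open A" "open B" "x \<in> A" "C \<subseteq> B" "A \<times> B \<subseteq> V"
        using Wallace_theorem_prod_topology[of euclidean "{x}" euclidean C V] C(1) V(1) by auto
      have "A \<times> B \<in> \<Q>" unfolding \<Q>_def using AB by (intro CollectI exI[of _ "{(A, B)}"]) auto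
      moreover have "a < emeasure N (Pair x -` (A \<times> B))"
        using AB sN by (intro less_le_trans[OF C(3)] emeasure_mono sec open_Times) auto
      ultimately show ?thesis unfolding \<F>_def image_def mem_Collect_eq Bex_def by blast
    qed
  qed
  then obtain Q where Q: "Q \<in> \<Q>" "\<phi> = (\<lambda>x. emeasure N (Pair x -` Q))" unfolding \<F>_def by blast
  then obtain R where R': "finite R" "\<forall>(A, B)\<in>R. open A \<and> open B"
     "Q = (\<Union>(A, B)\<in>R. A \<times> B)" "Q \<subseteq> V" unfolding \<Q>_def by blast
  have R: "finite R" "\<And>A B. (A, B) \<in> R \<Longrightarrow> open A \<and> open B"
     "Q = (\<Union>(A, B)\<in>R. A \<times> B)" "Q \<subseteq> V" using R' by auto
  have oV': "open (prod.swap -` V)"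
    by (intro open_vimage[OF V(1)]) (auto simp: prod.swap_def intro!: continuous_intros)
  have secM: "(\<lambda>x. (x, y)) -` V = Pair y -` (prod.swap -` V)" for y by auto
  have "(\<integral>\<^sup>+x. \<phi> x \<partial>M) = (\<integral>\<^sup>+y. emeasure M ((\<lambda>x. (x, y)) -` Q) \<partial>N)"
    unfolding Q(2) using R V(2) by (intro rectangle_union_swap[OF M N X Y R(1,2)]) auto
  also have "\<dots> \<le> (\<integral>\<^sup>+y. emeasure M ((\<lambda>x. (x, y)) -` V) \<partial>N)"
  proof (intro nn_integral_mono emeasure_mono)
    show "(\<lambda>x. (x, y)) -` V \<in> sets M" for y
      unfolding secM using section_borel[OF _ sM, of "prod.swap -` V" y] oV' by auto
  qed (use R(4) in auto)
  finally show "c \<le> (\<integral>\<^sup>+y. emeasure M ((\<lambda>x. (x, y)) -` V) \<partial>N)" using \<phi>(2) by auto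
qed

lemma open_set_swap:
  fixes M :: "'a::t2_space measure" and N :: "'b::t2_space measure"
  assumes M: "open_inner_regular M" and N: "open_inner_regular N"
    and X: "open X" "emeasure M X < \<infinity>" and Y: "open Y" "emeasure N Y < \<infinity>"
    and V: "open V" "V \<subseteq> X \<times> Y"
  shows "(\<integral>\<^sup>+x. emeasure N (Pair x -` V) \<partial>M) = (\<integral>\<^sup>+y. emeasure M (Pair y -` (prod.swap -` V)) \<partial>N)"
proof -
  have oV': "open (prod.swap -` V)"
    by (intro open_vimage[OF V(1)]) (auto simp: prod.swap_def intro!: continuous_intros)
  have e: "(\<lambda>x. (x, y)) -` V = Pair y -` (prod.swap -` V)"
     "(\<lambda>y. (y, x)) -` (prod.swap -` V) = Pair x -` V" for x y by auto
  show ?thesis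
  proof (rule antisym)
    show "(\<integral>\<^sup>+x. emeasure N (Pair x -` V) \<partial>M) \<le> (\<integral>\<^sup>+y. emeasure M (Pair y -` (prod.swap -` V)) \<partial>N)"
      using open_set_swap_le[OF M N X Y V] unfolding e .
    have "prod.swap -` V \<subseteq> Y \<times> X" using V(2) by auto
    from open_set_swap_le[OF N M Y X oV' this]
    show "(\<integral>\<^sup>+y. emeasure M (Pair y -` (prod.swap -` V)) \<partial>N) \<le> (\<integral>\<^sup>+x. emeasure N (Pair x -` V) \<partial>M)"
      unfolding e .
  qed
qed

lemma open_inner_regularD: "open_inner_regular M \<Longrightarrow> sets M = sets borel"
  by (simp add: open_inner_regular_def)

text \<open>
  The iterated measure in one order disintegrates by construction.  That it also disintegrates in the
  other order only has to be checked on open sets, where \<open>open_set_swap\<close> applies to the parts in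
  \<open>A n \<times> B n\<close>.
\<close>

lemma exists_swap_disintegration:
  fixes M :: "'a::t2_space measure" and N :: "'b::t2_space measure"
  assumes M: "open_inner_regular M" and N: "open_inner_regular N"
    and A: "incseq A" "\<And>n::nat. open (A n)" "\<And>n. emeasure M (A n) < \<infinity>"
    and B: "incseq B" "\<And>n::nat. open (B n)" "\<And>n. emeasure N (B n) < \<infinity>"
  obtains P where "disintegrates_on ((\<Union>n. A n) \<times> (\<Union>n. B n)) P M N"
    "disintegrates_on ((\<Union>n. B n) \<times> (\<Union>n. A n)) (distr P borel prod.swap) N M"
    "\<And>n. emeasure P (A n \<times> B n) < \<infinity>"
proof -
  have sM: "sets M = sets borel" and sN: "sets N = sets borel"
    using M N by (auto simp: open_inner_regular_def)
  define R where "R = (\<Union>n. A n) \<times> (\<Union>n. B n)"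
  define W where "W n = A n \<times> B n" for n
  have W: "incseq W" "\<And>n. open (W n)"
  proof -
    show "incseq W" using A(1) B(1) unfolding incseq_def W_def by (meson Sigma_mono)
    show "open (W n)" for n using A(2) B(2) by (simp add: W_def open_Times)
  qed
  have RW: "R = (\<Union>n. W n)"
  proof
    show "R \<subseteq> (\<Union>n. W n)"
    proof
      fix z assume "z \<in> R"
      then obtain i j where ij: "fst z \<in> A i" "snd z \<in> B j" by (auto simp: R_def)
      have "A i \<subseteq> A (max i j)" "B j \<subseteq> B (max i j)" using A(1) B(1) by (auto simp: incseq_def)
      then show "z \<in> (\<Union>n. W n)" using ij by (auto simp: W_def mem_Times_iff intro!: exI[of _ "max i j"])
    qed
  qed (auto simp: R_def W_def)
  have oR: "open R" unfolding RW using W by auto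
  have bR: "R \<in> sets borel" using oR by auto
  have sB: "sigma_open N (\<Union>n. B n)" unfolding sigma_open_def using B by blast
  have in_m: "(\<lambda>x. emeasure N (Pair x -` (S \<inter> R))) \<in> borel_measurable borel" if S: "S \<in> sets borel"
      for S
  proof -
    have SR: "S \<inter> R \<in> sets borel" using S bR by auto
    have "(\<lambda>x. \<integral>\<^sup>+y. indicator (S \<inter> R) (x, y) \<partial>N) \<in> borel_measurable borel"
      using SR by (intro measurable_nn_integral_section[OF N sB]) (auto simp: R_def)
    then show ?thesis unfolding nn_integral_section_indicator[OF SR sN] .
  qed
  define \<mu> where "\<mu> S = (\<integral>\<^sup>+x. emeasure N (Pair x -` (S \<inter> R)) \<partial>M)" for S
  define P where "P = measure_of UNIV (sets borel) \<mu>"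
  have sP: "sets P = sets borel"
    unfolding P_def by (metis sets_measure_of sets.sigma_sets_eq space_borel sets.space_closed)
  have PS: "emeasure P S = \<mu> S" if S: "S \<in> sets borel" for S
    unfolding P_def
  proof (rule emeasure_measure_of_sigma[OF _ _ _ S])
    show "sigma_algebra UNIV (sets (borel :: ('a \<times> 'b) measure))"
      using sets.sigma_algebra_axioms[of "borel :: ('a \<times> 'b) measure"] by simp
    show "positive (sets borel) \<mu>" by (simp add: positive_def \<mu>_def)
    show "countably_additive (sets borel) \<mu>"
      unfolding countably_additive_def
    proof (intro allI impI)
      fix F :: "nat \<Rightarrow> ('a \<times> 'b) set"
      assume F: "range F \<subseteq> sets borel" "disjoint_family F" "\<Union> (range F) \<in> sets borel"
      have "(\<Sum>i. \<mu> (F i)) = (\<integral>\<^sup>+x. (\<Sum>i. emeasure N (Pair x -` (F i \<inter> R))) \<partial>M)"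
        unfolding \<mu>_def using F(1) in_m sM
        by (intro nn_integral_suminf[symmetric]) (auto cong: measurable_cong_sets)
      also have "\<dots> = (\<integral>\<^sup>+x. emeasure N (Pair x -` ((\<Union>i. F i) \<inter> R)) \<partial>M)"
      proof (intro nn_integral_cong)
        fix x
        have "(\<Sum>i. emeasure N (Pair x -` (F i \<inter> R))) = emeasure N (\<Union>i. Pair x -` (F i \<inter> R))"
        proof (rule suminf_emeasure)
          have "F i \<inter> R \<in> sets borel" for i using F(1) bR by auto
          then show "range (\<lambda>i. Pair x -` (F i \<inter> R)) \<subseteq> sets N"
            using section_borel[OF _ sN] by blast
          show "disjoint_family (\<lambda>i. Pair x -` (F i \<inter> R))"
            using F(2) by (auto simp: disjoint_family_on_def)
        qed
        moreover have "(\<Union>i. Pair x -` (F i \<inter> R)) = Pair x -` ((\<Union>i. F i) \<inter> R)" by auto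
        ultimately show "(\<Sum>i. emeasure N (Pair x -` (F i \<inter> R))) = emeasure N (Pair x -` ((\<Union>i. F i) \<inter>
            R))"
          by simp
      qed
      finally show "(\<Sum>i. \<mu> (F i)) = \<mu> (\<Union> (range F))" unfolding \<mu>_def .
    qed
  qed
  have dis: "disintegrates_on R P M N"
    unfolding disintegrates_on_def
  proof (intro conjI allI impI sP sM sN)
    fix V assume V: "open V" "V \<subseteq> R"
    then have bV: "V \<in> sets borel" and VR: "V \<inter> R = V" by auto
    show "(\<lambda>x. emeasure N (Pair x -` V)) \<in> borel_measurable M"
      using in_m[OF bV] sM unfolding VR by (simp cong: measurable_cong_sets)
    show "emeasure P V = (\<integral>\<^sup>+x. emeasure N (Pair x -` V) \<partial>M)"
      unfolding PS[OF bV] \<mu>_def VR ..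
  qed
  have fin: "emeasure P (W n) < \<infinity>" for n
  proof -
    have bW: "W n \<in> sets borel" using W(2) by auto
    have "emeasure P (W n) \<le> (\<integral>\<^sup>+x. emeasure N (B n) * indicator (A n) x \<partial>M)"
      unfolding PS[OF bW] \<mu>_def
    proof (intro nn_integral_mono)
      fix x
      have "Pair x -` (W n \<inter> R) \<subseteq> (if x \<in> A n then B n else {})" by (auto simp: W_def)
      then have "emeasure N (Pair x -` (W n \<inter> R)) \<le> emeasure N (if x \<in> A n then B n else {})"
        using B(2) sN by (intro emeasure_mono) auto
      also have "\<dots> = emeasure N (B n) * indicator (A n) x" by simp
      finally show "emeasure N (Pair x -` (W n \<inter> R)) \<le> emeasure N (B n) * indicator (A n) x" .
    qed
    also have "\<dots> = emeasure N (B n) * emeasure M (A n)"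
    proof -
      have [measurable]: "A n \<in> sets M" using A(2) sM by auto
      show ?thesis by (subst nn_integral_cmult) auto
    qed
    also have "\<dots> < \<infinity>" using A(3) B(3) by (simp add: ennreal_mult_less_top)
    finally show ?thesis .
  qed
  have swap_m: "prod.swap \<in> P \<rightarrow>\<^sub>M borel" using borel_swap sP by (simp cong: measurable_cong_sets)
  have dis': "disintegrates_on (prod.swap ` R) (distr P borel prod.swap) N M"
    unfolding disintegrates_on_def
  proof (intro conjI allI impI sM sN)
    show "sets (distr P borel prod.swap) = sets borel" by simp
    fix V :: "('b \<times> 'a) set" assume V: "open V" "V \<subseteq> prod.swap ` R"
    define V' where "V' = prod.swap -` V"
    have oV': "open V'" unfolding V'_def
      by (intro open_vimage[OF V(1)]) (auto simp: prod.swap_def intro!: continuous_intros)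
    have V'R: "V' \<subseteq> R" using V(2) by (auto simp: V'_def)
    have VV': "prod.swap -` V' = V" by (auto simp: V'_def)
    define f where "f n y = emeasure M (Pair y -` (prod.swap -` (V' \<inter> W n)))" for n y
    have o: "open (V' \<inter> W n)" "V' \<inter> W n \<subseteq> A n \<times> B n" for n using oV' W by (auto simp: W_def)
    have os: "open (prod.swap -` (V' \<inter> W n))" for n
      by (intro open_vimage o) (auto simp: prod.swap_def intro!: continuous_intros)
    show m: "(\<lambda>y. emeasure M (Pair y -` V)) \<in> borel_measurable N"
      by (rule lower_semicont_measurable[OF lower_semicont_emeasure_section[OF M V(1)] sN])
    have fm: "f n \<in> borel_measurable N" for n unfolding f_def
      by (rule lower_semicont_measurable[OF lower_semicont_emeasure_section[OF M os] sN])
    have sec: "Pair y -` (prod.swap -` (V' \<inter> W n)) \<in> sets M" for y n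
      using section_borel[OF _ sM, of "prod.swap -` (V' \<inter> W n)" y] os[of n] by auto
    have Un: "(\<Union>n. V' \<inter> W n) = V'" using V'R RW by auto
    have inc: "incseq (\<lambda>n. V' \<inter> W n)" using W(1) by (auto simp: incseq_def)
    have "emeasure (distr P borel prod.swap) V = emeasure P V'"
    proof -
      have "space P = UNIV" using sP by (auto dest: sets_eq_imp_space_eq)
      then show ?thesis using V(1) swap_m by (subst emeasure_distr) (auto simp: V'_def)
    qed
    also have "\<dots> = (SUP n. emeasure P (V' \<inter> W n))"
    proof -
      have "range (\<lambda>n. V' \<inter> W n) \<subseteq> sets P" using o(1) sP by auto
      from SUP_emeasure_incseq[OF this inc] show ?thesis unfolding Un by simp
    qed
    also have "\<dots> = (SUP n. \<integral>\<^sup>+y. f n y \<partial>N)"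
    proof (rule SUP_cong[OF refl])
      fix n
      have "emeasure P (V' \<inter> W n) = (\<integral>\<^sup>+x. emeasure N (Pair x -` (V' \<inter> W n)) \<partial>M)"
        using dis o(1)[of n] V'R unfolding disintegrates_on_def by blast
      also have "\<dots> = (\<integral>\<^sup>+y. f n y \<partial>N)"
        unfolding f_def by (rule open_set_swap[OF M N A(2,3) B(2,3) o])
      finally show "emeasure P (V' \<inter> W n) = (\<integral>\<^sup>+y. f n y \<partial>N)" .
    qed
    also have "\<dots> = (\<integral>\<^sup>+y. (SUP n. f n y) \<partial>N)"
    proof (rule nn_integral_monotone_convergence_SUP[symmetric])
      show "incseq f"
        unfolding incseq_def le_fun_def f_def
      proof (intro allI impI emeasure_mono sec)
        fix m n :: nat and y assume "m \<le> n"
        then have "V' \<inter> W m \<subseteq> V' \<inter> W n" using inc by (simp add: incseq_def)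
        then show "Pair y -` prod.swap -` (V' \<inter> W m) \<subseteq> Pair y -` prod.swap -` (V' \<inter> W n)" by blast
      qed
    qed (rule fm)
    also have "\<dots> = (\<integral>\<^sup>+y. emeasure M (Pair y -` V) \<partial>N)"
    proof (intro nn_integral_cong)
      fix y
      have "(SUP n. f n y) = emeasure M (\<Union>n. Pair y -` (prod.swap -` (V' \<inter> W n)))"
        unfolding f_def
      proof (rule SUP_emeasure_incseq)
        show "incseq (\<lambda>n. Pair y -` prod.swap -` (V' \<inter> W n))"
          using inc unfolding incseq_def by blast
      qed (use sec in auto)
      also have "(\<Union>n. Pair y -` (prod.swap -` (V' \<inter> W n))) = Pair y -` (prod.swap -` (\<Union>n. V' \<inter> W
          n))" by auto
      also have "\<dots> = Pair y -` V" unfolding Un VV' ..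
      finally show "(SUP n. f n y) = emeasure M (Pair y -` V)" .
    qed
    finally show "emeasure (distr P borel prod.swap) V = (\<integral>\<^sup>+y. emeasure M (Pair y -` V) \<partial>N)" .
  qed
  have "prod.swap ` R = (\<Union>n. B n) \<times> (\<Union>n. A n)" by (auto simp: R_def image_iff)
  with dis dis' fin show thesis by (intro that[of P]) (auto simp: R_def W_def)
qed

text \<open>
  Fubini's theorem for functions that are Borel with respect to the product topology.  Both
  iterated integrals equal the integral against the measure of \<open>exists_swap_disintegration\<close>.
\<close>

theorem radon_fubini:
  fixes M :: "'a::t2_space measure" and N :: "'b::t2_space measure" and \<Phi> :: "'a \<times> 'b \<Rightarrow> complex"
  assumes M: "open_inner_regular M" and N: "open_inner_regular N"
    and A: "sigma_open M A" and B: "sigma_open N B"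
    and \<Phi>: "\<Phi> \<in> borel_measurable borel" and van: "\<And>x y. (x, y) \<notin> A \<times> B \<Longrightarrow> \<Phi> (x, y) = 0"
    and fin: "(\<integral>\<^sup>+x. \<integral>\<^sup>+y. ennreal (cmod (\<Phi> (x, y))) \<partial>N \<partial>M) < \<infinity>"
  obtains I where "has_iterated_integral M N (\<lambda>x y. \<Phi> (x, y)) I"
    "has_iterated_integral N M (\<lambda>y x. \<Phi> (x, y)) I"
proof -
  have sM: "sets M = sets borel" and sN: "sets N = sets borel"
    using M N by (auto simp: open_inner_regular_def)
  obtain a where a: "\<And>n. open (a n)" "\<And>n. emeasure M (a n) < \<infinity>" "incseq a" "A = (\<Union>n::nat. a n)"
    using A unfolding sigma_open_def by blast
  obtain b where b: "\<And>n. open (b n)" "\<And>n. emeasure N (b n) < \<infinity>" "incseq b" "B = (\<Union>n::nat. b n)"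
    using B unfolding sigma_open_def by blast
  obtain P where P: "disintegrates_on (A \<times> B) P M N"
    "disintegrates_on (B \<times> A) (distr P borel prod.swap) N M" "\<And>n. emeasure P (a n \<times> b n) < \<infinity>"
    using exists_swap_disintegration[OF M N a(3,1,2) b(3,1,2)] unfolding a(4)[symmetric]
        b(4)[symmetric] by blast
  have sP: "sets P = sets borel" using P(1) by (simp add: disintegrates_on_def)
  have swap_m: "prod.swap \<in> P \<rightarrow>\<^sub>M borel" using borel_swap sP by (simp cong: measurable_cong_sets)
  have spP: "space P = UNIV" using sP by (auto dest: sets_eq_imp_space_eq)
  define W where "W n = a n \<times> b n" for n
  have UnW: "(\<Union>n. W n) = A \<times> B"
  proof
    show "A \<times> B \<subseteq> (\<Union>n. W n)"
    proof
      fix z assume "z \<in> A \<times> B"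
      then obtain i j where ij: "fst z \<in> a i" "snd z \<in> b j" by (auto simp: a b)
      have "a i \<subseteq> a (max i j)" "b j \<subseteq> b (max i j)" using a(3) b(3) by (auto simp: incseq_def)
      then show "z \<in> (\<Union>n. W n)" using ij by (auto simp: W_def mem_Times_iff intro!: exI[of _ "max i j"])
    qed
  qed (auto simp: a b W_def)
  have W: "incseq W" "\<And>n. open (W n)" "\<And>n. W n \<subseteq> A \<times> B" "\<And>n. emeasure P (W n) < \<infinity>"
  proof -
    show "incseq W" using a(3) b(3) unfolding incseq_def W_def by (meson Sigma_mono)
    show "open (W n)" for n using a(1) b(1) by (simp add: W_def open_Times)
    show "W n \<subseteq> A \<times> B" for n using UnW by auto
    show "emeasure P (W n) < \<infinity>" for n using P(3) by (simp add: W_def)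
  qed
  have v: "\<Phi> z = 0" if "z \<notin> (\<Union>n. W n)" for z using that van unfolding UnW by (cases z) auto
  have \<Phi>P: "\<Phi> \<in> borel_measurable P" using \<Phi> sP by (simp cong: measurable_cong_sets)
  obtain g where g: "g \<in> borel_measurable M" "AE x in M. g x = (\<integral>\<^sup>+y. ennreal (cmod (\<Phi> (x, y))) \<partial>N)"
    "(\<integral>\<^sup>+z. ennreal (cmod (\<Phi> z)) \<partial>P) = (\<integral>\<^sup>+x. g x \<partial>M)"
    by (rule disintegrates_on_nn_integral[OF P(1) W, of "\<lambda>z. ennreal (cmod (\<Phi> z))"]) (use \<Phi> v in auto)
  have "(\<integral>\<^sup>+x. g x \<partial>M) = (\<integral>\<^sup>+x. \<integral>\<^sup>+y. ennreal (cmod (\<Phi> (x, y))) \<partial>N \<partial>M)"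
    using g(2) by (rule nn_integral_cong_AE)
  then have int: "integrable P \<Phi>" using fin g(3) \<Phi>P by (simp add: integrable_iff_bounded)
  have swap_int: "integrable (distr P borel prod.swap) (\<lambda>z. \<Phi> (prod.swap z))"
    and swap_eq: "(LINT z|distr P borel prod.swap. \<Phi> (prod.swap z)) = (LINT z|P. \<Phi> z)"
  proof -
    have m: "(\<lambda>z. \<Phi> (prod.swap z)) \<in> borel_measurable borel"
      by (rule measurable_compose[OF borel_swap \<Phi>])
    show "integrable (distr P borel prod.swap) (\<lambda>z. \<Phi> (prod.swap z))"
      by (subst integrable_distr_eq[OF swap_m m]) (use int in simp)
    show "(LINT z|distr P borel prod.swap. \<Phi> (prod.swap z)) = (LINT z|P. \<Phi> z)"
      by (subst integral_distr[OF swap_m m]) simp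
  qed
  have 1: "iterated_integrable M N \<Phi> (LINT z|P. \<Phi> z)"
    by (rule disintegrates_on_integral[OF P(1) W int v])
  have 2: "iterated_integrable N M (\<lambda>z. \<Phi> (prod.swap z)) (LINT z|P. \<Phi> z)"
    unfolding swap_eq[symmetric]
  proof (rule disintegrates_on_integral[OF P(2) _ _ _ _ swap_int, of "\<lambda>n. prod.swap -` W n"])
    show "incseq (\<lambda>n. prod.swap -` W n)" using W(1) unfolding incseq_def by blast
    show o: "open (prod.swap -` W n)" for n
      by (intro open_vimage W) (auto simp: prod.swap_def intro!: continuous_intros)
    show "prod.swap -` W n \<subseteq> B \<times> A" for n using W(3)[of n] by auto
    have "emeasure (distr P borel prod.swap) (prod.swap -` W n) = emeasure P (W n)" for n
      using o[of n] swap_m spP by (subst emeasure_distr) (auto simp: vimage_def)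
    then show "emeasure (distr P borel prod.swap) (prod.swap -` W n) < \<infinity>" for n using W(4) by simp
    show "\<Phi> (prod.swap z) = 0" if "z \<notin> (\<Union>n. prod.swap -` W n)" for z using that by (intro v) auto
  qed
  have m1: "(\<lambda>x. LINT y|N. \<Phi> (x, y)) \<in> borel_measurable M"
    using measurable_integral_section[OF N B \<Phi>] van sM by (auto cong: measurable_cong_sets)
  have m2: "(\<lambda>y. LINT x|M. \<Phi> (prod.swap (y, x))) \<in> borel_measurable N"
    using measurable_integral_section[OF M A measurable_compose[OF borel_swap \<Phi>]] van sN
    by (auto cong: measurable_cong_sets)
  show thesis
    using iterated_integrable_has_iterated_integral[OF 1 m1]
        iterated_integrable_has_iterated_integral[OF 2 m2]
    by (intro that[of "LINT z|P. \<Phi> z"]) auto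
qed

section \<open>Supports of integrable functions and Radon products\<close>

lemma radon_measureD:
  assumes "radon_measure M"
  shows "sets M = sets borel" "open_inner_regular M" "\<And>C. compact C \<Longrightarrow> emeasure M C < \<infinity>"
  using assms by (auto simp: radon_measure_def open_inner_regular_def)

lemma radon_outer_open:
  assumes "radon_measure M" "A \<in> sets borel" "emeasure M A < c"
  obtains U where "open U" "A \<subseteq> U" "emeasure M U < c"
proof -
  have "emeasure M A = (INF U\<in>{U. open U \<and> A \<subseteq> U}. emeasure M U)"
    using assms by (auto simp: radon_measure_def)
  then show thesis using assms(3) that by (auto simp: INF_less_iff)
qed

lemma sigma_open_cover:
  fixes A :: "nat \<Rightarrow> 'a::topological_space set"
  assumes M: "radon_measure M" and A: "\<And>n. A n \<in> sets borel" "\<And>n. emeasure M (A n) < \<infinity>"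
  obtains O' where "sigma_open M O'" "(\<Union>n. A n) \<subseteq> O'"
proof -
  have "\<forall>n. \<exists>U. open U \<and> A n \<subseteq> U \<and> emeasure M U < \<infinity>"
    using radon_outer_open[OF M A] by metis
  then obtain U where U: "\<And>n. open (U n)" "\<And>n. A n \<subseteq> U n" "\<And>n. emeasure M (U n) < \<infinity>" by metis
  have sM: "sets M = sets borel" using M by (rule radon_measureD)
  define V where "V n = (\<Union>i\<le>n. U i)" for n
  have "emeasure M (V n) < \<infinity>" for n
  proof -
    have "emeasure M (V n) \<le> (\<Sum>i\<le>n. emeasure M (U i))"
      unfolding V_def using U(1) sM by (intro emeasure_subadditive_finite) auto
    also have "\<dots> < \<infinity>" using U(3) by auto
    finally show ?thesis .
  qed
  moreover have "incseq V" unfolding V_def incseq_def by (intro allI impI UN_mono) auto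
  moreover have "open (V n)" for n unfolding V_def using U(1) by (intro open_UN) auto
  ultimately have "sigma_open M (\<Union>n. V n)" unfolding sigma_open_def by blast
  moreover have "(\<Union>n. A n) \<subseteq> (\<Union>n. V n)" using U(2) by (auto simp: V_def)
  ultimately show thesis by (rule that)
qed

lemma integrable_support_countable:
  assumes M: "radon_measure M" and g: "integrable M g" "\<And>x. 0 \<le> (g x :: real)"
  obtains A :: "nat \<Rightarrow> 'a::topological_space set"
    where "\<And>n. A n \<in> sets borel" "\<And>n. emeasure M (A n) < \<infinity>" "{x. g x \<noteq> 0} = (\<Union>n. A n)"
proof -
  have sM: "sets M = sets borel" using M by (rule radon_measureD)
  have sp: "space M = UNIV" using sM by (auto dest: sets_eq_imp_space_eq)
  have [measurable]: "g \<in> borel_measurable M" using g by auto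
  define A where "A n = {x. 1 / real (Suc n) < g x}" for n
  have Am: "A n \<in> sets M" for n
  proof -
    have "{x\<in>space M. 1 / real (Suc n) < g x} \<in> sets M" by measurable
    then show ?thesis by (simp add: A_def sp)
  qed
  have "emeasure M (A n) < \<infinity>" for n
  proof -
    have "ennreal (1 / real (Suc n)) * emeasure M (A n) = (\<integral>\<^sup>+x. ennreal (1 / real (Suc n)) *
        indicator (A n) x \<partial>M)"
      using Am by (subst nn_integral_cmult) auto
    also have "\<dots> \<le> (\<integral>\<^sup>+x. ennreal (g x) \<partial>M)"
      by (intro nn_integral_mono) (auto simp: A_def split: split_indicator intro!: ennreal_leI)
    also have "\<dots> < \<infinity>" using g by (subst nn_integral_eq_integral) auto
    finally show ?thesis by (auto simp: ennreal_mult_less_top)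
  qed
  moreover have "{x. g x \<noteq> 0} = (\<Union>n. A n)"
  proof (intro equalityI subsetI)
    fix x assume "x \<in> {x. g x \<noteq> 0}"
    then have "0 < g x" using g(2)[of x] by auto
    then obtain n where "inverse (real (Suc n)) < g x" using reals_Archimedean by blast
    then have "1 / real (Suc n) < g x" by (simp add: inverse_eq_divide)
    then show "x \<in> (\<Union>n. A n)" by (auto simp: A_def)
  next
    fix x assume "x \<in> (\<Union>n. A n)"
    then obtain n where "1 / real (Suc n) < g x" by (auto simp: A_def)
    moreover have "0 < 1 / real (Suc n)" by simp
    ultimately have "0 < g x" by (rule less_trans[rotated])
    then show "x \<in> {x. g x \<noteq> 0}" by simp
  qed
  ultimately show thesis using that Am sM by auto
qed

lemma integrable_sigma_open_support:
  fixes g :: "'a::topological_space \<Rightarrow> 'b::{banach, second_countable_topology}"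
  assumes M: "radon_measure M" and g: "integrable M g"
  obtains O' where "sigma_open M O'" "\<And>x. x \<notin> O' \<Longrightarrow> g x = 0"
proof -
  obtain A where A: "\<And>n::nat. A n \<in> sets borel" "\<And>n. emeasure M (A n) < \<infinity>" "{x. norm (g x) \<noteq> 0} =
      (\<Union>n. A n)"
    using integrable_support_countable[OF M integrable_norm[OF g]] by auto
  obtain O' where O': "sigma_open M O'" "(\<Union>n. A n) \<subseteq> O'"
    by (rule sigma_open_cover[OF M A(1,2)])
  show thesis
  proof (rule that[OF O'(1)])
    fix x assume "x \<notin> O'"
    then have "x \<notin> {x. norm (g x) \<noteq> 0}" using A(3) O'(2) by auto
    then show "g x = 0" by simp
  qed
qed

lemma compactly_supported_bump:
  fixes C W :: "'a::t2_space set"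
  assumes lc: "locally_compact_space (euclidean :: 'a topology)" and C: "compact C" and W: "open W"
      "C \<subseteq> W"
  obtains F :: "'a \<Rightarrow> real" and K where "continuous_on UNIV F" "\<And>x. 0 \<le> F x" "\<And>x. F x \<le> 1"
    "\<And>x. x \<in> C \<Longrightarrow> F x = 1" "\<And>x. x \<notin> W \<Longrightarrow> F x = 0" "compact K" "\<And>x. x \<notin> K \<Longrightarrow> F x = 0"
proof -
  have "\<forall>x::'a. \<exists>U K. open U \<and> compact K \<and> x \<in> U \<and> U \<subseteq> K"
    using lc unfolding locally_compact_space_def by simp
  then obtain U K :: "'a \<Rightarrow> 'a set" where UK: "\<And>x. open (U x)" "\<And>x. compact (K x)" "\<And>x. x \<in> U x" "\<And>x.
      U x \<subseteq> K x" by metis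
  obtain D where D: "D \<subseteq> C" "finite D" "C \<subseteq> (\<Union>x\<in>D. U x)"
    by (rule compactE_image[OF C, of C U]) (use UK(1,3) in auto)
  define O' where "O' = (\<Union>x\<in>D. U x)"
  define L where "L = (\<Union>x\<in>D. K x)"
  have L: "compact L" "O' \<subseteq> L" unfolding L_def O'_def using D(2) UK(2,4) by (auto intro!: compact_UN)
  have O': "open O'" "C \<subseteq> O'" using D UK(1) by (auto simp: O'_def)
  have "Hausdorff_space (euclidean :: 'a topology)"
    by (simp add: Hausdorff_space_def disjnt_def) (meson separation_t2)
  then have cr: "completely_regular_space (euclidean :: 'a topology)"
    using locally_compact_regular_imp_completely_regular_space lc by blast
  obtain F where F: "continuous_map euclidean (subtopology euclidean {0..1::real}) F" "F ` (- (W \<inter>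
      O')) \<subseteq> {0}" "F ` C \<subseteq> {1}"
    by (rule Urysohn_completely_regular_compact_closed[of 0 1 "euclidean :: 'a topology" C "- (W \<inter>
        O')"])
      (use cr C W O' in \<open>auto simp: disjnt_def closed_def\<close>)
  show thesis
  proof (rule that[of F L])
    show "continuous_on UNIV F" using F(1) by (simp add: continuous_map_in_subtopology)
    have "F x \<in> {0..1}" for x using F(1) by (auto simp: continuous_map_in_subtopology)
    then show "0 \<le> F x" "F x \<le> 1" for x by auto
    show "F x = 1" if "x \<in> C" for x using F(3) that by auto
    show "F x = 0" if "x \<notin> W" for x using F(2) that by auto
    show "F x = 0" if "x \<notin> L" for x using F(2) that L(2) by auto
    show "compact L" by fact
  qed
qed

lemma locally_compact_product:
  assumes "locally_compact_space (euclidean :: 'a::topological_space topology)"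
    "locally_compact_space (euclidean :: 'b::topological_space topology)"
  shows "locally_compact_space (euclidean :: ('a \<times> 'b) topology)"
  using assms locally_compact_space_prod_topology[of "euclidean :: 'a topology" "euclidean :: 'b
      topology"] by simp

text \<open>
  The defining identity of a Radon product for a nonnegative test function; compactness of its
  support makes all integrals finite, so that they can be read as integrals of extended nonnegative
  functions.
\<close>

lemma radon_product_test_function:
  fixes \<mu> :: "'a::t2_space measure" and \<nu> :: "'b::t2_space measure" and F :: "'a \<times> 'b \<Rightarrow> real"
  assumes \<pi>: "radon_product w \<mu> \<nu> \<pi>" and \<mu>: "radon_measure \<mu>" and \<nu>: "radon_measure \<nu>"
    and w: "continuous_on UNIV w" "\<And>x. 0 \<le> w x"
    and F: "continuous_on UNIV F" "\<And>z. 0 \<le> F z" "\<And>z. F z \<le> 1" "compact K" "\<And>z. z \<notin> K \<Longrightarrow> F z = 0"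
  shows "(\<integral>\<^sup>+z. ennreal (F z) \<partial>\<pi>) = (\<integral>\<^sup>+x. \<integral>\<^sup>+y. ennreal (w x * F (x, y)) \<partial>\<nu> \<partial>\<mu>)"
proof -
  have \<pi>R: "radon_measure \<pi>" using \<pi> by (simp add: radon_product_def)
  note sets = radon_measureD(1)[OF \<mu>] radon_measureD(1)[OF \<nu>] radon_measureD(1)[OF \<pi>R]
  have Fb: "F \<in> borel_measurable borel" using F(1) by (rule borel_measurable_continuous_onI)
  have wb[measurable]: "w \<in> borel_measurable \<mu>"
    using borel_measurable_continuous_onI[OF w(1)] sets by (simp cong: measurable_cong_sets)
  have [measurable]: "(\<lambda>y. F (x, y)) \<in> borel_measurable \<nu>" for x
    using Fb sets(2) by (rule measurable_Pair_left_borel)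
  have K1: "compact (fst ` K)" and K2: "compact (snd ` K)"
    using F(4) by (auto intro!: compact_continuous_image continuous_intros)
  have Ks[measurable]: "K \<in> sets \<pi>" "fst ` K \<in> sets \<mu>" "snd ` K \<in> sets \<nu>"
    using K1 K2 F(4) sets by (auto intro!: borel_closed compact_imp_closed)
  have F1: "F z \<le> indicator K z" for z using F(3,5) by (auto split: split_indicator)
  have F2: "F (x, y) \<le> indicator (snd ` K) y" for x y
    using F(3)[of "(x, y)"] F(5)[of "(x, y)"] by (force split: split_indicator)
  have F3: "F (x, y) = 0" if "x \<notin> fst ` K" for x y using F(5)[of "(x, y)"] that by force
  have ip: "integrable \<pi> F"
  proof (rule integrableI_nonneg)
    show "F \<in> borel_measurable \<pi>" using Fb sets by (simp cong: measurable_cong_sets)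
    have "(\<integral>\<^sup>+z. ennreal (F z) \<partial>\<pi>) \<le> (\<integral>\<^sup>+z. indicator K z \<partial>\<pi>)"
      using F1 by (intro nn_integral_mono) (auto split: split_indicator simp: F intro!:
          ennreal_le_1[THEN iffD2])
    also have "\<dots> < \<infinity>" using Ks radon_measureD(3)[OF \<pi>R F(4)] by simp
    finally show "(\<integral>\<^sup>+z. ennreal (F z) \<partial>\<pi>) < \<infinity>" .
  qed (use F in auto)
  have le2: "(\<integral>\<^sup>+y. ennreal (F (x, y)) \<partial>\<nu>) \<le> emeasure \<nu> (snd ` K)" for x
  proof -
    have "(\<integral>\<^sup>+y. ennreal (F (x, y)) \<partial>\<nu>) \<le> (\<integral>\<^sup>+y. indicator (snd ` K) y \<partial>\<nu>)"
    proof (intro nn_integral_mono)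
      fix y show "ennreal (F (x, y)) \<le> indicator (snd ` K) y"
        using F2[of x y] by (auto split: split_indicator_asm split_indicator simp: F ennreal_neg)
    qed
    then show ?thesis using Ks by simp
  qed
  have fin2: "emeasure \<nu> (snd ` K) < \<infinity>" by (rule radon_measureD(3)[OF \<nu> K2])
  have i2: "integrable \<nu> (\<lambda>y. F (x, y))" for x
    using le_less_trans[OF le2 fin2] F(2) by (intro integrableI_nonneg) auto
  define h where "h x = w x * (LINT y|\<nu>. F (x, y))" for x
  have h0: "0 \<le> h x" for x using w F by (auto simp: h_def intro!: mult_nonneg_nonneg integral_nonneg)
  have hn: "ennreal (h x) = (\<integral>\<^sup>+y. ennreal (w x * F (x, y)) \<partial>\<nu>)" for x
  proof -
    have "(\<integral>\<^sup>+y. ennreal (w x * F (x, y)) \<partial>\<nu>) = ennreal (LINT y|\<nu>. w x * F (x, y))"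
      using i2 w F by (intro nn_integral_eq_integral) auto
    then show ?thesis by (simp add: h_def)
  qed
  have "lower_semicont (\<lambda>x. \<integral>\<^sup>+y. (\<lambda>z. ennreal (w (fst z) * F z)) (x, y) \<partial>\<nu>)"
    by (intro lower_semicont_nn_integral radon_measureD \<nu> lower_semicont_continuous continuous_on_mult
        F(1) continuous_on_compose2[OF w(1)] continuous_intros) auto
  then have "(\<lambda>x. \<integral>\<^sup>+y. ennreal (w x * F (x, y)) \<partial>\<nu>) \<in> borel_measurable \<mu>"
    using sets(1) by (auto intro: lower_semicont_measurable)
  then have "(\<lambda>x. enn2real (ennreal (h x))) \<in> borel_measurable \<mu>" unfolding hn by simp
  then have hm: "h \<in> borel_measurable \<mu>" using h0 by simp
  have "bounded (w ` (fst ` K))"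
    by (rule compact_imp_bounded[OF compact_continuous_image[OF continuous_on_subset[OF w(1)
        subset_UNIV] K1]])
  then obtain b where b: "\<And>x. x \<in> fst ` K \<Longrightarrow> w x \<le> b"
    unfolding bounded_real by (metis abs_le_D1 image_eqI)
  have "(\<integral>\<^sup>+x. ennreal (h x) \<partial>\<mu>) \<le> (\<integral>\<^sup>+x. ennreal b * emeasure \<nu> (snd ` K) * indicator (fst ` K) x \<partial>\<mu>)"
  proof (intro nn_integral_mono)
    fix x
    show "ennreal (h x) \<le> ennreal b * emeasure \<nu> (snd ` K) * indicator (fst ` K) x"
    proof (cases "x \<in> fst ` K")
      case True
      have "ennreal (h x) = ennreal (w x) * ennreal (LINT y|\<nu>. F (x, y))"
        unfolding h_def using w F by (intro ennreal_mult) auto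
      also have "ennreal (LINT y|\<nu>. F (x, y)) = (\<integral>\<^sup>+y. ennreal (F (x, y)) \<partial>\<nu>)"
        using i2 F by (intro nn_integral_eq_integral[symmetric]) auto
      also have "ennreal (w x) * \<dots> \<le> ennreal b * emeasure \<nu> (snd ` K)"
        using b[OF True] le2 by (intro mult_mono ennreal_leI) auto
      finally show ?thesis using True by simp
    qed (use F3 in \<open>simp add: h_def\<close>)
  qed
  also have "\<dots> = ennreal b * emeasure \<nu> (snd ` K) * emeasure \<mu> (fst ` K)"
    by (subst nn_integral_cmult) auto
  also have "\<dots> < \<infinity>" using fin2 radon_measureD(3)[OF \<mu> K1] by (simp add: ennreal_mult_less_top)
  finally have hi: "integrable \<mu> h" using hm h0 by (intro integrableI_nonneg) auto
  have "(LINT z|\<pi>. F z) = (LINT x|\<mu>. h x)"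
    using \<pi> F(1,4,5) unfolding radon_product_def h_def by blast
  moreover have "(\<integral>\<^sup>+z. ennreal (F z) \<partial>\<pi>) = ennreal (LINT z|\<pi>. F z)"
    using ip F by (intro nn_integral_eq_integral) auto
  moreover have "(\<integral>\<^sup>+x. ennreal (h x) \<partial>\<mu>) = ennreal (LINT x|\<mu>. h x)"
    using hi h0 by (intro nn_integral_eq_integral) auto
  ultimately show ?thesis unfolding hn by simp
qed

text \<open>
  Bump functions between a compact subset of \<open>V\<close> and \<open>V\<close> give one inequality.  The other one is
  \<open>directed_lower_semicont\<close> for the partial integrals of the test functions below the indicator of
  \<open>V\<close>, which are directed under pointwise maxima.
\<close>

lemma radon_product_open:
  fixes \<mu> :: "'a::t2_space measure" and \<nu> :: "'b::t2_space measure" and V :: "('a \<times> 'b) set"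
  assumes \<pi>: "radon_product w \<mu> \<nu> \<pi>" and \<mu>: "radon_measure \<mu>" and \<nu>: "radon_measure \<nu>"
    and lc: "locally_compact_space (euclidean :: 'a topology)" "locally_compact_space (euclidean ::
        'b topology)"
    and w: "continuous_on UNIV w" "\<And>x. 0 \<le> w x" and V: "open V"
  shows "emeasure \<pi> V = (\<integral>\<^sup>+x. ennreal (w x) * emeasure \<nu> (Pair x -` V) \<partial>\<mu>)"
proof -
  have \<pi>R: "radon_measure \<pi>" using \<pi> by (simp add: radon_product_def)
  note sets = radon_measureD(1)[OF \<mu>] radon_measureD(1)[OF \<nu>] radon_measureD(1)[OF \<pi>R]
  note lcp = locally_compact_product[OF lc]
  have bV: "V \<in> sets borel" using V by auto
  have [measurable]: "Pair x -` V \<in> sets \<nu>" for x by (rule section_borel[OF bV sets(2)])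
  define \<T> where "\<T> = {F :: 'a \<times> 'b \<Rightarrow> real. continuous_on UNIV F \<and> (\<forall>z. 0 \<le> F z) \<and> (\<forall>z. F z \<le> 1) \<and>
    (\<forall>z. z \<notin> V \<longrightarrow> F z = 0) \<and> (\<exists>K. compact K \<and> (\<forall>z. z \<notin> K \<longrightarrow> F z = 0))}"
  define J where "J F x = (\<integral>\<^sup>+y. ennreal (w x * F (x, y)) \<partial>\<nu>)" for F :: "'a \<times> 'b \<Rightarrow> real" and x
  have JF: "(\<integral>\<^sup>+z. ennreal (F z) \<partial>\<pi>) = (\<integral>\<^sup>+x. J F x \<partial>\<mu>)" if "F \<in> \<T>" for F
    using that radon_product_test_function[OF \<pi> \<mu> \<nu> w] unfolding J_def \<T>_def by blast
  have FV: "ennreal (F z) \<le> indicator V z" if "F \<in> \<T>" for F z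
  proof -
    have "F z \<le> 1" "z \<notin> V \<Longrightarrow> F z = 0" using that unfolding \<T>_def by blast+
    then show ?thesis by (cases "z \<in> V") auto
  qed
  have bump: "\<exists>F\<in>\<T>. \<forall>z\<in>C. F z = 1" if C: "compact C" "C \<subseteq> V" for C
    by (rule compactly_supported_bump[OF lcp C(1) V C(2)]) (unfold \<T>_def, blast)
  define G where "G x = (\<integral>\<^sup>+y. ennreal (w x) * indicator V (x, y) \<partial>\<nu>)" for x
  have G: "G x = ennreal (w x) * emeasure \<nu> (Pair x -` V)" for x
  proof -
    have "G x = (\<integral>\<^sup>+y. ennreal (w x) * indicator (Pair x -` V) y \<partial>\<nu>)"
      unfolding G_def by (intro nn_integral_cong) (auto split: split_indicator)
    then show ?thesis by (subst (asm) nn_integral_cmult) auto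
  qed
  have JG: "J F x \<le> G x" if "F \<in> \<T>" for F x
    unfolding J_def G_def
  proof (intro nn_integral_mono)
    fix y
    have "ennreal (w x * F (x, y)) = ennreal (w x) * ennreal (F (x, y))"
      using that w by (intro ennreal_mult) (auto simp: \<T>_def)
    then show "ennreal (w x * F (x, y)) \<le> ennreal (w x) * indicator V (x, y)"
      using FV[OF that, of "(x, y)"] by (auto intro: mult_left_mono)
  qed
  have "emeasure \<pi> V \<le> (\<integral>\<^sup>+x. G x \<partial>\<mu>)"
  proof (rule dense_le)
    fix c assume "c < emeasure \<pi> V"
    then obtain C where C: "compact C" "C \<subseteq> V" "c < emeasure \<pi> C"
      using open_inner_regular_less[OF radon_measureD(2)[OF \<pi>R] V] by blast
    obtain F where F: "F \<in> \<T>" "\<forall>z\<in>C. F z = 1" using bump[OF C(1,2)] by blast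
    have mC: "C \<in> sets \<pi>" using C(1) sets by (auto intro!: borel_closed compact_imp_closed)
    have "emeasure \<pi> C = (\<integral>\<^sup>+z. indicator C z \<partial>\<pi>)" using mC by simp
    also have "\<dots> \<le> (\<integral>\<^sup>+z. ennreal (F z) \<partial>\<pi>)"
      using F(2) by (intro nn_integral_mono) (auto split: split_indicator)
    also have "\<dots> = (\<integral>\<^sup>+x. J F x \<partial>\<mu>)" by (rule JF[OF F(1)])
    also have "\<dots> \<le> (\<integral>\<^sup>+x. G x \<partial>\<mu>)" by (intro nn_integral_mono JG F)
    finally show "c \<le> (\<integral>\<^sup>+x. G x \<partial>\<mu>)" using C(3) by auto
  qed
  moreover have "(\<integral>\<^sup>+x. G x \<partial>\<mu>) \<le> emeasure \<pi> V"
  proof (rule dense_le)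
    fix c assume c: "c < (\<integral>\<^sup>+x. G x \<partial>\<mu>)"
    have lscw: "lower_semicont (\<lambda>z. ennreal (w (fst z)) * indicator V z)"
      unfolding lower_semicont_def
    proof
      fix a :: ennreal
      have "lower_semicont (\<lambda>z :: 'a \<times> 'b. ennreal (w (fst z)))"
        by (intro lower_semicont_continuous continuous_on_compose2[OF w(1)] continuous_intros) auto
      then have "open ({z. a < ennreal (w (fst z))} \<inter> V)" using V by (auto simp: lower_semicont_def)
      moreover have "{z. a < ennreal (w (fst z)) * indicator V z} = {z. a < ennreal (w (fst z))} \<inter> V"
        by (auto split: split_indicator_asm split_indicator)
      ultimately show "open {z. a < ennreal (w (fst z)) * indicator V z}" by simp
    qed
    have lscG: "lower_semicont G"
      using lower_semicont_nn_integral[OF radon_measureD(2)[OF \<nu>] lscw] unfolding G_def by simp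
    obtain \<phi> where \<phi>: "\<phi> \<in> J ` \<T>" "c < (\<integral>\<^sup>+x. \<phi> x \<partial>\<mu>)"
    proof (rule directed_lower_semicont[OF radon_measureD(2)[OF \<mu>] lscG c])
      show "J ` \<T> \<noteq> {}" using bump[of "{}"] by auto
      show "lower_semicont \<phi>" if \<phi>T: "\<phi> \<in> J ` \<T>" for \<phi>
      proof -
        obtain F where F: "F \<in> \<T>" "\<phi> = J F" using \<phi>T by auto
        have "lower_semicont (\<lambda>x. \<integral>\<^sup>+y. (\<lambda>z. ennreal (w (fst z) * F z)) (x, y) \<partial>\<nu>)"
          using F(1) unfolding \<T>_def
          by (intro lower_semicont_nn_integral radon_measureD \<nu> lower_semicont_continuous
              continuous_on_mult
              continuous_on_compose2[OF w(1)] continuous_intros) auto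
        then show ?thesis unfolding F(2) J_def by simp
      qed
      show "\<exists>\<eta>\<in>J ` \<T>. \<phi> \<le> \<eta> \<and> \<psi> \<le> \<eta>" if \<phi>\<psi>: "\<phi> \<in> J ` \<T>" "\<psi> \<in> J ` \<T>" for \<phi> \<psi>
      proof -
        obtain F E where FE: "F \<in> \<T>" "\<phi> = J F" "E \<in> \<T>" "\<psi> = J E" using \<phi>\<psi> by auto
        obtain K L where KL: "compact K" "\<forall>z. z \<notin> K \<longrightarrow> F z = 0" "compact L" "\<forall>z. z \<notin> L \<longrightarrow> E z = 0"
          using FE(1,3) by (auto simp: \<T>_def)
        have "\<exists>M. compact M \<and> (\<forall>z. z \<notin> M \<longrightarrow> max (F z) (E z) = 0)"
          using KL by (intro exI[of _ "K \<union> L"]) auto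
        then have "(\<lambda>z. max (F z) (E z)) \<in> \<T>"
          using FE(1,3) unfolding \<T>_def
          by (auto intro!: continuous_on_max simp: le_max_iff_disj)
        moreover have "\<phi> \<le> J (\<lambda>z. max (F z) (E z))" "\<psi> \<le> J (\<lambda>z. max (F z) (E z))"
          unfolding FE J_def le_fun_def using w(2)
          by (auto intro!: nn_integral_mono ennreal_leI mult_left_mono)
        ultimately show ?thesis by blast
      qed
      show "\<exists>\<phi>\<in>J ` \<T>. a < \<phi> x" if a: "a < G x" for x a
      proof -
        have "G x = (SUP C\<in>{C. compact C \<and> C \<subseteq> Pair x -` V}. ennreal (w x) * emeasure \<nu> C)"
          using radon_measureD(2)[OF \<nu>] open_section[OF V, of x]
          by (auto simp: G open_inner_regular_def SUP_mult_left_ennreal)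
        then obtain C where C: "compact C" "C \<subseteq> Pair x -` V" "a < ennreal (w x) * emeasure \<nu> C"
          using a by (auto simp: less_SUP_iff)
        have "compact ({x} \<times> C)" "{x} \<times> C \<subseteq> V" using C by (auto intro: compact_Times)
        then obtain F where F: "F \<in> \<T>" "\<forall>z\<in>{x} \<times> C. F z = 1" using bump by blast
        have mC: "C \<in> sets \<nu>" using C(1) sets by (auto intro!: borel_closed compact_imp_closed)
        note C(3)
        also have "ennreal (w x) * emeasure \<nu> C = (\<integral>\<^sup>+y. ennreal (w x) * indicator C y \<partial>\<nu>)"
          using mC by (subst nn_integral_cmult) auto
        also have "\<dots> \<le> J F x"
          unfolding J_def using F by (intro nn_integral_mono) (auto split: split_indicator)
        finally show ?thesis using F(1) by blast
      qed
    qed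
    then obtain F where F: "F \<in> \<T>" "c < (\<integral>\<^sup>+x. J F x \<partial>\<mu>)" by auto
    note F(2)
    also have "(\<integral>\<^sup>+x. J F x \<partial>\<mu>) = (\<integral>\<^sup>+z. ennreal (F z) \<partial>\<pi>)" using JF[OF F(1)] by simp
    also have "\<dots> \<le> (\<integral>\<^sup>+z. indicator V z \<partial>\<pi>)" by (intro nn_integral_mono FV F)
    also have "\<dots> = emeasure \<pi> V" using bV sets by simp
    finally show "c \<le> emeasure \<pi> V" by simp
  qed
  ultimately show ?thesis unfolding G by (rule antisym)
qed

text \<open>
  Outer regularity of \<open>\<pi>\<close> confines an integrable function to countably many open sets of finite
  measure, where the disintegration of open sets extends to Borel sets.
\<close>

lemma radon_product_fubini:
  fixes \<mu> :: "'a::t2_space measure" and \<nu> :: "'b::t2_space measure" and \<Phi> :: "'a \<times> 'b \<Rightarrow> complex"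
  assumes \<pi>: "radon_product w \<mu> \<nu> \<pi>" and \<mu>: "radon_measure \<mu>" and \<nu>: "radon_measure \<nu>"
    and lc: "locally_compact_space (euclidean :: 'a topology)" "locally_compact_space (euclidean ::
        'b topology)"
    and w: "continuous_on UNIV w" "\<And>x. 0 \<le> w x" and \<Phi>: "integrable \<pi> \<Phi>"
  shows "iterated_integrable (density \<mu> w) \<nu> \<Phi> (LINT z|\<pi>. \<Phi> z)"
proof -
  have \<pi>R: "radon_measure \<pi>" using \<pi> by (simp add: radon_product_def)
  note sets = radon_measureD(1)[OF \<mu>] radon_measureD(1)[OF \<nu>] radon_measureD(1)[OF \<pi>R]
  have wb[measurable]: "w \<in> borel_measurable \<mu>"
    using borel_measurable_continuous_onI[OF w(1)] sets by (simp cong: measurable_cong_sets)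
  have D: "disintegrates_on UNIV \<pi> (density \<mu> w) \<nu>"
    unfolding disintegrates_on_def
  proof (intro conjI allI impI)
    fix V :: "('a \<times> 'b) set" assume V: "open V"
    have m: "(\<lambda>x. emeasure \<nu> (Pair x -` V)) \<in> borel_measurable \<mu>"
      by (rule lower_semicont_measurable[OF lower_semicont_emeasure_section[OF radon_measureD(2)[OF
          \<nu>] V] sets(1)])
    then show "(\<lambda>x. emeasure \<nu> (Pair x -` V)) \<in> borel_measurable (density \<mu> w)" by simp
    show "emeasure \<pi> V = (\<integral>\<^sup>+x. emeasure \<nu> (Pair x -` V) \<partial>density \<mu> w)"
      using m by (subst nn_integral_density) (auto simp: radon_product_open[OF \<pi> \<mu> \<nu> lc w V])
  qed (use sets in auto)
  obtain O' where "sigma_open \<pi> O'" and van: "\<And>z. z \<notin> O' \<Longrightarrow> \<Phi> z = 0"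
    using integrable_sigma_open_support[OF \<pi>R \<Phi>] by blast
  then obtain W where W: "\<And>n. open (W n)" "\<And>n. emeasure \<pi> (W n) < \<infinity>" "incseq W" "O' = (\<Union>n::nat. W n)"
    unfolding sigma_open_def by blast
  show ?thesis
    by (rule disintegrates_on_integral[OF D W(3,1) _ W(2) \<Phi>]) (use van W(4) in auto)
qed

section \<open>Haar measures\<close>

lemma left_haar_measureD:
  assumes "left_haar_measure m M"
  shows "radon_measure M" "sets M = sets borel" "open_inner_regular M" "\<And>C. compact C \<Longrightarrow> emeasure M C
      < \<infinity>"
    "emeasure M UNIV \<noteq> 0"
  using assms radon_measureD[of M] by (auto simp: left_haar_measure_def)

lemma borel_measurable_add_left: "(\<lambda>y. x + y) \<in> (borel :: 'a::topological_group_add measure) \<rightarrow>\<^sub>M borel"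
  by (intro borel_measurable_continuous_onI continuous_intros)

lemma haar_distr_add_left:
  fixes M :: "'a::topological_group_add measure"
  assumes M: "left_haar_measure (+) M"
  shows "distr M borel (\<lambda>y. x + y) = M"
proof (rule measure_eqI)
  note sM = left_haar_measureD(2)[OF M]
  show "sets (distr M borel (\<lambda>y. x + y)) = sets M" using sM by simp
  fix A assume "A \<in> sets (distr M borel (\<lambda>y. x + y))"
  then have A: "A \<in> sets borel" by simp
  have sp: "space M = UNIV" using sM by (auto dest: sets_eq_imp_space_eq)
  have "(\<lambda>y. x + y) \<in> M \<rightarrow>\<^sub>M borel" using borel_measurable_add_left sM by (simp cong:
      measurable_cong_sets)
  then have "emeasure (distr M borel (\<lambda>y. x + y)) A = emeasure M ((\<lambda>y. x + y) -` A)"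
    using A sp by (simp add: emeasure_distr)
  also have "(\<lambda>y. x + y) -` A = (+) (- x) ` A"
  proof (intro equalityI subsetI)
    fix y assume "y \<in> (\<lambda>y. x + y) -` A"
    then show "y \<in> (+) (- x) ` A" by (intro image_eqI[of _ _ "x + y"]) (auto simp: add.assoc[symmetric])
  qed (auto simp: add.assoc[symmetric])
  also have "emeasure M \<dots> = emeasure M A" using M A by (simp add: left_haar_measure_def)
  finally show "emeasure (distr M borel (\<lambda>y. x + y)) A = emeasure M A" .
qed

text \<open>
  Steinhaus' argument.  Let \<open>C\<close> be compact of positive measure and \<open>U \<supseteq> C\<close> open of measure less than
  twice that of \<open>C\<close>.  For \<open>v\<close> near 0 the translate \<open>v + C\<close> lies in \<open>U\<close>, so it cannot be disjoint from
  \<open>C\<close>; hence the compact set \<open>C - C\<close> is a neighbourhood of 0.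
\<close>

lemma haar_locally_compact:
  fixes M :: "'a::{topological_group_add, t2_space} measure"
  assumes M: "left_haar_measure (+) M"
  shows "locally_compact_space (euclidean :: 'a topology)"
proof -
  note sM = left_haar_measureD(2)[OF M]
  have pos: "0 < emeasure M UNIV" using left_haar_measureD(5)[OF M] by (simp add:
      zero_less_iff_neq_zero)
  obtain C where C: "compact C" "0 < emeasure M C"
    by (rule open_inner_regular_less[OF left_haar_measureD(3)[OF M] open_UNIV pos])
  have bC: "C \<in> sets borel" using C(1) by (auto intro!: borel_closed compact_imp_closed)
  have fC: "emeasure M C < \<infinity>" by (rule left_haar_measureD(4)[OF M C(1)])
  have "emeasure M C + 0 < emeasure M C + emeasure M C"
    unfolding ennreal_add_left_cancel_less using C(2) fC by auto
  then have "emeasure M C < 2 * emeasure M C" by (simp only: mult_2 add_0_right)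
  then obtain U where U: "open U" "C \<subseteq> U" "emeasure M U < 2 * emeasure M C"
    using radon_outer_open[OF left_haar_measureD(1)[OF M] bC] by metis
  have "open ((\<lambda>z. fst z + snd z) -` U)" by (intro open_vimage U(1) continuous_intros)
  moreover have "{0} \<times> C \<subseteq> (\<lambda>z. fst z + snd z) -` U" using U(2) by auto
  ultimately have "\<exists>V. 0 \<in> V \<and> open V \<and> V \<times> C \<subseteq> (\<lambda>z. fst z + snd z) -` U"
    by (rule Elementary_Topology.tube_lemma[OF C(1)])
  then obtain V where V: "0 \<in> V" "open V" "V \<times> C \<subseteq> (\<lambda>z. fst z + snd z) -` U" by blast
  define L where "L = (\<lambda>z. fst z - snd z) ` (C \<times> C)"
  have L: "compact L" unfolding L_def using C(1)
    by (intro compact_continuous_image compact_Times continuous_intros)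
  have VL: "V \<subseteq> L"
  proof (rule subsetI, rule ccontr)
    fix v assume v: "v \<in> V" "v \<notin> L"
    have disj: "(+) v ` C \<inter> C = {}"
    proof (rule ccontr)
      assume "(+) v ` C \<inter> C \<noteq> {}"
      then obtain c where c: "c \<in> C" "v + c \<in> C" by auto
      have "v = (v + c) - c" by (simp add: add.assoc)
      then have "v \<in> L" unfolding L_def using c by (intro image_eqI[of _ _ "(v + c, c)"]) auto
      then show False using v by simp
    qed
    have cv: "compact ((+) v ` C)" by (intro compact_continuous_image C continuous_intros)
    then have bv: "(+) v ` C \<in> sets borel" by (auto intro!: borel_closed compact_imp_closed)
    have "2 * emeasure M C = emeasure M ((+) v ` C) + emeasure M C"
      using M bC by (simp add: left_haar_measure_def mult_2)
    also have "\<dots> = emeasure M ((+) v ` C \<union> C)"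
      using disj bC bv sM by (intro plus_emeasure) auto
    also have "\<dots> \<le> emeasure M U"
      using U V(3) v(1) sM by (intro emeasure_mono) auto
    finally show False using U(3) by auto
  qed
  show ?thesis
    unfolding locally_compact_space_def
  proof
    fix x :: 'a
    have "open ((\<lambda>y. - x + y) -` V)" by (intro open_vimage V(2) continuous_intros)
    moreover have "compact ((+) x ` L)" by (intro compact_continuous_image L continuous_intros)
    moreover have "x \<in> (\<lambda>y. - x + y) -` V" using V(1) by simp
    moreover have "(\<lambda>y. - x + y) -` V \<subseteq> (+) x ` L"
    proof
      fix y assume "y \<in> (\<lambda>y. - x + y) -` V"
      then have "- x + y \<in> L" using VL by auto
      then show "y \<in> (+) x ` L" by (intro image_eqI[of _ _ "- x + y"]) (auto simp: add.assoc[symmetric])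
    qed
    ultimately show "\<exists>U K. openin euclidean U \<and> compactin euclidean K \<and> x \<in> U \<and> U \<subseteq> K"
      by (metis open_openin compactin_euclidean_iff)
  qed
qed

lemma sigma_open_compact:
  fixes C :: "'a::t2_space set"
  assumes M: "radon_measure M" and C: "compact C"
  obtains A where "sigma_open M A" "C \<subseteq> A"
proof -
  have "C \<in> sets borel" using C by (auto intro!: borel_closed compact_imp_closed)
  then show thesis
    using sigma_open_cover[OF M, of "\<lambda>_. C"] radon_measureD(3)[OF M C] that by auto
qed

text \<open>
  Consider the double integral of \<open>1\<^sub>A(x + y) 1\<^sub>B(-y)\<close> for a compact set \<open>A\<close> of positive measure.
  Integrating over \<open>x\<close> first gives \<open>M A * M (-B)\<close>.  Replacing \<open>y\<close> by \<open>y - x\<close> turns the integrand into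
  \<open>1\<^sub>A(y) 1\<^sub>B(x - y)\<close>, and integrating this over \<open>x\<close> first gives \<open>M A * M B\<close>.
\<close>

lemma haar_uminus_compact:
  fixes M :: "'a::{topological_ab_group_add, t2_space} measure"
  assumes M: "left_haar_measure (+) M" and B: "compact B"
  shows "emeasure M (uminus ` B) = emeasure M B"
proof -
  note R = left_haar_measureD(1)[OF M] and sM = left_haar_measureD(2)[OF M] and oir =
      left_haar_measureD(3)[OF M]
  have sp: "space M = UNIV" using sM by (auto dest: sets_eq_imp_space_eq)
  have pos: "0 < emeasure M UNIV" using left_haar_measureD(5)[OF M] by (simp add:
      zero_less_iff_neq_zero)
  obtain A where A: "compact A" "0 < emeasure M A"
    by (rule open_inner_regular_less[OF oir open_UNIV pos])
  have nB: "compact (uminus ` B)" by (intro compact_continuous_image B continuous_intros)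
  define S where "S = (\<lambda>z. fst z + snd z) ` (A \<times> B)"
  have S: "compact S" unfolding S_def by (intro compact_continuous_image compact_Times A B
      continuous_intros)
  have bor[measurable]: "A \<in> sets borel" "B \<in> sets borel" "uminus ` B \<in> sets borel" "S \<in> sets borel"
    using A(1) B nB S by (auto intro!: borel_closed compact_imp_closed)
  have inM[measurable]: "A \<in> sets M" "B \<in> sets M" "uminus ` B \<in> sets M" "S \<in> sets M" using bor sM by
      auto
  have fin: "emeasure M A < \<infinity>" "emeasure M B < \<infinity>" "emeasure M (uminus ` B) < \<infinity>" "emeasure M S < \<infinity>"
    using A(1) B nB S left_haar_measureD(4)[OF M] by auto
  obtain OA where OA: "sigma_open M OA" "A \<subseteq> OA" by (rule sigma_open_compact[OF R A(1)])
  obtain OS where OS: "sigma_open M OS" "S \<subseteq> OS" by (rule sigma_open_compact[OF R S])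
  obtain OB where OB: "sigma_open M OB" "uminus ` B \<subseteq> OB" by (rule sigma_open_compact[OF R nB])
  have inBm: "indicator (uminus ` B) y = (indicator B (- y) :: complex)" for y
  proof -
    have "y \<in> uminus ` B \<longleftrightarrow> - y \<in> B" by (auto intro: image_eqI[of _ _ "- y"])
    then show ?thesis by (simp add: indicator_def)
  qed
  have tr: "(LINT y|M. f (x + y)) = (LINT y|M. f y)" if "f \<in> borel_measurable borel" for f :: "'a \<Rightarrow>
      complex" and x
  proof -
    have "(LINT y|M. f y) = (LINT y|distr M borel (\<lambda>y. x + y). f y)" by (simp add:
        haar_distr_add_left[OF M])
    also have "\<dots> = (LINT y|M. f (x + y))"
      using borel_measurable_add_left[of x] sM that by (subst integral_distr) (simp_all cong:
          measurable_cong_sets)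
    finally show ?thesis by simp
  qed
  have fun2: "(\<lambda>z. f (g z)) \<in> borel_measurable borel"
    if "f \<in> borel_measurable borel" "continuous_on UNIV g" for f :: "'a \<Rightarrow> complex" and g :: "'a \<times> 'a
        \<Rightarrow> 'a"
    using measurable_compose[OF borel_measurable_continuous_onI[OF that(2)] that(1)] .
  define \<Phi> where "\<Phi> z = (indicator A (fst z + snd z) * indicator B (- snd z) :: complex)" for z
  define \<Psi> where "\<Psi> z = (indicator A (snd z) * indicator B (fst z - snd z) :: complex)" for z
  have \<Phi>: "\<Phi> \<in> borel_measurable borel" and \<Psi>: "\<Psi> \<in> borel_measurable borel"
    unfolding \<Phi>_def \<Psi>_def
    by (intro borel_measurable_times fun2 borel_measurable_indicator bor continuous_intros)+
  have suppS: "x \<in> S" if "x + y \<in> A" "- y \<in> B" for x y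
    unfolding S_def using that by (intro image_eqI[of _ _ "(x + y, - y)"]) auto
  have suppB: "y \<in> uminus ` B" if "- y \<in> B" for y
    using that by (intro image_eqI[of _ _ "- y"]) auto
  have suppS': "x \<in> S" if "y \<in> A" "x - y \<in> B" for x y
    unfolding S_def using that by (intro image_eqI[of _ _ "(y, x - y)"]) auto
  have bound: "(\<integral>\<^sup>+x. \<integral>\<^sup>+y. ennreal (cmod (F (x, y))) \<partial>M \<partial>M) < \<infinity>"
    if "\<And>x y. cmod (F (x, y)) \<le> indicator S x * indicator T y" "T \<in> sets M" "emeasure M T < \<infinity>" for F T
  proof -
    have "(\<integral>\<^sup>+x. \<integral>\<^sup>+y. ennreal (cmod (F (x, y))) \<partial>M \<partial>M) \<le> (\<integral>\<^sup>+x. \<integral>\<^sup>+y. indicator S x * indicator T y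
        \<partial>M \<partial>M)"
    proof (intro nn_integral_mono)
      fix x y
      show "ennreal (cmod (F (x, y))) \<le> indicator S x * indicator T y"
        using ennreal_leI[OF that(1)[of x y]] by (auto split: split_indicator split_indicator_asm)
    qed
    also have "\<dots> = emeasure M S * emeasure M T"
      using that(2) by (simp add: nn_integral_cmult nn_integral_multc)
    also have "\<dots> < \<infinity>" using fin that(3) by (simp add: ennreal_mult_less_top)
    finally show ?thesis .
  qed
  have b\<Phi>: "cmod (\<Phi> (x, y)) \<le> indicator S x * indicator (uminus ` B) y" for x y
    using suppS[of x y] suppB[of y] by (auto simp: \<Phi>_def split: split_indicator)
  have b\<Psi>: "cmod (\<Psi> (x, y)) \<le> indicator S x * indicator A y" for x y
    using suppS'[of y x] by (auto simp: \<Psi>_def split: split_indicator)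
  obtain I where I: "has_iterated_integral M M (\<lambda>x y. \<Phi> (x, y)) I" "has_iterated_integral M M (\<lambda>y x.
      \<Phi> (x, y)) I"
  proof (rule radon_fubini[OF oir oir OS(1) OB(1) \<Phi>])
    show "\<Phi> (x, y) = 0" if "(x, y) \<notin> OS \<times> OB" for x y
      using that OS(2) OB(2) suppS[of x y] suppB[of y] by (auto simp: \<Phi>_def split: split_indicator)
    show "(\<integral>\<^sup>+x. \<integral>\<^sup>+y. ennreal (cmod (\<Phi> (x, y))) \<partial>M \<partial>M) < \<infinity>"
      by (rule bound[OF b\<Phi>]) (use inM fin in auto)
  qed
  obtain J where J: "has_iterated_integral M M (\<lambda>x y. \<Psi> (x, y)) J" "has_iterated_integral M M (\<lambda>y x.
      \<Psi> (x, y)) J"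
  proof (rule radon_fubini[OF oir oir OS(1) OA(1) \<Psi>])
    show "\<Psi> (x, y) = 0" if "(x, y) \<notin> OS \<times> OA" for x y
      using that OS(2) OA(2) suppS'[of y x] by (auto simp: \<Psi>_def split: split_indicator)
    show "(\<integral>\<^sup>+x. \<integral>\<^sup>+y. ennreal (cmod (\<Psi> (x, y))) \<partial>M \<partial>M) < \<infinity>"
      by (rule bound[OF b\<Psi>]) (use inM fin in auto)
  qed
  have "(LINT y|M. \<Phi> (x, y)) = (LINT y|M. \<Psi> (x, y))" for x
  proof -
    have m: "(\<lambda>y. \<Psi> (x, y)) \<in> borel_measurable borel" using measurable_Pair_left_borel[OF \<Psi>] by simp
    show ?thesis using tr[OF m, of x] by (simp add: \<Phi>_def \<Psi>_def algebra_simps)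
  qed
  then have IJ: "I = J" using I(1) J(1) unfolding has_iterated_integral_def by simp
  have indI: "(LINT y|M. indicator T y) = complex_of_real (measure M T)" if "T \<in> sets M" for T
  proof -
    have "(LINT y|M. indicator T y :: complex) = (LINT y|M. complex_of_real (indicator T y))"
      by (intro Bochner_Integration.integral_cong) (auto split: split_indicator)
    then show ?thesis using that sp by simp
  qed
  have "I = (LINT y|M. indicator B (- y) * (LINT x|M. indicator A (y + x)))"
    using I(2) by (simp add: has_iterated_integral_def \<Phi>_def add.commute mult.commute)
  also have "\<dots> = (LINT y|M. indicator (uminus ` B) y * complex_of_real (measure M A))"
    by (subst tr) (auto simp: indI inBm)
  also have "\<dots> = complex_of_real (measure M (uminus ` B)) * complex_of_real (measure M A)"
    by (simp add: indI)
  finally have I': "I = complex_of_real (measure M (uminus ` B) * measure M A)" by simp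
  have "J = (LINT y|M. indicator A y * (LINT x|M. indicator B (- y + x)))"
    using J(2) by (simp add: has_iterated_integral_def \<Psi>_def)
  also have "\<dots> = (LINT y|M. indicator A y * complex_of_real (measure M B))"
    by (subst tr) (auto simp: indI)
  also have "\<dots> = complex_of_real (measure M A) * complex_of_real (measure M B)"
    by (simp add: indI)
  finally have "J = complex_of_real (measure M B * measure M A)" by simp
  with I' IJ have "measure M (uminus ` B) * measure M A = measure M B * measure M A" by (metis
      of_real_eq_iff)
  moreover have "measure M A \<noteq> 0" using A(2) fin(1) by (auto simp: measure_def enn2real_eq_0_iff)
  ultimately have "measure M (uminus ` B) = measure M B" by simp
  then show ?thesis using fin by (simp add: emeasure_eq_ennreal_measure less_top)
qed

text \<open>
  From compact sets the invariance passes to open sets by inner regularity, and from there to Borel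
  sets by outer regularity.
\<close>

lemma haar_distr_uminus:
  fixes M :: "'a::{topological_ab_group_add, t2_space} measure"
  assumes M: "left_haar_measure (+) M"
  shows "distr M borel uminus = M"
proof (rule measure_eqI)
  note R = left_haar_measureD(1)[OF M] and sM = left_haar_measureD(2)[OF M] and oir =
      left_haar_measureD(3)[OF M]
  have sp: "space M = UNIV" using sM by (auto dest: sets_eq_imp_space_eq)
  show "sets (distr M borel uminus) = sets M" using sM by simp
  have vim: "uminus ` A = uminus -` A" for A :: "'a set" by (auto simp: image_iff) (metis minus_minus)
  have inv: "uminus ` uminus ` A = A" for A :: "'a set" by (simp add: image_image)
  have opm: "open (uminus ` U)" if "open U" for U :: "'a set"
    unfolding vim by (intro open_vimage that continuous_intros)
  have open_le: "emeasure M (uminus ` U) \<le> emeasure M U" if U: "open U" for U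
  proof (rule dense_le)
    fix c assume "c < emeasure M (uminus ` U)"
    then obtain C where C: "compact C" "C \<subseteq> uminus ` U" "c < emeasure M C"
      using open_inner_regular_less[OF oir opm[OF U]] by blast
    have "emeasure M C = emeasure M (uminus ` C)" using haar_uminus_compact[OF M C(1)] by simp
    also have "\<dots> \<le> emeasure M U" using C(2) U sM by (intro emeasure_mono) auto
    finally show "c \<le> emeasure M U" using C(3) by auto
  qed
  have le: "emeasure M (uminus ` A) \<le> emeasure M A" if A: "A \<in> sets borel" for A
  proof (rule dense_ge)
    fix c assume "emeasure M A < c"
    then obtain U where U: "open U" "A \<subseteq> U" "emeasure M U < c"
      using radon_outer_open[OF R A] by blast
    have "emeasure M (uminus ` A) \<le> emeasure M (uminus ` U)"
      using U(1,2) opm sM by (intro emeasure_mono) auto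
    also have "\<dots> \<le> emeasure M U" by (rule open_le[OF U(1)])
    finally show "emeasure M (uminus ` A) \<le> c" using U(3) by auto
  qed
  fix A assume "A \<in> sets (distr M borel uminus)"
  then have A: "A \<in> sets borel" by simp
  have um: "uminus \<in> (borel :: 'a measure) \<rightarrow>\<^sub>M borel" by (intro borel_measurable_continuous_onI
      continuous_intros)
  have nA: "uminus ` A \<in> sets borel" using measurable_sets[OF um A] vim by simp
  have "emeasure (distr M borel uminus) A = emeasure M (uminus ` A)"
    using um A sp sM vim by (subst emeasure_distr) (auto cong: measurable_cong_sets)
  also have "\<dots> = emeasure M A"
    using le[OF A] le[OF nA] unfolding inv by (rule antisym)
  finally show "emeasure (distr M borel uminus) A = emeasure M A" .
qed

lemma haar_distr_affine:
  fixes M :: "'a::{topological_ab_group_add, t2_space} measure"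
  assumes M: "left_haar_measure (+) M"
  shows "distr M borel (\<lambda>y. y + x) = M" "distr M borel (\<lambda>y. x - y) = M"
proof -
  note sM = left_haar_measureD(2)[OF M]
  show "distr M borel (\<lambda>y. y + x) = M" using haar_distr_add_left[OF M, of x] by (simp add: add.commute)
  have um: "uminus \<in> M \<rightarrow>\<^sub>M borel" using sM
    by (simp cong: measurable_cong_sets) (intro borel_measurable_continuous_onI continuous_intros)
  have "distr M borel (\<lambda>y. x - y) = distr (distr M borel uminus) borel (\<lambda>y. x + y)"
    using um borel_measurable_add_left[of x] by (subst distr_distr) (auto simp: o_def)
  then show "distr M borel (\<lambda>y. x - y) = M"
    using haar_distr_uminus[OF M] haar_distr_add_left[OF M, of x] by simp
qed

lemma distr_invariance:
  fixes M :: "'a::topological_space measure" and f :: "'a \<Rightarrow> 'b::{banach, second_countable_topology}"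
  assumes sM: "sets M = sets borel" and T: "continuous_on UNIV T" "distr M borel T = M"
    and f: "f \<in> borel_measurable borel"
  shows "(LINT y|M. f (T y)) = (LINT y|M. f y)" "integrable M (\<lambda>y. f (T y)) \<longleftrightarrow> integrable M f"
proof -
  have Tm: "T \<in> M \<rightarrow>\<^sub>M borel" using borel_measurable_continuous_onI[OF T(1)] sM by (simp cong:
      measurable_cong_sets)
  show "(LINT y|M. f (T y)) = (LINT y|M. f y)"
    using integral_distr[OF Tm f] T(2) by simp
  show "integrable M (\<lambda>y. f (T y)) \<longleftrightarrow> integrable M f"
    using integrable_distr_eq[OF Tm f] T(2) by simp
qed

lemma distr_invariance_nn:
  fixes M :: "'a::topological_space measure" and f :: "'a \<Rightarrow> ennreal"
  assumes sM: "sets M = sets borel" and T: "continuous_on UNIV T" "distr M borel T = M"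
    and f: "f \<in> borel_measurable borel"
  shows "(\<integral>\<^sup>+y. f (T y) \<partial>M) = (\<integral>\<^sup>+y. f y \<partial>M)"
proof -
  have Tm: "T \<in> M \<rightarrow>\<^sub>M borel" using borel_measurable_continuous_onI[OF T(1)] sM by (simp cong:
      measurable_cong_sets)
  have "f \<in> borel_measurable M" using f sM by (simp cong: measurable_cong_sets)
  then show ?thesis using nn_integral_distr[OF Tm, of f] T(2) by simp
qed

lemma distr_invariance_AE:
  fixes M :: "'a::topological_space measure"
  assumes sM: "sets M = sets borel" and T: "continuous_on UNIV T" "distr M borel T = M"
    and P: "AE y in M. P y"
  shows "AE y in M. P (T y)"
proof -
  have Tm: "T \<in> M \<rightarrow>\<^sub>M borel" using borel_measurable_continuous_onI[OF T(1)] sM by (simp cong: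
      measurable_cong_sets)
  show ?thesis using AE_distrD[OF Tm, of P] P unfolding T(2) by simp
qed

text \<open>
  On a compact neighbourhood of \<open>k\<close>, nearby characters are uniformly close.
\<close>

lemma continuous_char_at:
  assumes lc: "locally_compact_space (euclidean :: 'k::{topological_ab_group_add, t2_space} topology)"
  shows "continuous_on UNIV (\<lambda>z :: 'k dual \<times> 'k. char_at (fst z) (snd z))"
  unfolding continuous_on_def
proof
  fix z :: "'k dual \<times> 'k"
  obtain \<xi>0 k0 where z: "z = (\<xi>0, k0)" by (cases z)
  obtain U L where U: "open U" "compact L" "k0 \<in> U" "U \<subseteq> L"
  proof -
    have "\<forall>x::'k. \<exists>U K. open U \<and> compact K \<and> x \<in> U \<and> U \<subseteq> K"
      using lc unfolding locally_compact_space_def by simp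
    then show thesis using that by blast
  qed
  show "((\<lambda>z. char_at (fst z) (snd z)) \<longlongrightarrow> char_at (fst z) (snd z)) (at z within UNIV)"
  proof (rule tendstoI)
    fix e :: real assume e: "0 < e"
    define B where "B = char_at \<xi>0 -` ball (char_at \<xi>0 k0) (e / 2)"
    have B: "open B" "k0 \<in> B" unfolding B_def using e char_at_props(1)[of \<xi>0] by (auto intro!:
        open_vimage)
    define S where "S = dual_nbhd \<xi>0 L (e / 2) \<times> (U \<inter> B)"
    have "open S" unfolding S_def using U B by (intro open_Times open_dual_nbhd open_Int)
    moreover have "z \<in> S" using U B e by (auto simp: S_def z dual_nbhd_def)
    moreover have "dist (char_at (fst y) (snd y)) (char_at (fst z) (snd z)) < e" if "y \<in> S" for y
    proof -
      have 1: "dist (char_at (fst y) (snd y)) (char_at \<xi>0 (snd y)) < e / 2"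
        using that U(4) by (auto simp: S_def dual_nbhd_def dist_norm)
      have 2: "dist (char_at \<xi>0 (snd y)) (char_at \<xi>0 k0) < e / 2"
        using that by (auto simp: S_def B_def dist_commute)
      show ?thesis using dist_triangle_half_l[OF 1, of "char_at \<xi>0 k0"] 2 by (simp add: z dist_commute)
    qed
    ultimately show "\<forall>\<^sub>F y in at z within UNIV. dist (char_at (fst y) (snd y)) (char_at (fst z) (snd
        z)) < e"
      unfolding eventually_at_topological by blast
  qed
qed

section \<open>Fourier inversion\<close>

lemma borel_measurable_cnj [measurable (raw)]:
  "f \<in> borel_measurable M \<Longrightarrow> (\<lambda>x. cnj (f x)) \<in> borel_measurable M"
  by (erule measurable_compose) (intro borel_measurable_continuous_onI continuous_intros)

lemma open_exhausted_by_compacts: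
  fixes M :: "'a::t2_space measure"
  assumes M: "open_inner_regular M" and V: "open V" "emeasure M V < \<infinity>"
  obtains D :: "nat \<Rightarrow> 'a set" where "\<And>m. compact (D m)" "\<And>m. D m \<subseteq> V" "V - (\<Union>m. D m) \<in> null_sets M"
proof -
  have sM: "sets M = sets borel" by (rule open_inner_regularD[OF M])
  let ?A = "emeasure M ` {C. compact C \<and> C \<subseteq> V}"
  have "?A \<noteq> {}" by auto
  from ennreal_Sup_countable_SUP[OF this] obtain f :: "nat \<Rightarrow> ennreal"
    where f: "incseq f" "range f \<subseteq> ?A" "Sup ?A = (SUP i. f i)" by blast
  then have "\<forall>n. \<exists>C. compact C \<and> C \<subseteq> V \<and> f n = emeasure M C" by auto
  then obtain D where D: "\<And>n. compact (D n)" "\<And>n. D n \<subseteq> V" "\<And>n. f n = emeasure M (D n)" by metis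
  have mD: "D n \<in> sets M" for n using D(1) sM by (auto intro!: borel_closed compact_imp_closed)
  have mV: "V \<in> sets M" using V sM by auto
  have VU: "emeasure M V = (SUP i. f i)"
    using M V(1) f(3) by (simp add: open_inner_regular_def)
  also have "\<dots> \<le> emeasure M (\<Union>m. D m)"
    unfolding D(3) using mD by (intro SUP_least emeasure_mono) auto
  finally have ge: "emeasure M V \<le> emeasure M (\<Union>m. D m)" .
  have UV: "(\<Union>m. D m) \<subseteq> V" using D(2) by auto
  have le: "emeasure M (\<Union>m. D m) \<le> emeasure M V" using UV mV by (intro emeasure_mono) auto
  have mU: "(\<Union>m. D m) \<in> sets M" using mD by auto
  have "emeasure M (V - (\<Union>m. D m)) = emeasure M V - emeasure M (\<Union>m. D m)"
    by (rule emeasure_Diff[OF _ mV mU UV]) (use le V(2) in \<open>auto simp: top_unique\<close>)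
  also have "\<dots> = 0" using ge le V(2) by (simp add: antisym[OF ge le] less_top[symmetric])
  finally have "V - (\<Union>m. D m) \<in> null_sets M" using mV mU by auto
  then show thesis using D by (intro that[of D])
qed

text \<open>
  Sigma-compact carriers serve two purposes: up to a small error an integrable function on the dual
  group lives on a compact, hence equicontinuous, set of characters, and the differences of two
  sigma-compact sets form a sigma-compact set, which bounds the support of \<open>(\<xi>, \<omega>) \<mapsto> p \<xi> * q (\<xi> - \<omega>)\<close>.
\<close>

lemma integrable_sigma_compact_carrier:
  fixes M :: "'a::t2_space measure" and g :: "'a \<Rightarrow> 'b::{banach, second_countable_topology}"
  assumes M: "radon_measure M" and g: "integrable M g"
  obtains C :: "nat \<Rightarrow> 'a set" where "incseq C" "\<And>n. compact (C n)" "AE x in M. x \<notin> (\<Union>n. C n) \<longrightarrow> g x = 0"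
proof -
  obtain O' where O': "sigma_open M O'" "\<And>x. x \<notin> O' \<Longrightarrow> g x = 0"
    using integrable_sigma_open_support[OF M g] by blast
  obtain V :: "nat \<Rightarrow> 'a set" where V': "\<forall>n. open (V n) \<and> emeasure M (V n) < \<infinity>" "O' = (\<Union>n. V n)"
    using O'(1) unfolding sigma_open_def by (elim exE conjE) (rule that)
  then have V: "\<And>n. open (V n)" "\<And>n. emeasure M (V n) < \<infinity>" "O' = (\<Union>n. V n)" by auto
  have "\<exists>D. (\<forall>m. compact (D m)) \<and> V n - (\<Union>m::nat. D m) \<in> null_sets M" for n
  proof -
    obtain D :: "nat \<Rightarrow> 'a set" where "\<And>m. compact (D m)" "\<And>m. D m \<subseteq> V n" "V n - (\<Union>m. D m) \<in> null_sets M"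
      using open_exhausted_by_compacts[OF radon_measureD(2)[OF M] V(1,2)[of n]] by blast
    then show ?thesis by (intro exI[of _ D]) auto
  qed
  then obtain D where D: "\<And>n m. compact (D n m)" "\<And>n. V n - (\<Union>m::nat. D n m) \<in> null_sets M" by metis
  define C where "C j = (\<Union>n\<le>j. \<Union>m\<le>j. D n m)" for j
  have "incseq C" unfolding incseq_def C_def by (intro allI impI UN_mono) auto
  moreover have "compact (C j)" for j unfolding C_def using D(1) by (intro compact_UN) auto
  moreover have "AE x in M. x \<notin> (\<Union>n. C n) \<longrightarrow> g x = 0"
  proof -
    have "(\<Union>n. V n - (\<Union>m. D n m)) \<in> null_sets M" using D(2) by auto
    then have "AE x in M. x \<notin> (\<Union>n. V n - (\<Union>m. D n m))" by (rule AE_not_in)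
    then show ?thesis
    proof eventually_elim
      case (elim x)
      show ?case
      proof (intro impI O'(2) notI)
        assume x: "x \<notin> (\<Union>n. C n)" "x \<in> O'"
        then obtain n where n: "x \<in> V n" using V(3) by auto
        then obtain m where "x \<in> D n m" using elim by auto
        then have "x \<in> C (max n m)" unfolding C_def by (intro UN_I[of n] UN_I[of m]) auto
        then show False using x by auto
      qed
    qed
  qed
  ultimately show thesis by (rule that)
qed

definition inv_fourier :: "'k::topological_ab_group_add dual measure \<Rightarrow> ('k dual \<Rightarrow> complex) \<Rightarrow> 'k \<Rightarrow>
    complex" where
  "inv_fourier \<mu>D g k = (LINT \<xi>|\<mu>D. g \<xi> * char_at \<xi> k)"

lemma L2_times_indicator_integrable:
  assumes v: "v \<in> L2 M" and E: "E \<in> sets M" "emeasure M E < \<infinity>"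
  shows "integrable M (\<lambda>x. indicator E x * v x)"
proof (rule Bochner_Integration.integrable_bound)
  show "integrable M (\<lambda>x. indicator E x + (cmod (v x))\<^sup>2 :: real)"
    using v E by (auto simp: L2_def)
  show "(\<lambda>x. indicator E x * v x) \<in> borel_measurable M" using v E by (auto simp: L2_def)
  show "AE x in M. cmod (indicator E x * v x) \<le> norm (indicator E x + (cmod (v x))\<^sup>2 :: real)"
  proof (rule AE_I2)
    fix x
    have "cmod (v x) \<le> 1 + (cmod (v x))\<^sup>2"
      by (smt (verit, best) power2_diff norm_ge_zero one_power2 zero_le_power2 mult_cancel_left1)
    then show "cmod (indicator E x * v x) \<le> norm (indicator E x + (cmod (v x))\<^sup>2 :: real)"
      by (auto split: split_indicator)
  qed
qed

locale plancherel_pair =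
  fixes \<mu>K :: "'k::{topological_ab_group_add, t2_space} measure" and \<mu>D :: "'k dual measure"
    and U :: "('k \<Rightarrow> complex) \<Rightarrow> 'k dual \<Rightarrow> complex"
  assumes lcK: "locally_compact_space (euclidean :: 'k topology)"
    and haarK: "left_haar_measure (+) \<mu>K" and haarD: "left_haar_measure (+) \<mu>D"
    and transform: "plancherel_map \<mu>K \<mu>D U"
begin

lemmas sK = left_haar_measureD(2)[OF haarK] and sD = left_haar_measureD(2)[OF haarD]
  and RK = left_haar_measureD(1)[OF haarK] and RD = left_haar_measureD(1)[OF haarD]
  and oirK = left_haar_measureD(3)[OF haarK] and oirD = left_haar_measureD(3)[OF haarD]

lemma char_measurable [measurable]:
  "(\<lambda>\<xi>. char_at \<xi> k) \<in> borel_measurable \<mu>D" "char_at \<xi> \<in> borel_measurable \<mu>K"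
proof -
  have "(\<lambda>\<xi>. (\<lambda>z. char_at (fst z) (snd z)) (\<xi>, k)) \<in> borel_measurable borel"
    by (intro borel_measurable_continuous_onI continuous_on_compose2[OF continuous_char_at[OF lcK]]
        continuous_intros) auto
  then show "(\<lambda>\<xi>. char_at \<xi> k) \<in> borel_measurable \<mu>D" using sD by (simp cong: measurable_cong_sets)
  show "char_at \<xi> \<in> borel_measurable \<mu>K"
    using borel_measurable_continuous_onI[OF char_at_props(1)] sK by (simp cong: measurable_cong_sets)
qed

lemma integrable_times_char:
  assumes "integrable \<mu>D g" shows "integrable \<mu>D (\<lambda>\<xi>. g \<xi> * char_at \<xi> k)"
  by (rule Bochner_Integration.integrable_bound[OF assms]) (use assms in \<open>auto simp: norm_mult
      char_at_props\<close>)

lemma inv_fourier_bound: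
  assumes "integrable \<mu>D g" shows "cmod (inv_fourier \<mu>D g k) \<le> (LINT \<xi>|\<mu>D. cmod (g \<xi>))"
  unfolding inv_fourier_def
  using integral_norm_bound[of \<mu>D "\<lambda>\<xi>. g \<xi> * char_at \<xi> k"] by (simp add: norm_mult char_at_props)

text \<open>
  Up to \<open>e / 4\<close> the mass of \<open>g\<close> sits on a compact set of characters, which is equicontinuous at \<open>k0\<close>.
\<close>

lemma inv_fourier_continuous:
  assumes g: "integrable \<mu>D g" shows "continuous_on UNIV (inv_fourier \<mu>D g)"
  unfolding continuous_on_def
proof
  fix k0
  have [measurable]: "g \<in> borel_measurable \<mu>D" using g by auto
  show "(inv_fourier \<mu>D g \<longlongrightarrow> inv_fourier \<mu>D g k0) (at k0 within UNIV)"
  proof (rule tendstoI)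
    fix e :: real assume e: "0 < e"
    obtain C where C: "incseq C" "\<And>n::nat. compact (C n)" "AE \<xi> in \<mu>D. \<xi> \<notin> (\<Union>n. C n) \<longrightarrow> g \<xi> = 0"
      using integrable_sigma_compact_carrier[OF RD g] by blast
    \<comment> \<open>The mass of \<open>g\<close> outside \<open>C n\<close> tends to 0.\<close>
    have [measurable]: "C n \<in> sets \<mu>D" for n using C(2) sD by (auto intro!: borel_closed
        compact_imp_closed)
    have "(\<lambda>n. LINT \<xi>|\<mu>D. cmod (g \<xi>) * indicator (- C n) \<xi>) \<longlonglongrightarrow> (LINT \<xi>|\<mu>D. 0)"
    proof (rule integral_dominated_convergence[where w = "\<lambda>\<xi>. cmod (g \<xi>)"])
      show "AE \<xi> in \<mu>D. (\<lambda>n. cmod (g \<xi>) * indicator (- C n) \<xi>) \<longlonglongrightarrow> 0"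
        using C(3)
      proof eventually_elim
        case (elim \<xi>)
        show ?case
        proof (cases "\<xi> \<in> (\<Union>n. C n)")
          case True
          then obtain N where "\<xi> \<in> C N" by auto
          then have "\<forall>n\<ge>N. \<xi> \<in> C n" using C(1) by (auto simp: incseq_def)
          then have "\<forall>\<^sub>F n in sequentially. cmod (g \<xi>) * indicator (- C n) \<xi> = 0"
            by (auto simp: eventually_sequentially intro!: exI[of _ N])
          then show ?thesis by (rule tendsto_eventually)
        qed (use elim in simp)
      qed
      show "AE \<xi> in \<mu>D. norm (cmod (g \<xi>) * indicator (- C n) \<xi>) \<le> cmod (g \<xi>)" for n
        by (auto split: split_indicator)
    qed (use g in auto)
    then have "\<forall>\<^sub>F n in sequentially. (LINT \<xi>|\<mu>D. cmod (g \<xi>) * indicator (- C n) \<xi>) < e / 4"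
      by (rule order_tendstoD) (use e in simp)
    then obtain n where n: "(LINT \<xi>|\<mu>D. cmod (g \<xi>) * indicator (- C n) \<xi>) < e / 4"
      by (auto dest: eventually_happens)
    define B where "B = (LINT \<xi>|\<mu>D. cmod (g \<xi>))"
    have B: "0 \<le> B" by (simp add: B_def)
    define \<eta> where "\<eta> = e / (4 * (B + 1))"
    have \<eta>: "0 < \<eta>" using e B by (simp add: \<eta>_def)
    have cont: "continuous_on (UNIV \<times> C n) (\<lambda>z :: 'k \<times> 'k dual. char_at (snd z) (fst z))"
    proof (rule continuous_on_subset[OF _ subset_UNIV])
      have "continuous_on UNIV (\<lambda>z :: 'k \<times> 'k dual. (\<lambda>w. char_at (fst w) (snd w)) (snd z, fst z))"
        by (intro continuous_on_compose2[OF continuous_char_at[OF lcK]] continuous_intros) auto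
      then show "continuous_on UNIV (\<lambda>z :: 'k \<times> 'k dual. char_at (snd z) (fst z))" by simp
    qed
    obtain X where X: "k0 \<in> X" "open X"
      "\<forall>k\<in>X \<inter> UNIV. \<forall>\<xi>\<in>C n. dist (char_at (snd (k, \<xi>)) (fst (k, \<xi>))) (char_at (snd (k0, \<xi>)) (fst
          (k0, \<xi>))) \<le> \<eta>"
      by (rule continuous_on_prod_compactE[OF cont C(2) UNIV_I \<eta>])
    have "dist (inv_fourier \<mu>D g k) (inv_fourier \<mu>D g k0) < e" if k: "k \<in> X" for k
    proof -
      have iC: "integrable \<mu>D (\<lambda>\<xi>. cmod (g \<xi>) * indicator (- C n) \<xi>)"
        by (rule Bochner_Integration.integrable_bound[OF integrable_norm[OF g]]) (auto split:
            split_indicator)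
      have "inv_fourier \<mu>D g k - inv_fourier \<mu>D g k0 = (LINT \<xi>|\<mu>D. g \<xi> * (char_at \<xi> k - char_at \<xi> k0))"
        unfolding inv_fourier_def using integrable_times_char[OF g]
        by (subst Bochner_Integration.integral_diff[symmetric]) (auto simp: algebra_simps)
      also have "cmod \<dots> \<le> (LINT \<xi>|\<mu>D. cmod (g \<xi> * (char_at \<xi> k - char_at \<xi> k0)))"
        by (rule integral_norm_bound)
      also have "\<dots> \<le> (LINT \<xi>|\<mu>D. cmod (g \<xi>) * \<eta> + 2 * (cmod (g \<xi>) * indicator (- C n) \<xi>))"
      proof (rule integral_mono)
        show "integrable \<mu>D (\<lambda>\<xi>. cmod (g \<xi> * (char_at \<xi> k - char_at \<xi> k0)))"
          using integrable_times_char[OF g] by (intro integrable_norm) (auto simp: right_diff_distrib)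
        show "integrable \<mu>D (\<lambda>\<xi>. cmod (g \<xi>) * \<eta> + 2 * (cmod (g \<xi>) * indicator (- C n) \<xi>))"
          using iC g by auto
        fix \<xi>
        show "cmod (g \<xi> * (char_at \<xi> k - char_at \<xi> k0)) \<le> cmod (g \<xi>) * \<eta> + 2 * (cmod (g \<xi>) *
            indicator (- C n) \<xi>)"
        proof (cases "\<xi> \<in> C n")
          case True
          then have "cmod (char_at \<xi> k - char_at \<xi> k0) \<le> \<eta>" using X(3) k by (auto simp: dist_norm)
          then show ?thesis using True by (simp add: norm_mult mult_left_mono)
        next
          case False
          have "cmod (char_at \<xi> k - char_at \<xi> k0) \<le> 2"
            using norm_triangle_ineq4[of "char_at \<xi> k" "char_at \<xi> k0"] by (simp add: char_at_props)
          then have "cmod (g \<xi>) * cmod (char_at \<xi> k - char_at \<xi> k0) \<le> cmod (g \<xi>) * 2" by (rule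
              mult_left_mono) simp
          moreover have "0 \<le> cmod (g \<xi>) * \<eta>" using \<eta> by simp
          ultimately show ?thesis using False unfolding norm_mult by simp
        qed
      qed
      also have "\<dots> = B * \<eta> + 2 * (LINT \<xi>|\<mu>D. cmod (g \<xi>) * indicator (- C n) \<xi>)"
        using iC g by (simp add: B_def)
      also have "\<dots> < e / 4 + 2 * (e / 4)"
      proof -
        have "B * \<eta> \<le> e / 4" using B e by (simp add: \<eta>_def divide_simps algebra_simps)
        then show ?thesis using n by simp
      qed
      also have "\<dots> < e" using e by simp
      finally show ?thesis by (simp add: dist_norm)
    qed
    then show "\<forall>\<^sub>F k in at k0 within UNIV. dist (inv_fourier \<mu>D g k) (inv_fourier \<mu>D g k0) < e"
      unfolding eventually_at_topological using X(1,2) by blast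
  qed
qed

lemma inv_fourier_measurable:
  assumes "integrable \<mu>D g"
  shows "inv_fourier \<mu>D g \<in> borel_measurable borel" "inv_fourier \<mu>D g \<in> borel_measurable \<mu>K"
proof -
  show "inv_fourier \<mu>D g \<in> borel_measurable borel"
    by (rule borel_measurable_continuous_onI[OF inv_fourier_continuous[OF assms]])
  then show "inv_fourier \<mu>D g \<in> borel_measurable \<mu>K" using sK by (simp cong: measurable_cong_sets)
qed

text \<open>
  The pairing of \<open>v\<close> with the indicator function of \<open>E\<close> is, by unitarity, the pairing of \<open>U v\<close> with an
  honest Fourier integral, and Fubini's theorem moves the characters to the other factor.
\<close>

lemma inversion_weak:
  assumes v: "v \<in> L2 \<mu>K" and i: "integrable \<mu>D (U v)" and E: "E \<in> sets borel" "emeasure \<mu>K E < \<infinity>"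
  shows "(LINT k|\<mu>K. indicator E k * v k) = (LINT k|\<mu>K. indicator E k * inv_fourier \<mu>D (U v) k)"
proof -
  have EK[measurable]: "E \<in> sets \<mu>K" using E sK by simp
  have sp: "space \<mu>K = UNIV" using sK by (auto dest: sets_eq_imp_space_eq)
  define e :: "'k \<Rightarrow> complex" where "e = indicator E"
  have eI: "integrable \<mu>K e"
  proof -
    have "e = (\<lambda>k. complex_of_real (indicator E k))" by (auto simp: e_def split: split_indicator)
    then show ?thesis using E(2) by simp
  qed
  have e2: "e \<in> L2 \<mu>K"
  proof -
    have "(\<lambda>x. (cmod (e x))\<^sup>2) = indicator E" by (auto simp: e_def split: split_indicator)
    then show ?thesis using E(2) by (auto simp: L2_def e_def)
  qed
  have Uv: "U v \<in> L2 \<mu>D" and Ue: "U e \<in> L2 \<mu>D" and inn: "L2_inner \<mu>D (U v) (U e) = L2_inner \<mu>K v e"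
    and four: "AE \<xi> in \<mu>D. U e \<xi> = fourier \<mu>K e \<xi>"
    using transform v e2 eI unfolding plancherel_map_def L2_unitary_def by auto
  obtain A where A: "sigma_open \<mu>D A" "\<And>\<xi>. \<xi> \<notin> A \<Longrightarrow> U v \<xi> = 0"
    using integrable_sigma_open_support[OF RD i] by blast
  obtain B where B: "sigma_open \<mu>K B" "\<And>k. k \<notin> B \<Longrightarrow> e k = 0"
    using integrable_sigma_open_support[OF RK eI] by blast
  define \<Phi> where "\<Phi> z = U v (fst z) * (e (snd z) * char_at (fst z) (snd z))" for z
  have fsm: "(fst :: 'k dual \<times> 'k \<Rightarrow> _) \<in> borel \<rightarrow>\<^sub>M borel" "(snd :: 'k dual \<times> 'k \<Rightarrow> _) \<in> borel \<rightarrow>\<^sub>M borel"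
    by (intro borel_measurable_continuous_onI continuous_intros)+
  have ch: "(\<lambda>z. char_at (fst z) (snd z)) \<in> borel_measurable (borel :: ('k dual \<times> 'k) measure)"
    by (rule borel_measurable_continuous_onI[OF continuous_char_at[OF lcK]])
  have eb: "e \<in> borel_measurable borel" unfolding e_def using E by simp
  have Uvb: "U v \<in> borel_measurable borel" using Uv sD by (simp add: L2_def cong: measurable_cong_sets)
  have em: "(\<lambda>z. e (snd z)) \<in> borel_measurable (borel :: ('k dual \<times> 'k) measure)"
    by (rule measurable_compose[OF fsm(2) eb])
  have Uvm: "(\<lambda>z. U v (fst z)) \<in> borel_measurable (borel :: ('k dual \<times> 'k) measure)"
    by (rule measurable_compose[OF fsm(1) Uvb])
  have \<Phi>m: "\<Phi> \<in> borel_measurable borel" unfolding \<Phi>_def by (intro borel_measurable_times em ch Uvm)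
  obtain I where I: "has_iterated_integral \<mu>D \<mu>K (\<lambda>\<xi> k. \<Phi> (\<xi>, k)) I" "has_iterated_integral \<mu>K \<mu>D
      (\<lambda>k \<xi>. \<Phi> (\<xi>, k)) I"
  proof (rule radon_fubini[OF oirD oirK A(1) B(1) \<Phi>m])
    show "\<Phi> (\<xi>, k) = 0" if "(\<xi>, k) \<notin> A \<times> B" for \<xi> k
      using that A(2)[of \<xi>] B(2)[of k] by (auto simp: \<Phi>_def)
    have "(\<integral>\<^sup>+\<xi>. \<integral>\<^sup>+k. ennreal (cmod (\<Phi> (\<xi>, k))) \<partial>\<mu>K \<partial>\<mu>D) = (\<integral>\<^sup>+\<xi>. ennreal (cmod (U v \<xi>)) * emeasure
        \<mu>K E \<partial>\<mu>D)"
    proof (intro nn_integral_cong)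
      fix \<xi>
      have "(\<integral>\<^sup>+k. ennreal (cmod (\<Phi> (\<xi>, k))) \<partial>\<mu>K) = (\<integral>\<^sup>+k. ennreal (cmod (U v \<xi>)) * indicator E k \<partial>\<mu>K)"
        by (intro nn_integral_cong) (auto simp: \<Phi>_def e_def norm_mult char_at_props split:
            split_indicator)
      then show "(\<integral>\<^sup>+k. ennreal (cmod (\<Phi> (\<xi>, k))) \<partial>\<mu>K) = ennreal (cmod (U v \<xi>)) * emeasure \<mu>K E"
        by (simp add: nn_integral_cmult)
    qed
    also have "\<dots> = (\<integral>\<^sup>+\<xi>. ennreal (cmod (U v \<xi>)) \<partial>\<mu>D) * emeasure \<mu>K E"
      using i by (intro nn_integral_multc) auto
    also have "\<dots> < \<infinity>" using i E(2) by (simp add: integrable_iff_bounded ennreal_mult_less_top)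
    finally show "(\<integral>\<^sup>+\<xi>. \<integral>\<^sup>+k. ennreal (cmod (\<Phi> (\<xi>, k))) \<partial>\<mu>K \<partial>\<mu>D) < \<infinity>" .
  qed
  have fm: "fourier \<mu>K e \<in> borel_measurable \<mu>D"
  proof -
    have "(\<lambda>\<xi>. LINT k|\<mu>K. (\<lambda>z. e (snd z) * cnj (char_at (fst z) (snd z))) (\<xi>, k)) \<in> borel_measurable
        borel"
      using B(2) by (intro measurable_integral_section[OF oirK B(1)] borel_measurable_times em
          borel_measurable_cnj ch) auto
    then show ?thesis using sD by (simp add: fourier_def[abs_def] cong: measurable_cong_sets)
  qed
  have cn: "cnj (fourier \<mu>K e \<xi>) = (LINT k|\<mu>K. e k * char_at \<xi> k)" for \<xi>
  proof -
    have "cnj (fourier \<mu>K e \<xi>) = (LINT k|\<mu>K. cnj (e k * cnj (char_at \<xi> k)))"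
      unfolding fourier_def by (rule Bochner_Integration.integral_cnj[symmetric])
    also have "\<dots> = (LINT k|\<mu>K. e k * char_at \<xi> k)"
      by (intro Bochner_Integration.integral_cong) (auto simp: e_def split: split_indicator)
    finally show ?thesis .
  qed
  have "(LINT k|\<mu>K. indicator E k * v k) = L2_inner \<mu>K v e"
    unfolding L2_inner_def
    by (intro Bochner_Integration.integral_cong) (auto simp: e_def split: split_indicator)
  also have "\<dots> = L2_inner \<mu>D (U v) (U e)" using inn by simp
  also have "\<dots> = (LINT \<xi>|\<mu>D. U v \<xi> * cnj (fourier \<mu>K e \<xi>))"
    unfolding L2_inner_def
  proof (rule integral_cong_AE)
    show "AE \<xi> in \<mu>D. U v \<xi> * cnj (U e \<xi>) = U v \<xi> * cnj (fourier \<mu>K e \<xi>)"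
      using four by eventually_elim simp
  qed (use Uv Ue fm in \<open>auto simp: L2_def\<close>)
  also have "\<dots> = (LINT \<xi>|\<mu>D. LINT k|\<mu>K. \<Phi> (\<xi>, k))"
    unfolding cn \<Phi>_def by simp
  also have "\<dots> = (LINT k|\<mu>K. LINT \<xi>|\<mu>D. \<Phi> (\<xi>, k))"
    using I by (simp add: has_iterated_integral_def)
  also have "\<dots> = (LINT k|\<mu>K. indicator E k * inv_fourier \<mu>D (U v) k)"
    unfolding \<Phi>_def inv_fourier_def by (simp add: e_def mult.left_commute)
  finally show ?thesis .
qed

text \<open>
  Restriction to \<open>E\<close> makes the measure finite, and there the integrals over Borel subsets, which
  \<open>inversion_weak\<close> provides, determine an integrable function.
\<close>

lemma inversion_on_finite:
  assumes v: "v \<in> L2 \<mu>K" and i: "integrable \<mu>D (U v)" and E: "E \<in> sets borel" "emeasure \<mu>K E < \<infinity>"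
  shows "AE k in \<mu>K. k \<in> E \<longrightarrow> v k = inv_fourier \<mu>D (U v) k"
proof -
  have EK[measurable]: "E \<in> sets \<mu>K" using E sK by simp
  let ?w = "inv_fourier \<mu>D (U v)"
  let ?N = "density \<mu>K (\<lambda>x. ennreal (indicator E x))"
  have vm[measurable]: "v \<in> borel_measurable \<mu>K" using v by (simp add: L2_def)
  have wm[measurable]: "?w \<in> borel_measurable \<mu>K" by (rule inv_fourier_measurable[OF i])
  have "emeasure ?N (space ?N) = emeasure \<mu>K E"
    using sets.top[of \<mu>K] E by (simp add: emeasure_density ennreal_indicator)
  then interpret N: finite_measure ?N using E(2) by (intro finite_measureI) auto
  have conv: "integrable ?N f \<longleftrightarrow> integrable \<mu>K (\<lambda>k. indicator E k * f k)"
    "(LINT k|?N. f k) = (LINT k|\<mu>K. indicator E k * f k)" if [measurable]: "f \<in> borel_measurable \<mu>K"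
        for f :: "'k \<Rightarrow> complex"
  proof -
    have e: "(\<lambda>k. indicat_real E k *\<^sub>R f k) = (\<lambda>k. indicator E k * f k)" by (auto split:
        split_indicator)
    show "integrable ?N f \<longleftrightarrow> integrable \<mu>K (\<lambda>k. indicator E k * f k)"
      by (subst integrable_density) (auto simp: e)
    show "(LINT k|?N. f k) = (LINT k|\<mu>K. indicator E k * f k)"
      by (subst integral_density) (auto simp: e)
  qed
  have "AE k in ?N. v k = ?w k"
  proof (rule N.density_unique_banach)
    show "integrable ?N v" using conv(1)[OF vm] L2_times_indicator_integrable[OF v EK E(2)] by simp
    show "integrable ?N ?w"
    proof (rule N.integrable_const_bound)
      show "AE k in ?N. cmod (?w k) \<le> (LINT \<xi>|\<mu>D. cmod (U v \<xi>))" using inv_fourier_bound[OF i] by auto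
    qed simp
    fix A assume "A \<in> sets ?N"
    then have A[measurable]: "A \<in> sets \<mu>K" by simp
    have AE: "A \<inter> E \<in> sets borel" "emeasure \<mu>K (A \<inter> E) < \<infinity>"
      using A E sK le_less_trans[OF emeasure_mono[of "A \<inter> E" E \<mu>K] E(2)] by auto
    have e: "(LINT k:A|?N. f k) = (LINT k|\<mu>K. indicator (A \<inter> E) k * f k)" if "f \<in> borel_measurable
        \<mu>K" for f :: "'k \<Rightarrow> complex"
    proof -
      have "(LINT k:A|?N. f k) = (LINT k|\<mu>K. indicator E k * (indicat_real A k *\<^sub>R f k))"
        unfolding set_lebesgue_integral_def using that by (intro conv) auto
      also have "\<dots> = (LINT k|\<mu>K. indicator (A \<inter> E) k * f k)"
        by (intro Bochner_Integration.integral_cong) (auto split: split_indicator)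
      finally show ?thesis .
    qed
    show "(LINT k:A|?N. v k) = (LINT k:A|?N. ?w k)"
      unfolding e[OF vm] e[OF wm] by (rule inversion_weak[OF v i AE])
  qed
  then show ?thesis by (subst (asm) AE_density) (auto split: split_indicator)
qed

text \<open>
  The equality is known on sets of finite measure, so it remains to see that both sides vanish off
  countably many of them.  For the right-hand side this is where continuity enters: the sets
  \<open>{|w| > 1/n}\<close> are open, so their measure is the supremum over compact subsets, and on these \<open>w\<close>
  coincides with \<open>v\<close>, which bounds their measure by \<open>n\<^sup>2 \<parallel>v\<parallel>\<^sup>2\<close>.
\<close>

theorem inversion:
  assumes v: "v \<in> L2 \<mu>K" and i: "integrable \<mu>D (U v)"
  shows "AE k in \<mu>K. v k = inv_fourier \<mu>D (U v) k"
proof -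
  let ?w = "inv_fourier \<mu>D (U v)"
  have vm[measurable]: "v \<in> borel_measurable \<mu>K" and vi: "integrable \<mu>K (\<lambda>k. (cmod (v k))\<^sup>2)"
    using v by (auto simp: L2_def)
  have wm[measurable]: "?w \<in> borel_measurable \<mu>K" by (rule inv_fourier_measurable[OF i])
  define G where "G n = {k. 1 / real (Suc n) < cmod (?w k)}" for n
  have oG: "open (G n)" for n unfolding G_def
    by (intro open_Collect_less continuous_intros inv_fourier_continuous[OF i])
  define B where "B = (\<integral>\<^sup>+k. ennreal ((cmod (v k))\<^sup>2) \<partial>\<mu>K)"
  have B: "B < \<infinity>" unfolding B_def using vi by (simp add: integrable_iff_bounded)
  have fG: "emeasure \<mu>K (G n) < \<infinity>" for n
  proof -
    have "emeasure \<mu>K (G n) \<le> ennreal ((real (Suc n))\<^sup>2) * B"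
    proof (rule dense_le)
      fix c assume "c < emeasure \<mu>K (G n)"
      then obtain C where C: "compact C" "C \<subseteq> G n" "c < emeasure \<mu>K C"
        using open_inner_regular_less[OF oirK oG] by metis
      have bC: "C \<in> sets borel" using C(1) by (auto intro!: borel_closed compact_imp_closed)
      then have [measurable]: "C \<in> sets \<mu>K" using sK by simp
      have "emeasure \<mu>K C = (\<integral>\<^sup>+k. indicator C k \<partial>\<mu>K)" by simp
      also have "\<dots> \<le> (\<integral>\<^sup>+k. ennreal ((real (Suc n))\<^sup>2) * ennreal ((cmod (v k))\<^sup>2) \<partial>\<mu>K)"
      proof (rule nn_integral_mono_AE)
        show "AE k in \<mu>K. indicator C k \<le> ennreal ((real (Suc n))\<^sup>2) * ennreal ((cmod (v k))\<^sup>2)"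
          using inversion_on_finite[OF v i bC left_haar_measureD(4)[OF haarK C(1)]]
        proof eventually_elim
          case (elim k)
          show ?case
          proof (cases "k \<in> C")
            case True
            then have "1 / real (Suc n) < cmod (v k)" using C(2) elim by (auto simp: G_def)
            then have "1 \<le> real (Suc n) * cmod (v k)" by (simp add: field_simps)
            then have "1 \<le> (real (Suc n) * cmod (v k))\<^sup>2" by (rule one_le_power)
            then have "ennreal 1 \<le> ennreal ((real (Suc n))\<^sup>2 * (cmod (v k))\<^sup>2)"
              by (intro ennreal_leI) (simp only: power_mult_distrib)
            then show ?thesis using True by (simp add: ennreal_mult)
          qed simp
        qed
      qed
      also have "\<dots> = ennreal ((real (Suc n))\<^sup>2) * B" unfolding B_def by (rule nn_integral_cmult) simp
      finally show "c \<le> ennreal ((real (Suc n))\<^sup>2) * B" using C(3) by auto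
    qed
    also have "\<dots> < \<infinity>" using B by (simp add: ennreal_mult_less_top)
    finally show ?thesis .
  qed
  obtain A where A: "\<And>n::nat. A n \<in> sets borel" "\<And>n. emeasure \<mu>K (A n) < \<infinity>" "{k. (cmod (v k))\<^sup>2 \<noteq> 0}
      = (\<Union>n. A n)"
    using integrable_support_countable[OF RK vi] by auto
  have bG: "G n \<in> sets borel" for n using oG by auto
  have "AE k in \<mu>K. \<forall>n. k \<in> G n \<longrightarrow> v k = ?w k"
    unfolding AE_all_countable using inversion_on_finite[OF v i bG fG] by blast
  moreover have "AE k in \<mu>K. \<forall>n. k \<in> A n \<longrightarrow> v k = ?w k"
    unfolding AE_all_countable using inversion_on_finite[OF v i A(1,2)] by blast
  ultimately show ?thesis
  proof eventually_elim
    case (elim k)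
    show ?case
    proof (rule ccontr)
      assume ne: "v k \<noteq> ?w k"
      have "k \<notin> (\<Union>n. A n)" using elim ne by auto
      then have "v k = 0" using A(3) by auto
      then have "0 < cmod (?w k)" using ne by simp
      then obtain n where "inverse (real (Suc n)) < cmod (?w k)" using reals_Archimedean by blast
      then have "k \<in> G n" by (simp add: G_def inverse_eq_divide)
      then show False using elim ne by auto
    qed
  qed
qed

lemma inv_fourier_preimage:
  assumes g: "integrable \<mu>D g" "g \<in> L2 \<mu>D"
  obtains v where "v \<in> L2 \<mu>K" "AE \<xi> in \<mu>D. U v \<xi> = g \<xi>" "AE k in \<mu>K. v k = inv_fourier \<mu>D g k"
proof -
  obtain v where v: "v \<in> L2 \<mu>K" "AE \<xi> in \<mu>D. U v \<xi> = g \<xi>"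
    using transform g(2) unfolding plancherel_map_def L2_unitary_def by blast
  have m: "U v \<in> borel_measurable \<mu>D" "g \<in> borel_measurable \<mu>D"
    using transform v(1) g unfolding plancherel_map_def L2_unitary_def L2_def by auto
  have i: "integrable \<mu>D (U v)" using integrable_cong_AE[OF m v(2)] g(1) by simp
  have "inv_fourier \<mu>D (U v) k = inv_fourier \<mu>D g k" for k
    unfolding inv_fourier_def using m v(2) by (intro integral_cong_AE) auto
  then show thesis using inversion[OF v(1) i] v by (intro that) auto
qed

text \<open>
  The Plancherel map is onto, so \<open>g\<close> and \<open>h\<close> are Fourier transforms of square-integrable functions,
  which are the inverse transforms of \<open>g\<close> and \<open>h\<close> by \<open>inversion\<close>.
\<close>

theorem inv_fourier_Parseval:
  assumes g: "integrable \<mu>D g" "g \<in> L2 \<mu>D" and h: "integrable \<mu>D h" "h \<in> L2 \<mu>D"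
  shows "inv_fourier \<mu>D g \<in> L2 \<mu>K"
    "L2_inner \<mu>K (inv_fourier \<mu>D g) (inv_fourier \<mu>D h) = L2_inner \<mu>D g h"
proof -
  obtain v where v: "v \<in> L2 \<mu>K" "AE \<xi> in \<mu>D. U v \<xi> = g \<xi>" "AE k in \<mu>K. v k = inv_fourier \<mu>D g k"
    by (rule inv_fourier_preimage[OF g])
  obtain w where w: "w \<in> L2 \<mu>K" "AE \<xi> in \<mu>D. U w \<xi> = h \<xi>" "AE k in \<mu>K. w k = inv_fourier \<mu>D h k"
    by (rule inv_fourier_preimage[OF h])
  note m = inv_fourier_measurable(2)[OF g(1)] inv_fourier_measurable(2)[OF h(1)]
  have UL: "U v \<in> L2 \<mu>D" "U w \<in> L2 \<mu>D" "L2_inner \<mu>D (U v) (U w) = L2_inner \<mu>K v w"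
    using transform v(1) w(1) unfolding plancherel_map_def L2_unitary_def by auto
  have "integrable \<mu>K (\<lambda>k. (cmod (v k))\<^sup>2) \<longleftrightarrow> integrable \<mu>K (\<lambda>k. (cmod (inv_fourier \<mu>D g k))\<^sup>2)"
    using v m by (intro integrable_cong_AE) (auto simp: L2_def)
  then show "inv_fourier \<mu>D g \<in> L2 \<mu>K" using v(1) m by (auto simp: L2_def)
  have "L2_inner \<mu>K (inv_fourier \<mu>D g) (inv_fourier \<mu>D h) = L2_inner \<mu>K v w"
    unfolding L2_inner_def
  proof (rule integral_cong_AE)
    show "AE k in \<mu>K. inv_fourier \<mu>D g k * cnj (inv_fourier \<mu>D h k) = v k * cnj (w k)"
      using v(3) w(3) by eventually_elim simp
  qed (use v w m in \<open>auto simp: L2_def\<close>)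
  also have "\<dots> = L2_inner \<mu>D (U v) (U w)" using UL by simp
  also have "\<dots> = L2_inner \<mu>D g h"
    unfolding L2_inner_def
  proof (rule integral_cong_AE)
    show "AE \<xi> in \<mu>D. U v \<xi> * cnj (U w \<xi>) = g \<xi> * cnj (h \<xi>)"
      using v(2) w(2) by eventually_elim simp
  qed (use UL g h in \<open>auto simp: L2_def\<close>)
  finally show "L2_inner \<mu>K (inv_fourier \<mu>D g) (inv_fourier \<mu>D h) = L2_inner \<mu>D g h" .
qed

end

section \<open>The Gabor transform on the frequency side\<close>

lemma char_at_diff: "char_at \<omega> (x - y) = char_at \<omega> x * cnj (char_at \<omega> y)"
proof -
  have "char_at \<omega> (x - y) * char_at \<omega> y = char_at \<omega> x"
    using char_at_props(2)[of \<omega> "x - y" y] by simp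
  moreover have "char_at \<omega> y * cnj (char_at \<omega> y) = 1"
    using complex_norm_square[of "char_at \<omega> y"] by (simp add: char_at_props)
  ultimately show ?thesis by (metis mult.assoc mult.right_neutral)
qed

lemma char_at_dual_diff: "char_at (\<omega> - \<psi> :: 'a::topological_ab_group_add dual) k = char_at \<omega> k * cnj
    (char_at \<psi> k)"
  by (simp only: diff_conv_add_uminus char_at_plus char_at_uminus)

lemma char_at_cnj_cancel: "char_at \<omega> k * cnj (char_at \<omega> k) = 1" "cnj (char_at \<omega> k) * char_at \<omega> k = 1"
  using complex_norm_square[of "char_at \<omega> k"] by (simp_all add: char_at_props mult.commute)

lemma L2_times_integrable:
  assumes "v \<in> L2 M" "w \<in> L2 M" shows "integrable M (\<lambda>x. v x * w x)"
proof (rule Bochner_Integration.integrable_bound)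
  show "integrable M (\<lambda>x. (cmod (v x))\<^sup>2 + (cmod (w x))\<^sup>2)" using assms by (auto simp: L2_def)
  show "(\<lambda>x. v x * w x) \<in> borel_measurable M" using assms by (auto simp: L2_def)
  show "AE x in M. cmod (v x * w x) \<le> norm ((cmod (v x))\<^sup>2 + (cmod (w x))\<^sup>2)"
  proof (rule AE_I2)
    fix x
    have "2 * (cmod (v x) * cmod (w x)) \<le> (cmod (v x))\<^sup>2 + (cmod (w x))\<^sup>2"
      using sum_squares_bound[of "cmod (v x)" "cmod (w x)"] by simp
    moreover have "0 \<le> cmod (v x) * cmod (w x)" by simp
    ultimately have "cmod (v x) * cmod (w x) \<le> (cmod (v x))\<^sup>2 + (cmod (w x))\<^sup>2" by linarith
    then show "cmod (v x * w x) \<le> norm ((cmod (v x))\<^sup>2 + (cmod (w x))\<^sup>2)" by (simp add: norm_mult)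
  qed
qed

lemma L2_cnj: "v \<in> L2 M \<Longrightarrow> (\<lambda>x. cnj (v x)) \<in> L2 M"
  by (auto simp: L2_def)

lemma has_iterated_integral_cmult:
  assumes "has_iterated_integral M N F I"
  shows "has_iterated_integral M N (\<lambda>x y. c * F x y) (c * I)"
proof -
  have "AE x in M. integrable N (F x)" "integrable M (\<lambda>x. LINT y|N. F x y)" "(LINT x|M. LINT y|N. F
      x y) = I"
    using assms by (auto simp: has_iterated_integral_def)
  then show ?thesis by (auto simp: has_iterated_integral_def)
qed

lemma has_product_integral_cmult:
  assumes "has_product_integral \<mu> \<nu> F I" and c: "c \<noteq> 0"
  shows "has_product_integral \<mu> \<nu> (\<lambda>x y. c * F x y) (c * I)"
  using assms has_iterated_integral_cmult[of \<mu> \<nu> F I c] has_iterated_integral_cmult[of \<nu> \<mu> "\<lambda>y x. F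
      x y" I c]
  unfolding has_product_integral_def
proof (intro conjI allI impI)
  fix \<pi> assume "radon_product (\<lambda>_. 1) \<mu> \<nu> \<pi>" and "integrable \<pi> (\<lambda>z. c * F (fst z) (snd z))"
  moreover have "(\<lambda>z. inverse c * (c * F (fst z) (snd z))) = (\<lambda>z. F (fst z) (snd z))" using c by auto
  ultimately have "(LINT z|\<pi>. F (fst z) (snd z)) = I"
    using assms(1) integrable_mult_right[of "inverse c" \<pi> "\<lambda>z. c * F (fst z) (snd z)"]
    unfolding has_product_integral_def by simp
  then show "(LINT z|\<pi>. c * F (fst z) (snd z)) = c * I" by simp
qed auto

lemma continuous_on_affine:
  "continuous_on UNIV (\<lambda>y. y + x)" "continuous_on UNIV (\<lambda>y. x - y :: 'b::topological_ab_group_add)"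
  by (intro continuous_intros)+

lemma borel_measurable_compose_continuous:
  fixes f :: "'b::topological_space \<Rightarrow> complex"
  assumes "f \<in> borel_measurable borel" "continuous_on UNIV T"
  shows "(\<lambda>z. f (T z)) \<in> borel_measurable (borel :: 'c::topological_space measure)"
  by (rule measurable_compose[OF borel_measurable_continuous_onI[OF assms(2)] assms(1)])

lemma L2_times_unimodular:
  assumes "integrable M g" "g \<in> L2 M" "c \<in> borel_measurable M" "\<And>x. cmod (c x) = 1"
  shows "integrable M (\<lambda>x. g x * c x)" "(\<lambda>x. g x * c x) \<in> L2 M"
proof -
  show "integrable M (\<lambda>x. g x * c x)"
    by (rule Bochner_Integration.integrable_bound[OF assms(1)]) (use assms in \<open>auto simp: norm_mult\<close>)
  show "(\<lambda>x. g x * c x) \<in> L2 M" using assms by (auto simp: L2_def norm_mult)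
qed

text \<open>
  Here \<open>p\<close> and \<open>q\<close> are the Fourier transforms of the analysed function and of the window, modified on
  null sets so that they vanish off \<open>A\<close> and \<open>B\<close>.  All integrands on the square of the dual group are
  then supported in rectangles with sides \<open>A\<close>, \<open>B\<close> or \<open>C\<close>, as \<open>radon_fubini\<close> requires.
\<close>

locale gabor_pair = plancherel_pair \<mu>K \<mu>D U
  for \<mu>K :: "'k::{topological_ab_group_add, t2_space} measure" and \<mu>D :: "'k dual measure"
    and U :: "('k \<Rightarrow> complex) \<Rightarrow> 'k dual \<Rightarrow> complex" +
  fixes p q :: "'k dual \<Rightarrow> complex" and A B C :: "'k dual set"
  assumes p: "integrable \<mu>D p" "p \<in> L2 \<mu>D" and q: "integrable \<mu>D q" "q \<in> L2 \<mu>D"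
    and opens: "sigma_open \<mu>D A" "sigma_open \<mu>D B" "sigma_open \<mu>D C"
    and supp: "\<And>\<xi>. \<xi> \<notin> A \<Longrightarrow> p \<xi> = 0" "\<And>\<xi>. \<xi> \<notin> B \<Longrightarrow> q \<xi> = 0"
      "\<And>\<xi> \<eta>. p \<xi> \<noteq> 0 \<Longrightarrow> q \<eta> \<noteq> 0 \<Longrightarrow> \<xi> - \<eta> \<in> C"
begin

abbreviation W where "W \<equiv> inv_fourier \<mu>D"

lemma pb: "p \<in> borel_measurable borel" and qb: "q \<in> borel_measurable borel"
  using p(1) q(1) sD by (auto dest!: borel_measurable_integrable cong: measurable_cong_sets)

lemmas affD = haar_distr_affine[OF haarD] and affK = haar_distr_affine[OF haarK]

lemmas D_plus = distr_invariance[OF sD continuous_on_affine(1) affD(1)]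
  and D_minus = distr_invariance[OF sD continuous_on_affine(2) affD(2)]
  and K_minus = distr_invariance[OF sK continuous_on_affine(2) affK(2)]
  and K_plus_AE = distr_invariance_AE[OF sK continuous_on_affine(1) affK(1)]
  and K_minus_AE = distr_invariance_AE[OF sK continuous_on_affine(2) affK(2)]

lemma char_borel: "(\<lambda>\<xi>. char_at \<xi> k) \<in> borel_measurable (borel :: 'k dual measure)"
  using char_measurable(1)[of k] sD by (simp cong: measurable_cong_sets)

text \<open>
  The bound is of convolution type: for fixed \<open>\<xi>\<close> the second factor has an integral that is independent
  of \<open>\<xi>\<close> by invariance of the measure under \<open>T \<xi>\<close>.
\<close>

lemma dual_fubini:
  fixes a b :: "'k dual \<Rightarrow> real" and \<Phi> :: "'k dual \<times> 'k dual \<Rightarrow> complex"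
  assumes ab: "integrable \<mu>D a" "integrable \<mu>D b" "\<And>\<xi>. 0 \<le> a \<xi>" "\<And>\<xi>. 0 \<le> b \<xi>"
    and T: "\<And>\<xi>. continuous_on UNIV (T \<xi>)" "\<And>\<xi>. distr \<mu>D borel (T \<xi>) = \<mu>D"
    and \<Phi>: "\<Phi> \<in> borel_measurable borel" "\<And>\<xi> \<omega>. cmod (\<Phi> (\<xi>, \<omega>)) \<le> a \<xi> * b (T \<xi> \<omega>)"
    and S: "sigma_open \<mu>D S" "sigma_open \<mu>D S'" "\<And>\<xi> \<omega>. (\<xi>, \<omega>) \<notin> S \<times> S' \<Longrightarrow> \<Phi> (\<xi>, \<omega>) = 0"
  obtains I where "has_iterated_integral \<mu>D \<mu>D (\<lambda>\<xi> \<omega>. \<Phi> (\<xi>, \<omega>)) I"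
    "has_iterated_integral \<mu>D \<mu>D (\<lambda>\<omega> \<xi>. \<Phi> (\<xi>, \<omega>)) I"
proof (rule radon_fubini[OF oirD oirD S(1,2) \<Phi>(1) S(3)])
  have bb: "(\<lambda>\<xi>. ennreal (b \<xi>)) \<in> borel_measurable borel"
    using ab(2) sD by (auto dest!: borel_measurable_integrable cong: measurable_cong_sets)
  have Tb: "(\<lambda>\<omega>. ennreal (b (T \<xi> \<omega>))) \<in> borel_measurable \<mu>D" for \<xi>
    using measurable_compose[OF borel_measurable_continuous_onI[OF T(1)] bb] sD by (simp cong:
        measurable_cong_sets)
  have "(\<integral>\<^sup>+\<xi>. \<integral>\<^sup>+\<omega>. ennreal (cmod (\<Phi> (\<xi>, \<omega>))) \<partial>\<mu>D \<partial>\<mu>D) \<le> (\<integral>\<^sup>+\<xi>. ennreal (a \<xi>) * (\<integral>\<^sup>+\<omega>. ennreal (b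
      \<omega>) \<partial>\<mu>D) \<partial>\<mu>D)"
  proof (rule nn_integral_mono)
    fix \<xi>
    have "(\<integral>\<^sup>+\<omega>. ennreal (cmod (\<Phi> (\<xi>, \<omega>))) \<partial>\<mu>D) \<le> (\<integral>\<^sup>+\<omega>. ennreal (a \<xi>) * ennreal (b (T \<xi> \<omega>)) \<partial>\<mu>D)"
      using \<Phi>(2) ab(3,4) by (intro nn_integral_mono) (simp add: ennreal_mult[symmetric] ennreal_leI)
    also have "\<dots> = ennreal (a \<xi>) * (\<integral>\<^sup>+\<omega>. ennreal (b \<omega>) \<partial>\<mu>D)"
      using Tb distr_invariance_nn[OF sD T bb] by (subst nn_integral_cmult) auto
    finally show "(\<integral>\<^sup>+\<omega>. ennreal (cmod (\<Phi> (\<xi>, \<omega>))) \<partial>\<mu>D) \<le> ennreal (a \<xi>) * (\<integral>\<^sup>+\<omega>. ennreal (b \<omega>) \<partial>\<mu>D)" .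
  qed
  also have "\<dots> = (\<integral>\<^sup>+\<xi>. ennreal (a \<xi>) \<partial>\<mu>D) * (\<integral>\<^sup>+\<omega>. ennreal (b \<omega>) \<partial>\<mu>D)"
    using ab(1) by (intro nn_integral_multc) auto
  also have "\<dots> < \<infinity>"
    using ab by (simp add: nn_integral_eq_integral ennreal_mult_less_top)
  finally show "(\<integral>\<^sup>+\<xi>. \<integral>\<^sup>+\<omega>. ennreal (cmod (\<Phi> (\<xi>, \<omega>))) \<partial>\<mu>D \<partial>\<mu>D) < \<infinity>" .
qed

text \<open>
  The Gabor coefficient on the frequency side, see \<open>inner_tf_shift\<close>.
\<close>

definition G where "G s \<omega> = (LINT \<xi>|\<mu>D. p \<xi> * cnj (q (\<xi> - \<omega>)) * char_at (\<xi> - \<omega>) s)"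

lemma cont_char_compose:
  fixes S :: "'c::topological_space \<Rightarrow> 'k dual" and T :: "'c \<Rightarrow> 'k"
  assumes "continuous_on UNIV S" "continuous_on UNIV T"
  shows "continuous_on UNIV (\<lambda>z. char_at (S z) (T z))"
proof -
  have "continuous_on UNIV (\<lambda>z. (\<lambda>w. char_at (fst w) (snd w)) (S z, T z))"
    by (intro continuous_on_compose2[OF continuous_char_at[OF lcK]] continuous_on_Pair assms) auto
  then show ?thesis by simp
qed

lemma G_translate: "G s \<omega> = W (\<lambda>\<xi>. p (\<xi> + \<omega>) * cnj (q \<xi>)) s"
proof -
  have m: "(\<lambda>\<xi>. p \<xi> * cnj (q (\<xi> - \<omega>)) * char_at (\<xi> - \<omega>) s) \<in> borel_measurable borel"
    by (intro borel_measurable_times borel_measurable_cnj pb borel_measurable_compose_continuous[OF qb]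
        borel_measurable_continuous_onI cont_char_compose continuous_intros)
  have "(\<lambda>\<xi>. p (\<xi> + \<omega>) * cnj (q (\<xi> + \<omega> - \<omega>)) * char_at (\<xi> + \<omega> - \<omega>) s) = (\<lambda>\<xi>. p (\<xi> + \<omega>) * cnj (q \<xi>) *
      char_at \<xi> s)"
    by simp
  then show ?thesis unfolding G_def inv_fourier_def using D_plus(1)[OF m, of \<omega>] by simp
qed

lemma L2_translate:
  assumes g: "g \<in> borel_measurable borel" and "integrable \<mu>D g" "g \<in> L2 \<mu>D"
  shows "integrable \<mu>D (\<lambda>\<xi>. g (\<xi> - \<omega>))" "(\<lambda>\<xi>. g (\<xi> - \<omega>)) \<in> L2 \<mu>D"
    "integrable \<mu>D (\<lambda>\<xi>. g (\<xi> + \<omega>))" "(\<lambda>\<xi>. g (\<xi> + \<omega>)) \<in> L2 \<mu>D"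
proof -
  have g2: "(\<lambda>\<xi>. (cmod (g \<xi>))\<^sup>2) \<in> borel_measurable borel" using g by measurable
  have plus: "integrable \<mu>D (\<lambda>\<xi>. g (\<xi> + \<omega>)) \<and> (\<lambda>\<xi>. g (\<xi> + \<omega>)) \<in> L2 \<mu>D" for \<omega>
    using D_plus(2)[OF g] D_plus(2)[OF g2] assms(2,3) by (auto simp: L2_def)
  show "integrable \<mu>D (\<lambda>\<xi>. g (\<xi> + \<omega>))" "(\<lambda>\<xi>. g (\<xi> + \<omega>)) \<in> L2 \<mu>D" using plus by auto
  show "integrable \<mu>D (\<lambda>\<xi>. g (\<xi> - \<omega>))" "(\<lambda>\<xi>. g (\<xi> - \<omega>)) \<in> L2 \<mu>D"
    using plus[of "- \<omega>"] by (simp_all only: diff_conv_add_uminus)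
qed

text \<open>
  The time-frequency shift of the inverse transform of \<open>q\<close> is the inverse transform of
  \<open>\<xi> \<mapsto> q (\<xi> - \<omega>) * cnj (char_at (\<xi> - \<omega>) s)\<close>, so that Parseval's formula applies.
\<close>

lemma inner_tf_shift:
  assumes v: "v \<in> L2 \<mu>K" "AE k in \<mu>K. v k = W p k" and u: "u \<in> L2 \<mu>K" "AE k in \<mu>K. u k = W q k"
  shows "L2_inner \<mu>K v (tf_shift s \<omega> u) = G s \<omega>"
proof -
  define g where "g \<xi> = q (\<xi> - \<omega>) * cnj (char_at (\<xi> - \<omega>) s)" for \<xi>
  have g: "integrable \<mu>D g" "g \<in> L2 \<mu>D"
  proof -
    have "(\<lambda>\<xi>. cnj (char_at (\<xi> - \<omega>) s)) \<in> borel_measurable borel"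
      by (intro borel_measurable_cnj borel_measurable_continuous_onI cont_char_compose
          continuous_intros)
    then have m: "(\<lambda>\<xi>. cnj (char_at (\<xi> - \<omega>) s)) \<in> borel_measurable \<mu>D" using sD by (simp cong:
        measurable_cong_sets)
    show "integrable \<mu>D g" "g \<in> L2 \<mu>D" unfolding g_def
      using L2_times_unimodular[OF L2_translate(1,2)[OF qb q] m] by (auto simp: char_at_props)
  qed
  have Wg: "W g y = char_at \<omega> y * W q (y - s)" for y
  proof -
    have m: "(\<lambda>\<xi>. g \<xi> * char_at \<xi> y) \<in> borel_measurable borel"
      using g(1) sD char_borel[of y] by (auto dest!: borel_measurable_integrable cong:
          measurable_cong_sets)
    have "W g y = (LINT \<xi>|\<mu>D. g (\<xi> + \<omega>) * char_at (\<xi> + \<omega>) y)"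
      unfolding inv_fourier_def using D_plus(1)[OF m, of \<omega>] by simp
    also have "\<dots> = (LINT \<xi>|\<mu>D. char_at \<omega> y * (q \<xi> * char_at \<xi> (y - s)))"
      by (simp add: g_def char_at_plus char_at_diff mult_ac)
    also have "\<dots> = char_at \<omega> y * W q (y - s)" by (simp add: inv_fourier_def)
    finally show ?thesis .
  qed
  have ae: "AE y in \<mu>K. u (y + (- s)) = W q (y + (- s))" by (rule K_plus_AE[OF u(2)])
  have ub: "u \<in> borel_measurable borel" using u(1) sK by (simp add: L2_def cong: measurable_cong_sets)
  have tm: "tf_shift s \<omega> u \<in> borel_measurable \<mu>K"
  proof -
    have "(\<lambda>y. u (y - s)) \<in> borel_measurable borel" by (intro borel_measurable_compose_continuous[OF
        ub] continuous_intros)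
    then have [measurable]: "(\<lambda>y. u (y - s)) \<in> borel_measurable \<mu>K" using sK by (simp cong:
        measurable_cong_sets)
    show ?thesis unfolding tf_shift_def[abs_def] by measurable
  qed
  have "L2_inner \<mu>K v (tf_shift s \<omega> u) = L2_inner \<mu>K (W p) (W g)"
    unfolding L2_inner_def
  proof (rule integral_cong_AE)
    show "AE y in \<mu>K. v y * cnj (tf_shift s \<omega> u y) = W p y * cnj (W g y)"
      using ae v(2) by eventually_elim (simp add: tf_shift_def Wg)
    have [measurable]: "v \<in> borel_measurable \<mu>K" using v by (simp add: L2_def)
    note [measurable] = tm inv_fourier_measurable(2)[OF p(1)] inv_fourier_measurable(2)[OF g(1)]
    show "(\<lambda>y. v y * cnj (tf_shift s \<omega> u y)) \<in> borel_measurable \<mu>K" "(\<lambda>y. W p y * cnj (W g y)) \<in>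
        borel_measurable \<mu>K"
      by measurable
  qed
  also have "\<dots> = L2_inner \<mu>D p g" by (rule inv_fourier_Parseval(2)[OF p g])
  also have "\<dots> = G s \<omega>" by (simp add: L2_inner_def G_def g_def mult.assoc)
  finally show ?thesis .
qed

lemma G_measurable: "(\<lambda>z. G (fst z) (snd z)) \<in> borel_measurable borel"
proof -
  define \<Phi> :: "('k \<times> 'k dual) \<times> 'k dual \<Rightarrow> complex"
    where "\<Phi> w = p (snd w) * cnj (q (snd w - snd (fst w))) * char_at (snd w - snd (fst w)) (fst (fst
        w))" for w
  have "\<Phi> \<in> borel_measurable borel"
    unfolding \<Phi>_def
    by (intro borel_measurable_times borel_measurable_cnj borel_measurable_compose_continuous[OF pb]
        borel_measurable_compose_continuous[OF qb]
        borel_measurable_continuous_onI cont_char_compose continuous_intros)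
  from measurable_integral_section[OF oirD opens(1) this] supp(1)
  have "(\<lambda>z. LINT \<xi>|\<mu>D. \<Phi> (z, \<xi>)) \<in> borel_measurable borel" by (simp add: \<Phi>_def)
  then show ?thesis by (simp add: \<Phi>_def G_def)
qed

text \<open>
  After the interchange, \<open>\<omega>\<close> is replaced by \<open>\<eta> = \<xi> - \<omega>\<close>.  The characters factor as
  \<open>(\<xi>-\<omega>)(s) \<omega>(k) = \<xi>(k) \<eta>(k-s)\<^sup>*\<close>, which separates the variables.
\<close>

lemma inner_frequency_integral:
  "integrable \<mu>D (\<lambda>\<omega>. G s \<omega> * char_at \<omega> k)"
  "(LINT \<omega>|\<mu>D. G s \<omega> * char_at \<omega> k) = W p k * cnj (W q (k - s))"
proof -
  define \<Phi> where "\<Phi> z = p (fst z) * cnj (q (fst z - snd z)) * char_at (fst z - snd z) s * char_at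
      (snd z) k" for z
  have \<Phi>: "\<Phi> \<in> borel_measurable borel"
    unfolding \<Phi>_def
    by (intro borel_measurable_times borel_measurable_cnj borel_measurable_compose_continuous[OF pb]
        borel_measurable_compose_continuous[OF qb]
        borel_measurable_continuous_onI cont_char_compose continuous_intros)
  obtain I where I: "has_iterated_integral \<mu>D \<mu>D (\<lambda>\<xi> \<omega>. \<Phi> (\<xi>, \<omega>)) I"
    "has_iterated_integral \<mu>D \<mu>D (\<lambda>\<omega> \<xi>. \<Phi> (\<xi>, \<omega>)) I"
  proof (rule dual_fubini[OF integrable_norm[OF p(1)] integrable_norm[OF q(1)] _ _
      continuous_on_affine(2) affD(2) \<Phi> _ opens(1,3)])
    show "cmod (\<Phi> (\<xi>, \<omega>)) \<le> cmod (p \<xi>) * cmod (q (\<xi> - \<omega>))" for \<xi> \<omega>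
      by (simp add: \<Phi>_def norm_mult char_at_props)
    show "\<Phi> (\<xi>, \<omega>) = 0" if "(\<xi>, \<omega>) \<notin> A \<times> C" for \<xi> \<omega>
      using that supp(1)[of \<xi>] supp(3)[of \<xi> "\<xi> - \<omega>"] by (auto simp: \<Phi>_def)
  qed auto
  have GI: "(LINT \<xi>|\<mu>D. \<Phi> (\<xi>, \<omega>)) = G s \<omega> * char_at \<omega> k" for \<omega>
    by (simp add: \<Phi>_def G_def)
  show "integrable \<mu>D (\<lambda>\<omega>. G s \<omega> * char_at \<omega> k)"
    using I(2) unfolding has_iterated_integral_def GI by simp
  have "(LINT \<omega>|\<mu>D. G s \<omega> * char_at \<omega> k) = (LINT \<xi>|\<mu>D. LINT \<omega>|\<mu>D. \<Phi> (\<xi>, \<omega>))"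
    using I unfolding has_iterated_integral_def GI by simp
  also have "\<dots> = (LINT \<xi>|\<mu>D. p \<xi> * char_at \<xi> k * cnj (W q (k - s)))"
  proof (rule Bochner_Integration.integral_cong[OF refl])
    fix \<xi>
    have m: "(\<lambda>\<eta>. cnj (q \<eta> * char_at \<eta> (k - s))) \<in> borel_measurable borel"
      by (intro borel_measurable_cnj borel_measurable_times qb char_borel)
    have "(LINT \<omega>|\<mu>D. \<Phi> (\<xi>, \<omega>)) = (LINT \<omega>|\<mu>D. p \<xi> * char_at \<xi> k * cnj (q (\<xi> - \<omega>) * char_at (\<xi> - \<omega>)
        (k - s)))"
    proof (rule Bochner_Integration.integral_cong[OF refl])
      fix \<omega>
      have "char_at (\<xi> - \<omega>) s * char_at \<omega> k = char_at \<xi> k * cnj (char_at (\<xi> - \<omega>) (k - s))"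
      proof -
        have "char_at \<xi> k * cnj (char_at (\<xi> - \<omega>) (k - s)) =
          (char_at \<xi> k * cnj (char_at \<xi> k)) * char_at (\<xi> - \<omega>) s * char_at \<omega> k"
          by (simp add: char_at_diff char_at_dual_diff mult_ac)
        then show ?thesis by (simp add: char_at_cnj_cancel)
      qed
      then show "\<Phi> (\<xi>, \<omega>) = p \<xi> * char_at \<xi> k * cnj (q (\<xi> - \<omega>) * char_at (\<xi> - \<omega>) (k - s))"
        by (simp add: \<Phi>_def mult_ac)
    qed
    also have "\<dots> = p \<xi> * char_at \<xi> k * (LINT \<omega>|\<mu>D. cnj (q \<omega> * char_at \<omega> (k - s)))"
      using D_minus(1)[OF m, of \<xi>] by simp
    also have "\<dots> = p \<xi> * char_at \<xi> k * cnj (W q (k - s))"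
      unfolding inv_fourier_def by (simp add: Bochner_Integration.integral_cnj del: complex_cnj_mult)
    finally show "(LINT \<omega>|\<mu>D. \<Phi> (\<xi>, \<omega>)) = p \<xi> * char_at \<xi> k * cnj (W q (k - s))" .
  qed
  also have "\<dots> = W p k * cnj (W q (k - s))" by (simp add: inv_fourier_def)
  finally show "(LINT \<omega>|\<mu>D. G s \<omega> * char_at \<omega> k) = W p k * cnj (W q (k - s))" .
qed

text \<open>
  The inner integral is \<open>inner_frequency_integral\<close>; invariance under \<open>s \<mapsto> k - s\<close> evaluates the outer one.
\<close>

lemma reconstruction_frequency_first:
  assumes u: "u \<in> L2 \<mu>K" "AE k in \<mu>K. u k = W q k"
  shows "has_iterated_integral \<mu>K \<mu>D (\<lambda>s \<omega>. G s \<omega> * tf_shift s \<omega> u k)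
    (W p k * complex_of_real (LINT y|\<mu>K. (cmod (u y))\<^sup>2))"
proof -
  have ub: "u \<in> borel_measurable borel" using u(1) sK by (simp add: L2_def cong: measurable_cong_sets)
  have e: "(\<lambda>\<omega>. G s \<omega> * tf_shift s \<omega> u k) = (\<lambda>\<omega>. G s \<omega> * char_at \<omega> k * u (k - s))" for s
    by (auto simp: tf_shift_def mult_ac)
  have i: "integrable \<mu>D (\<lambda>\<omega>. G s \<omega> * tf_shift s \<omega> u k)" for s
    unfolding e using inner_frequency_integral(1) by simp
  have L: "(LINT \<omega>|\<mu>D. G s \<omega> * tf_shift s \<omega> u k) = W p k * cnj (W q (k - s)) * u (k - s)" for s
    unfolding e using inner_frequency_integral(2)[of s k] by simp
  have u2b: "(\<lambda>y. complex_of_real ((cmod (u y))\<^sup>2)) \<in> borel_measurable borel" using ub by measurable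
  have u2: "integrable \<mu>K (\<lambda>y. complex_of_real ((cmod (u y))\<^sup>2))" using u(1)
    by (simp add: L2_def del: of_real_power)
  have us: "integrable \<mu>K (\<lambda>s. complex_of_real ((cmod (u (k - s)))\<^sup>2))"
    "(LINT s|\<mu>K. complex_of_real ((cmod (u (k - s)))\<^sup>2)) = (LINT y|\<mu>K. complex_of_real ((cmod (u
        y))\<^sup>2))"
    using K_minus[OF u2b, of k] u2 by auto
  have ae: "AE s in \<mu>K. W p k * cnj (W q (k - s)) * u (k - s) = W p k * complex_of_real ((cmod (u (k
      - s)))\<^sup>2)"
    using K_minus_AE[OF u(2), of k]
  proof eventually_elim
    case (elim s)
    have "cnj (u (k - s)) * u (k - s) = complex_of_real ((cmod (u (k - s)))\<^sup>2)"
      using complex_norm_square[of "u (k - s)"] by (simp add: mult.commute)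
    then show ?case using elim by (simp add: mult.assoc)
  qed
  have m: "(\<lambda>s. W p k * cnj (W q (k - s)) * u (k - s)) \<in> borel_measurable \<mu>K"
  proof -
    have "(\<lambda>s. W p k * cnj (W q (k - s)) * u (k - s)) \<in> borel_measurable borel"
      by (intro borel_measurable_times borel_measurable_cnj borel_measurable_compose_continuous[OF ub]
          borel_measurable_compose_continuous[OF inv_fourier_measurable(1)[OF q(1)]]
              continuous_intros borel_measurable_const)
    then show ?thesis using sK by (simp cong: measurable_cong_sets)
  qed
  have m': "(\<lambda>s. W p k * complex_of_real ((cmod (u (k - s)))\<^sup>2)) \<in> borel_measurable \<mu>K" using us(1)
      by auto
  have "integrable \<mu>K (\<lambda>s. W p k * cnj (W q (k - s)) * u (k - s))"
    unfolding integrable_cong_AE[OF m m' ae] using us(1) by simp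
  moreover have "(LINT s|\<mu>K. W p k * cnj (W q (k - s)) * u (k - s)) = W p k * complex_of_real (LINT
      y|\<mu>K. (cmod (u y))\<^sup>2)"
    unfolding integral_cong_AE[OF m m' ae] using us(2) by (simp del: of_real_power)
  ultimately show ?thesis unfolding has_iterated_integral_def L using i by simp
qed

lemma q_norm_square: "W q \<in> L2 \<mu>K" "(LINT k|\<mu>K. W q k * cnj (W q k)) = (LINT \<xi>|\<mu>D. q \<xi> * cnj (q \<xi>))"
  using inv_fourier_Parseval[OF q q] by (auto simp: L2_inner_def)

text \<open>
  For almost every \<open>\<omega>\<close> both \<open>G _ \<omega>\<close> and \<open>s \<mapsto> u (k - s)\<close> are square-integrable, the former as an inverse
  transform of \<open>g \<omega>\<close>.  Parseval's formula then rewrites their pairing on the frequency side.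
\<close>

lemma reconstruction_time_first:
  assumes u: "u \<in> L2 \<mu>K" "AE k in \<mu>K. u k = W q k"
  shows "has_iterated_integral \<mu>D \<mu>K (\<lambda>\<omega> s. G s \<omega> * tf_shift s \<omega> u k)
    (W p k * complex_of_real (LINT y|\<mu>K. (cmod (u y))\<^sup>2))"
proof -
  have ub: "u \<in> borel_measurable borel" using u(1) sK by (simp add: L2_def cong: measurable_cong_sets)
  have pm: "(\<lambda>z :: 'k dual \<times> 'k dual. p (snd z + fst z)) \<in> borel_measurable borel"
    and qm: "(\<lambda>z :: 'k dual \<times> 'k dual. q (fst z)) \<in> borel_measurable borel"
    by (intro borel_measurable_compose_continuous[OF pb] borel_measurable_compose_continuous[OF qb]
        continuous_intros)+
  have p2: "integrable \<mu>D (\<lambda>\<xi>. (cmod (p \<xi>))\<^sup>2)" and q2: "integrable \<mu>D (\<lambda>\<xi>. (cmod (q \<xi>))\<^sup>2)"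
    using p(2) q(2) by (auto simp: L2_def)
  have suppC: "\<omega> \<in> C" if "p (\<omega> + \<xi>) \<noteq> 0" "q \<xi> \<noteq> 0" for \<xi> \<omega>
    using supp(3)[OF that] by simp
  define g where "g \<omega> \<xi> = p (\<omega> + \<xi>) * cnj (q \<xi>)" for \<omega> \<xi>
  have Gg: "G s \<omega> = W (g \<omega>) s" for s \<omega>
    unfolding G_translate g_def by (simp add: add.commute)
  have g1: "integrable \<mu>D (g \<omega>)" for \<omega>
    unfolding g_def using L2_translate(4)[OF pb p, of \<omega>] q(2)
    by (intro L2_times_integrable L2_cnj) (auto simp: add.commute)
  define \<Psi> where "\<Psi> z = complex_of_real ((cmod (p (snd z + fst z)))\<^sup>2 * (cmod (q (fst z)))\<^sup>2)" for z
  have \<Psi>: "\<Psi> \<in> borel_measurable borel" unfolding \<Psi>_def using pm qm by measurable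
  obtain J where J: "has_iterated_integral \<mu>D \<mu>D (\<lambda>\<xi> \<omega>. \<Psi> (\<xi>, \<omega>)) J"
    "has_iterated_integral \<mu>D \<mu>D (\<lambda>\<omega> \<xi>. \<Psi> (\<xi>, \<omega>)) J"
  proof (rule dual_fubini[OF q2 p2 _ _ continuous_on_affine(1) affD(1) \<Psi> _ opens(2,3)])
    show "cmod (\<Psi> (\<xi>, \<omega>)) \<le> (cmod (q \<xi>))\<^sup>2 * (cmod (p (\<omega> + \<xi>)))\<^sup>2" for \<xi> \<omega>
      unfolding \<Psi>_def norm_of_real by (simp add: mult.commute)
    show "\<Psi> (\<xi>, \<omega>) = 0" if "(\<xi>, \<omega>) \<notin> B \<times> C" for \<xi> \<omega>
      using that supp(2)[of \<xi>] suppC[of \<omega> \<xi>] by (auto simp: \<Psi>_def)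
  qed auto
  have g2: "AE \<omega> in \<mu>D. g \<omega> \<in> L2 \<mu>D"
  proof -
    have "AE \<omega> in \<mu>D. integrable \<mu>D (\<lambda>\<xi>. \<Psi> (\<xi>, \<omega>))" using J(2) by (simp add: has_iterated_integral_def)
    then show ?thesis
    proof eventually_elim
      case (elim \<omega>)
      then have "integrable \<mu>D (\<lambda>\<xi>. cmod (\<Psi> (\<xi>, \<omega>)))" by (rule integrable_norm)
      moreover have "cmod (\<Psi> (\<xi>, \<omega>)) = (cmod (g \<omega> \<xi>))\<^sup>2" for \<xi>
        unfolding \<Psi>_def norm_of_real g_def by (simp add: norm_mult power_mult_distrib)
      ultimately show ?case using g1[of \<omega>] by (auto simp: L2_def)
    qed
  qed
  define h where "h \<xi> = cnj (q \<xi>) * cnj (char_at \<xi> k)" for \<xi>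
  have h: "integrable \<mu>D h" "h \<in> L2 \<mu>D"
    unfolding h_def using q
    by (auto intro!: L2_times_unimodular L2_cnj simp: char_at_props)
  have Wh: "W h s = cnj (W q (k - s))" for s
  proof -
    have "W h s = (LINT \<xi>|\<mu>D. cnj (q \<xi> * char_at \<xi> (k - s)))"
      unfolding inv_fourier_def by (simp add: h_def char_at_diff mult_ac)
    also have "\<dots> = cnj (W q (k - s))"
      unfolding inv_fourier_def by (rule Bochner_Integration.integral_cnj)
    finally show ?thesis .
  qed
  define \<Theta> where "\<Theta> z = p (snd z + fst z) * (q (fst z) * cnj (q (fst z))) * char_at (snd z + fst z)
      k" for z
  have \<Theta>: "\<Theta> \<in> borel_measurable borel" unfolding \<Theta>_def
    by (intro borel_measurable_times borel_measurable_cnj pm qm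
        borel_measurable_continuous_onI cont_char_compose continuous_intros)
  obtain I where I: "has_iterated_integral \<mu>D \<mu>D (\<lambda>\<xi> \<omega>. \<Theta> (\<xi>, \<omega>)) I"
    "has_iterated_integral \<mu>D \<mu>D (\<lambda>\<omega> \<xi>. \<Theta> (\<xi>, \<omega>)) I"
  proof (rule dual_fubini[OF q2 integrable_norm[OF p(1)] _ _ continuous_on_affine(1) affD(1) \<Theta> _
      opens(2,3)])
    show "cmod (\<Theta> (\<xi>, \<omega>)) \<le> (cmod (q \<xi>))\<^sup>2 * cmod (p (\<omega> + \<xi>))" for \<xi> \<omega>
      by (simp add: \<Theta>_def norm_mult char_at_props power2_eq_square)
    show "\<Theta> (\<xi>, \<omega>) = 0" if "(\<xi>, \<omega>) \<notin> B \<times> C" for \<xi> \<omega>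
      using that supp(2)[of \<xi>] suppC[of \<omega> \<xi>] by (auto simp: \<Theta>_def)
  qed auto
  have I_val: "I = W p k * complex_of_real (LINT y|\<mu>K. (cmod (u y))\<^sup>2)"
  proof -
    have "I = (LINT \<xi>|\<mu>D. LINT \<omega>|\<mu>D. \<Theta> (\<xi>, \<omega>))" using I(1) by (simp add: has_iterated_integral_def)
    also have "\<dots> = (LINT \<xi>|\<mu>D. q \<xi> * cnj (q \<xi>) * W p k)"
    proof (rule Bochner_Integration.integral_cong[OF refl])
      fix \<xi>
      have m: "(\<lambda>\<omega>. p \<omega> * char_at \<omega> k) \<in> borel_measurable borel" by (intro borel_measurable_times pb
          char_borel)
      have "(LINT \<omega>|\<mu>D. \<Theta> (\<xi>, \<omega>)) = (LINT \<omega>|\<mu>D. (q \<xi> * cnj (q \<xi>)) * (p (\<omega> + \<xi>) * char_at (\<omega> + \<xi>) k))"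
        by (simp add: \<Theta>_def mult_ac)
      also have "\<dots> = q \<xi> * cnj (q \<xi>) * W p k"
        unfolding inv_fourier_def using D_plus(1)[OF m, of \<xi>] by simp
      finally show "(LINT \<omega>|\<mu>D. \<Theta> (\<xi>, \<omega>)) = q \<xi> * cnj (q \<xi>) * W p k" .
    qed
    also have "\<dots> = (LINT \<xi>|\<mu>D. q \<xi> * cnj (q \<xi>)) * W p k" by simp
    also have "(LINT \<xi>|\<mu>D. q \<xi> * cnj (q \<xi>)) = (LINT y|\<mu>K. W q y * cnj (W q y))" by (simp add:
        q_norm_square)
    also have "\<dots> = (LINT y|\<mu>K. complex_of_real ((cmod (u y))\<^sup>2))"
    proof (rule integral_cong_AE)
      show "AE y in \<mu>K. W q y * cnj (W q y) = complex_of_real ((cmod (u y))\<^sup>2)"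
        using u(2) by eventually_elim (simp only: complex_norm_square)
    qed (use u(1) q_norm_square(1) in \<open>auto simp: L2_def\<close>)
    finally show ?thesis by (simp add: mult.commute del: of_real_power)
  qed
  have us: "(\<lambda>s. u (k - s)) \<in> L2 \<mu>K"
  proof -
    have u2b: "(\<lambda>y. (cmod (u y))\<^sup>2) \<in> borel_measurable borel" using ub by measurable
    have "(\<lambda>s. u (k - s)) \<in> borel_measurable borel" by (intro borel_measurable_compose_continuous[OF
        ub] continuous_intros)
    then show ?thesis using K_minus(2)[OF u2b, of k] u(1) sK by (simp add: L2_def cong:
        measurable_cong_sets)
  qed
  have inner: "AE \<omega> in \<mu>D. integrable \<mu>K (\<lambda>s. G s \<omega> * tf_shift s \<omega> u k) \<and>
      (LINT s|\<mu>K. G s \<omega> * tf_shift s \<omega> u k) = (LINT \<xi>|\<mu>D. \<Theta> (\<xi>, \<omega>))"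
    using g2
  proof eventually_elim
    case (elim \<omega>)
    note P = inv_fourier_Parseval[OF g1 elim h]
    have e: "(\<lambda>s. G s \<omega> * tf_shift s \<omega> u k) = (\<lambda>s. char_at \<omega> k * (W (g \<omega>) s * u (k - s)))"
      by (auto simp: tf_shift_def Gg mult_ac)
    have i: "integrable \<mu>K (\<lambda>s. W (g \<omega>) s * u (k - s))" by (rule L2_times_integrable[OF P(1) us])
    have "(LINT s|\<mu>K. W (g \<omega>) s * u (k - s)) = (LINT s|\<mu>K. W (g \<omega>) s * cnj (W h s))"
    proof (rule integral_cong_AE)
      show "AE s in \<mu>K. W (g \<omega>) s * u (k - s) = W (g \<omega>) s * cnj (W h s)"
        using K_minus_AE[OF u(2), of k] by eventually_elim (simp add: Wh)
      have [measurable]: "W (g \<omega>) \<in> borel_measurable \<mu>K" "W h \<in> borel_measurable \<mu>K"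
        using inv_fourier_measurable g1 h by auto
      show "(\<lambda>s. W (g \<omega>) s * cnj (W h s)) \<in> borel_measurable \<mu>K" by measurable
    qed (use i in auto)
    also have "\<dots> = (LINT \<xi>|\<mu>D. g \<omega> \<xi> * cnj (h \<xi>))" using P(2) by (simp add: L2_inner_def)
    finally have "(LINT s|\<mu>K. G s \<omega> * tf_shift s \<omega> u k) = (LINT \<xi>|\<mu>D. char_at \<omega> k * (g \<omega> \<xi> * cnj (h
        \<xi>)))"
      unfolding e by simp
    also have "\<dots> = (LINT \<xi>|\<mu>D. \<Theta> (\<xi>, \<omega>))"
      by (simp add: g_def h_def \<Theta>_def char_at_plus mult_ac)
    finally show ?case unfolding e using i by simp
  qed
  have m: "(\<lambda>\<omega>. LINT s|\<mu>K. G s \<omega> * tf_shift s \<omega> u k) \<in> borel_measurable \<mu>D"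
  proof -
    have "integrable \<mu>K (\<lambda>s. (cmod (u (k - s)))\<^sup>2)" using us by (simp add: L2_def)
    then obtain S where S: "sigma_open \<mu>K S" "\<And>s. s \<notin> S \<Longrightarrow> (cmod (u (k - s)))\<^sup>2 = 0"
      using integrable_sigma_open_support[OF RK] by blast
    define F :: "'k dual \<times> 'k \<Rightarrow> complex" where "F z = G (snd z) (fst z) * (char_at (fst z) k * u (k
        - snd z))" for z
    have "(\<lambda>z :: 'k dual \<times> 'k. (\<lambda>w. G (fst w) (snd w)) (snd z, fst z)) \<in> borel_measurable borel"
      by (intro borel_measurable_compose_continuous[OF G_measurable] continuous_intros)
    then have "F \<in> borel_measurable borel"
      unfolding F_def
      by (intro borel_measurable_times borel_measurable_compose_continuous[OF ub]
        borel_measurable_continuous_onI[OF cont_char_compose] continuous_intros) simp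
    from measurable_integral_section[OF oirK S(1) this] S(2)
    have "(\<lambda>\<omega>. LINT s|\<mu>K. F (\<omega>, s)) \<in> borel_measurable borel" by (simp add: F_def)
    then show ?thesis using sD by (simp add: F_def tf_shift_def cong: measurable_cong_sets)
  qed
  have I': "integrable \<mu>D (\<lambda>\<omega>. LINT \<xi>|\<mu>D. \<Theta> (\<xi>, \<omega>))" "(LINT \<omega>|\<mu>D. LINT \<xi>|\<mu>D. \<Theta> (\<xi>, \<omega>)) = I"
    using I(2) by (auto simp: has_iterated_integral_def)
  have ae: "AE \<omega> in \<mu>D. (LINT s|\<mu>K. G s \<omega> * tf_shift s \<omega> u k) = (LINT \<xi>|\<mu>D. \<Theta> (\<xi>, \<omega>))"
    using inner by eventually_elim simp
  show ?thesis
    unfolding has_iterated_integral_def I_val[symmetric]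
  proof (intro conjI)
    show "AE \<omega> in \<mu>D. integrable \<mu>K (\<lambda>s. G s \<omega> * tf_shift s \<omega> u k)"
      using inner by eventually_elim simp
    show "integrable \<mu>D (\<lambda>\<omega>. LINT s|\<mu>K. G s \<omega> * tf_shift s \<omega> u k)"
      using integrable_cong_AE[OF m _ ae] I'(1) by auto
    show "(LINT \<omega>|\<mu>D. LINT s|\<mu>K. G s \<omega> * tf_shift s \<omega> u k) = I"
      using integral_cong_AE[OF m _ ae] I' by auto
  qed
qed

theorem reconstruction:
  assumes v: "v \<in> L2 \<mu>K" "AE k in \<mu>K. v k = W p k" and u: "u \<in> L2 \<mu>K" "AE k in \<mu>K. u k = W q k"
  shows "has_product_integral \<mu>K \<mu>D (\<lambda>s \<omega>. L2_inner \<mu>K v (tf_shift s \<omega> u) * tf_shift s \<omega> u k)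
    (W p k * complex_of_real (LINT y|\<mu>K. (cmod (u y))\<^sup>2))"
  unfolding inner_tf_shift[OF assms] has_product_integral_def
proof (intro conjI allI impI)
  let ?I = "W p k * complex_of_real (LINT y|\<mu>K. (cmod (u y))\<^sup>2)"
  show 1: "has_iterated_integral \<mu>K \<mu>D (\<lambda>s \<omega>. G s \<omega> * tf_shift s \<omega> u k) ?I"
    by (rule reconstruction_frequency_first[OF u])
  show "has_iterated_integral \<mu>D \<mu>K (\<lambda>\<omega> s. G s \<omega> * tf_shift s \<omega> u k) ?I"
    by (rule reconstruction_time_first[OF u])
  fix \<pi> :: "('k \<times> 'k dual) measure"
  let ?F = "\<lambda>z. G (fst z) (snd z) * tf_shift (fst z) (snd z) u k"
  assume \<pi>: "radon_product (\<lambda>_. 1) \<mu>K \<mu>D \<pi>" and i: "integrable \<pi> ?F"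
  have "iterated_integrable (density \<mu>K (\<lambda>_. ennreal 1)) \<mu>D ?F (LINT z|\<pi>. ?F z)"
    by (rule radon_product_fubini[OF \<pi> RK RD lcK haar_locally_compact[OF haarD] _ _ i]) auto
  then have "iterated_integrable \<mu>K \<mu>D ?F (LINT z|\<pi>. ?F z)" by (simp add: density_1)
  from iterated_integrable_has_iterated_integral[OF this] 1
  show "(LINT z|\<pi>. ?F z) = ?I" by (simp add: has_iterated_integral_def borel_measurable_integrable)
qed

end

section \<open>Reconstruction\<close>

text \<open>
  Cutting off outside a sigma-compact carrier yields a representative that vanishes there
  everywhere, not only almost everywhere.
\<close>

lemma sigma_compact_modification:
  fixes M :: "'a::t2_space measure" and g :: "'a \<Rightarrow> complex"
  assumes M: "radon_measure M" and g: "integrable M g" "g \<in> L2 M"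
  obtains C :: "nat \<Rightarrow> 'a set" and g' where "incseq C" "\<And>n. compact (C n)" "\<And>x. x \<notin> (\<Union>n. C n) \<Longrightarrow> g' x = 0"
    "AE x in M. g' x = g x" "integrable M g'" "g' \<in> L2 M"
proof -
  obtain C :: "nat \<Rightarrow> 'a set" where C: "incseq C" "\<And>n. compact (C n)" "AE x in M. x \<notin> (\<Union>n. C n) \<longrightarrow> g x
      = 0"
    using integrable_sigma_compact_carrier[OF M g(1)] by blast
  define g' where "g' x = indicator (\<Union>n. C n) x * g x" for x
  have [measurable]: "C n \<in> sets M" for n
    using C(2) radon_measureD(1)[OF M] by (auto intro!: borel_closed compact_imp_closed)
  have gm[measurable]: "g \<in> borel_measurable M" using g by auto
  have g'm[measurable]: "g' \<in> borel_measurable M" unfolding g'_def by measurable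
  have ae: "AE x in M. g' x = g x" using C(3) by eventually_elim (auto simp: g'_def split:
      split_indicator)
  show thesis
  proof (rule that[of C g'])
    show "integrable M g'" using integrable_cong_AE[OF g'm gm ae] g(1) by simp
    have ae2: "AE x in M. (cmod (g' x))\<^sup>2 = (cmod (g x))\<^sup>2" using ae by eventually_elim simp
    have "integrable M (\<lambda>x. (cmod (g' x))\<^sup>2)" using integrable_cong_AE[OF _ _ ae2] g(2) by (simp
        add: L2_def)
    then show "g' \<in> L2 M" by (simp add: L2_def)
  qed (use C ae in \<open>auto simp: g'_def\<close>)
qed

context plancherel_pair
begin

theorem gabor_reconstruction:
  assumes v: "v \<in> L2 \<mu>K" "integrable \<mu>D (U v)" and u: "u \<in> L2 \<mu>K" "integrable \<mu>D (U u)"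
  shows "AE k in \<mu>K. has_product_integral \<mu>K \<mu>D
    (\<lambda>s \<omega>. L2_inner \<mu>K v (tf_shift s \<omega> u) * tf_shift s \<omega> u k)
    (v k * complex_of_real (LINT y|\<mu>K. (cmod (u y))\<^sup>2))"
proof -
  have UL: "U v \<in> L2 \<mu>D" "U u \<in> L2 \<mu>D"
    using transform v u unfolding plancherel_map_def L2_unitary_def by auto
  obtain C p where p: "incseq C" "\<And>n. compact (C n)" "\<And>\<xi>. \<xi> \<notin> (\<Union>n. C n) \<Longrightarrow> p \<xi> = 0"
    "AE \<xi> in \<mu>D. p \<xi> = U v \<xi>" "integrable \<mu>D p" "p \<in> L2 \<mu>D"
    using sigma_compact_modification[OF RD v(2) UL(1)] by blast
  obtain E q where q: "incseq E" "\<And>n. compact (E n)" "\<And>\<xi>. \<xi> \<notin> (\<Union>n. E n) \<Longrightarrow> q \<xi> = 0"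
    "AE \<xi> in \<mu>D. q \<xi> = U u \<xi>" "integrable \<mu>D q" "q \<in> L2 \<mu>D"
    using sigma_compact_modification[OF RD u(2) UL(2)] by blast
  note modp = p(4,5) and modq = q(4,5)
  \<comment> \<open>As \<open>C\<close> and \<open>E\<close> increase, these sets exhaust all differences.\<close>
  define F where "F n = (\<lambda>z. fst z - snd z) ` (C n \<times> E n)" for n
  have F: "compact (F n)" for n unfolding F_def
    by (intro compact_continuous_image compact_Times p q continuous_intros)
  have cover: "\<exists>A. sigma_open \<mu>D A \<and> (\<Union>n. K n) \<subseteq> A" if "\<And>n. compact (K n)" for K :: "nat \<Rightarrow> 'k dual set"
  proof -
    have "K n \<in> sets borel" "emeasure \<mu>D (K n) < \<infinity>" for n
      using that left_haar_measureD(4)[OF haarD] by (auto intro!: borel_closed compact_imp_closed)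
    then show ?thesis using sigma_open_cover[OF RD, of K] by metis
  qed
  obtain A where A: "sigma_open \<mu>D A" "(\<Union>n. C n) \<subseteq> A" using cover[of C] p(2) by blast
  obtain B where B: "sigma_open \<mu>D B" "(\<Union>n. E n) \<subseteq> B" using cover[of E] q(2) by blast
  obtain D where D: "sigma_open \<mu>D D" "(\<Union>n. F n) \<subseteq> D" using cover[of F] F by blast
  interpret gabor_pair \<mu>K \<mu>D U p q A B D
  proof
    show "p \<xi> = 0" if "\<xi> \<notin> A" for \<xi> using that A(2) p(3) by blast
    show "q \<xi> = 0" if "\<xi> \<notin> B" for \<xi> using that B(2) q(3) by blast
    show "\<xi> - \<eta> \<in> D" if "p \<xi> \<noteq> 0" "q \<eta> \<noteq> 0" for \<xi> \<eta>
    proof -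
      have "\<xi> \<in> (\<Union>n. C n)" "\<eta> \<in> (\<Union>n. E n)" using p(3)[of \<xi>] q(3)[of \<eta>] that by auto
      then obtain n m where nm: "\<xi> \<in> C n" "\<eta> \<in> E m" by blast
      have "C n \<subseteq> C (max n m)" "E m \<subseteq> E (max n m)" using p(1) q(1) by (auto simp: incseq_def)
      then have "\<xi> - \<eta> \<in> F (max n m)"
        unfolding F_def using nm by (intro image_eqI[of _ _ "(\<xi>, \<eta>)"]) auto
      then show ?thesis using D(2) by blast
    qed
  qed (use p q A B D in auto)
  have Wp: "W p k = inv_fourier \<mu>D (U v) k" and Wq: "W q k = inv_fourier \<mu>D (U u) k" for k
    unfolding inv_fourier_def using modp(1,2) modq(1,2) v(2) u(2) by (auto intro!: integral_cong_AE)
  have vW: "AE k in \<mu>K. v k = W p k" unfolding Wp by (rule inversion[OF v])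
  have uW: "AE k in \<mu>K. u k = W q k" unfolding Wq by (rule inversion[OF u])
  show ?thesis
    using vW by eventually_elim (use reconstruction[OF v(1) vW u(1) uW] in simp)
qed

end

text \<open>
  Fubini's theorem for \<open>|f|\<^sup>2\<close>; as \<open>w\<close> is positive, null sets of \<open>density \<mu> w\<close> are null sets of \<open>\<mu>\<close>.
\<close>

lemma radon_product_L2_sections:
  fixes \<mu> :: "'a::t2_space measure" and \<nu> :: "'b::t2_space measure"
  assumes \<pi>: "radon_product w \<mu> \<nu> \<pi>" and \<mu>: "radon_measure \<mu>" and \<nu>: "radon_measure \<nu>"
    and lc: "locally_compact_space (euclidean :: 'a topology)" "locally_compact_space (euclidean ::
        'b topology)"
    and w: "continuous_on UNIV w" "\<And>x. 0 < w x" and f: "f \<in> L2 \<pi>"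
  shows "AE x in \<mu>. (\<lambda>y. f (x, y)) \<in> L2 \<nu>"
proof -
  have s\<pi>: "sets \<pi> = sets borel" using \<pi> by (simp add: radon_product_def radon_measureD)
  have wb[measurable]: "w \<in> borel_measurable \<mu>"
    using borel_measurable_continuous_onI[OF w(1)] radon_measureD(1)[OF \<mu>] by (simp cong:
        measurable_cong_sets)
  have i: "integrable \<pi> (\<lambda>z. complex_of_real ((cmod (f z))\<^sup>2))" using f by (simp add: L2_def del:
      of_real_power)
  have "iterated_integrable (density \<mu> w) \<nu> (\<lambda>z. complex_of_real ((cmod (f z))\<^sup>2)) (LINT z|\<pi>.
      complex_of_real ((cmod (f z))\<^sup>2))"
    using w(2) by (intro radon_product_fubini[OF \<pi> \<mu> \<nu> lc w(1) _ i]) (auto intro: less_imp_le)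
  then have "AE x in density \<mu> w. integrable \<nu> (\<lambda>y. complex_of_real ((cmod (f (x, y)))\<^sup>2))"
    by (simp add: iterated_integrable_def del: of_real_power)
  then have "AE x in \<mu>. integrable \<nu> (\<lambda>y. complex_of_real ((cmod (f (x, y)))\<^sup>2))"
    using w(2) by (subst (asm) AE_density) (auto simp del: of_real_power)
  then show ?thesis
  proof eventually_elim
    case (elim x)
    have "f \<in> borel_measurable borel" using f s\<pi> by (simp add: L2_def cong: measurable_cong_sets)
    then have "(\<lambda>y. f (x, y)) \<in> borel_measurable \<nu>" using radon_measureD(1)[OF \<nu>] by (rule
        measurable_Pair_left_borel)
    then show ?case using elim unfolding L2_def complex_of_real_integrable_eq by simp
  qed
qed

theorem proposition3p6:
  fixes \<tau> :: "'h::{topological_group_add, t2_space} \<Rightarrow> 'k::{topological_ab_group_add, t2_space} \<Rightarrow> 'k"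
    and \<mu>H :: "'h measure" and \<mu>K :: "'k measure" and \<mu>D :: "'k dual measure"
    and \<mu>G :: "('h \<times> 'k) measure" and \<delta> :: "'h \<Rightarrow> real"
    and u :: "'k \<Rightarrow> complex" and f :: "'h \<times> 'k \<Rightarrow> complex"
  assumes "locally_compact_space (euclidean :: 'h topology)"
    and "locally_compact_space (euclidean :: 'k topology)"
    and "left_haar_measure (+) \<mu>H"
    and "left_haar_measure (+) \<mu>K"
    and "plancherel_measure \<mu>K \<mu>D"
    and "continuous_action \<tau>"
    and "modular_character \<tau> \<mu>K \<delta>"
    and "semidirect_haar \<tau> \<delta> \<mu>H \<mu>K \<mu>G"
    and "u \<in> L2 \<mu>K" and "L2_norm \<mu>K u \<noteq> 0"
    and "integrable \<mu>D (plancherel \<mu>K \<mu>D u)"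
    and "f \<in> L2 \<mu>G"
    and "AE h in \<mu>H. integrable \<mu>D (plancherel \<mu>K \<mu>D (\<lambda>k. f (h, k)))"
  shows "AE h in \<mu>H. AE k in \<mu>K. \<exists>I.
           has_product_integral \<mu>K \<mu>D
             (\<lambda>s \<omega>. partial_gabor \<mu>K \<delta> u f h s \<omega> * tf_shift s \<omega> u k) I \<and>
           f (h, k) = complex_of_real (\<delta> h powr (-1/2) * L2_norm \<mu>K u powr (-2)) * I"
proof -
  have \<delta>: "\<And>h. 0 < \<delta> h" "continuous_on UNIV \<delta>"
    using assms(7) by (auto simp: modular_character_def)
  have \<pi>: "radon_product \<delta> \<mu>H \<mu>K \<mu>G" using assms(8) by (simp add: semidirect_haar_def)
  have "plancherel_map \<mu>K \<mu>D (plancherel \<mu>K \<mu>D)"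
    unfolding plancherel_def using assms(5) by (intro someI_ex[of "plancherel_map \<mu>K \<mu>D"]) (simp
        add: plancherel_measure_def)
  then interpret plancherel_pair \<mu>K \<mu>D "plancherel \<mu>K \<mu>D"
    using assms(2,4,5) by unfold_locales (auto simp: plancherel_measure_def)
  define N where "N = (LINT y|\<mu>K. (cmod (u y))\<^sup>2)"
  have N: "L2_norm \<mu>K u = sqrt N" "0 < N"
  proof -
    show n: "L2_norm \<mu>K u = sqrt N" by (simp add: L2_norm_def N_def)
    have "0 \<le> N" by (simp add: N_def)
    then show "0 < N" using assms(10) n by (cases "N = 0") auto
  qed
  have Np: "L2_norm \<mu>K u powr (-2) = inverse N"
    using N(2) by (simp add: N(1) powr_minus powr_numeral)
  have "AE h in \<mu>H. (\<lambda>k. f (h, k)) \<in> L2 \<mu>K"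
    by (rule radon_product_L2_sections[OF \<pi> left_haar_measureD(1)[OF assms(3)] RK assms(1,2) \<delta>(2,1)
        assms(12)])
  then show ?thesis
    using assms(13)
  proof eventually_elim
    case (elim h)
    define c where "c = \<delta> h powr (1/2)"
    have c: "c \<noteq> 0" "\<delta> h powr (-1/2) = inverse c"
      using \<delta>(1)[of h] by (auto simp: c_def powr_minus[symmetric])
    show ?case
      using gabor_reconstruction[OF elim assms(9,11)]
    proof eventually_elim
      case (elim k)
      have "has_product_integral \<mu>K \<mu>D (\<lambda>s \<omega>. complex_of_real c *
          (L2_inner \<mu>K (\<lambda>k. f (h, k)) (tf_shift s \<omega> u) * tf_shift s \<omega> u k))
          (complex_of_real c * (f (h, k) * complex_of_real N))"
        using has_product_integral_cmult[OF elim, of "complex_of_real c"] c(1) by (simp add: N_def)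
      then have "has_product_integral \<mu>K \<mu>D (\<lambda>s \<omega>. partial_gabor \<mu>K \<delta> u f h s \<omega> * tf_shift s \<omega> u k)
          (complex_of_real c * (f (h, k) * complex_of_real N))"
        by (simp add: partial_gabor_def c_def mult.assoc)
      moreover have "f (h, k) = complex_of_real (\<delta> h powr (-1/2) * L2_norm \<mu>K u powr (-2)) *
          (complex_of_real c * (f (h, k) * complex_of_real N))"
      proof -
        have "complex_of_real c \<noteq> 0" "complex_of_real N \<noteq> 0" using c(1) N(2) by auto
        then show ?thesis unfolding c(2) Np by (simp add: field_simps)
      qed
      ultimately show ?case by blast
    qed
  qed
qed

end
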